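(* Consider the optimistic Basis Inverse Linear Feasibility Problem: given $A\in\mathbb{Q}^{m\times n}$, $B\in\mathbb{Q}^{m\times k}$, $b\in\mathbb{Q}^m$, $C\in\mathbb{Q}^{n\times k}$, $c\in\mathbb{Q}^n$, a polyhedron $X=\{x\in\mathbb{R}^k \mid Dx\le d\}$ with $D\in\mathbb{Q}^{g\times k}$, $d\in\mathbb{Q}^g$, and a basis $\bar{\mathcal B}$ of $A$, decide whether there exists $x\in X$ such that $\bar{\mathcal B}$ is an optimal basis for the LP $$\min\{(Cx+c)^\top y \mid Ay=Bx+b,\ y\in\mathbb{R}^n,\ y\ge 0\}.$$ This decision problem is NP-complete, and it remains NP-complete when restricted to instances with fixed objective function, i.e., with $C=0$.
   Context: All input data are rational and given in the usual binary encoding. A basis of $A\in\mathbb{R}^{m\times n}$ is an index set $\mathcal B\subseteq\{1,\dots,n\}$ such that the submatrix $A_{[\mathcal B]}$ of $A$ consisting of the columns with index in $\mathcal B$ is regular (square and invertible). For a right-hand side $\beta\in\mathbb{R}^m$, the basic solution associated with $\mathcal B$ is the vector $y\in\mathbb{R}^n$ with $y_{\mathcal B}=A_{[\mathcal B]}^{-1}\beta$ and $y_i=0$ for $i\notin\mathcal B$. A basis is optimal for the LP if its associated basic solution is feasible and optimal for the LP (here, $\beta=Bx+b$). *)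

theory Defs
  imports
    Jordan_Normal_Form.Gauss_Jordan_Elimination
    Jordan_Normal_Form.DL_Submatrix
    "HOL-Computational_Algebra.Polynomial"
begin

section \<open>Deterministic multitape Turing machines\<close>

text \<open>The tape alphabet is blank (\<^term>\<open>None\<close>), 0 and 1 (\<^term>\<open>Some False\<close>, \<^term>\<open>Some True\<close>).
  Tapes are infinite in both directions and are described relative to the head, which scans
  cell 0; moving the head shifts the tape.\<close>

type_synonym tape = "int \<Rightarrow> bool option"

datatype move = Left | Stay | Right

record tm =
  num_tapes :: nat
  num_states :: nat
  start :: nat
  accept :: nat
  reject :: nat
  delta :: "nat \<Rightarrow> bool option list \<Rightarrow> nat \<times> (bool option \<times> move) list"

text \<open>Only the restriction of the transition function to the finitely many arguments constrained
  here is ever used. Two tapes are needed for the input and for the output or certificate.\<close>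

definition wf_tm :: "tm \<Rightarrow> bool" where
  "wf_tm M \<longleftrightarrow> 2 \<le> num_tapes M \<and>
     start M < num_states M \<and> accept M < num_states M \<and> reject M < num_states M \<and>
     accept M \<noteq> reject M \<and>
     (\<forall>q < num_states M. \<forall>syms. length syms = num_tapes M \<longrightarrow>
        fst (delta M q syms) < num_states M \<and> length (snd (delta M q syms)) = num_tapes M)"

type_synonym config = "nat \<times> tape list"

fun shift :: "move \<Rightarrow> tape \<Rightarrow> tape" where
  "shift Left t = (\<lambda>i. t (i - 1))"
| "shift Stay t = t"
| "shift Right t = (\<lambda>i. t (i + 1))"

definition act :: "bool option \<times> move \<Rightarrow> tape \<Rightarrow> tape" where
  "act a t = shift (snd a) (t(0 := fst a))"

definition halted :: "tm \<Rightarrow> config \<Rightarrow> bool" where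
  "halted M cf \<longleftrightarrow> fst cf = accept M \<or> fst cf = reject M"

definition step :: "tm \<Rightarrow> config \<Rightarrow> config" where
  "step M cf =
     (if halted M cf then cf
      else let (q, as) = delta M (fst cf) (map (\<lambda>t. t 0) (snd cf))
           in (q, map2 act as (snd cf)))"

definition string_tape :: "bool list \<Rightarrow> tape" where
  "string_tape w = (\<lambda>i. if 0 \<le> i \<and> i < int (length w) then Some (w ! nat i) else None)"

text \<open>Tape \<open>j\<close> initially holds the \<open>j\<close>-th given string with the head on its first symbol;
  the remaining tapes are blank.\<close>

definition init_config :: "tm \<Rightarrow> bool list list \<Rightarrow> config" where
  "init_config M ws =
     (start M, map (\<lambda>j. string_tape (if j < length ws then ws ! j else [])) [0..<num_tapes M])"

definition run :: "tm \<Rightarrow> nat \<Rightarrow> bool list list \<Rightarrow> config" where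
  "run M t ws = (step M ^^ t) (init_config M ws)"

text \<open>The string on a tape is read from the head to the right up to the first blank.\<close>

definition reads_string :: "tape \<Rightarrow> bool list \<Rightarrow> bool" where
  "reads_string t w \<longleftrightarrow>
     (\<forall>i < length w. t (int i) = Some (w ! i)) \<and> t (int (length w)) = None"

section \<open>NP-completeness\<close>

definition poly_time_computable :: "(bool list \<Rightarrow> bool list) \<Rightarrow> bool" where
  "poly_time_computable f \<longleftrightarrow>
     (\<exists>M (p :: nat poly). wf_tm M \<and>
        (\<forall>w. let cf = run M (poly p (length w)) [w]
             in halted M cf \<and> reads_string (snd cf ! 1) (f w)))"

text \<open>Polynomial-time verifiers: the input is on the first tape and the certificate, of
  polynomially bounded length, on the second one.\<close>

definition NP :: "bool list set set" where
  "NP = {L. \<exists>M (p :: nat poly) (q :: nat poly). wf_tm M \<and>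
     (\<forall>w u. length u \<le> poly q (length w) \<longrightarrow> halted M (run M (poly p (length w)) [w, u])) \<and>
     (\<forall>w. w \<in> L \<longleftrightarrow>
        (\<exists>u. length u \<le> poly q (length w) \<and> fst (run M (poly p (length w)) [w, u]) = accept M))}"

definition poly_reducible :: "bool list set \<Rightarrow> bool list set \<Rightarrow> bool" where
  "poly_reducible L L' \<longleftrightarrow> (\<exists>f. poly_time_computable f \<and> (\<forall>w. w \<in> L \<longleftrightarrow> f w \<in> L'))"

definition NP_hard :: "bool list set \<Rightarrow> bool" where
  "NP_hard L \<longleftrightarrow> (\<forall>L' \<in> NP. poly_reducible L' L)"

definition NP_complete :: "bool list set \<Rightarrow> bool" where
  "NP_complete L \<longleftrightarrow> L \<in> NP \<and> NP_hard L"

section \<open>Bases and linear programs\<close>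

text \<open>Rows and columns are indexed from 0.\<close>

definition is_basis :: "'a :: field mat \<Rightarrow> nat set \<Rightarrow> bool" where
  "is_basis A I \<longleftrightarrow> I \<subseteq> {..<dim_col A} \<and> invertible_mat (submatrix A UNIV I)"

text \<open>Column \<open>i \<in> I\<close> of \<open>A\<close> is column \<open>card {j \<in> I. j < i}\<close> of the submatrix.\<close>

definition basic_solution :: "'a :: field mat \<Rightarrow> 'a vec \<Rightarrow> nat set \<Rightarrow> 'a vec" where
  "basic_solution A \<beta> I = vec (dim_col A)
     (\<lambda>i. if i \<in> I then (the (mat_inverse (submatrix A UNIV I)) *\<^sub>v \<beta>) $ card {j \<in> I. j < i}
          else 0)"

text \<open>The linear program is: minimise \<open>q \<bullet> y\<close> subject to \<open>A y = \<beta>\<close> and \<open>y \<ge> 0\<close>.\<close>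

definition lp_feasible :: "real mat \<Rightarrow> real vec \<Rightarrow> real vec \<Rightarrow> bool" where
  "lp_feasible A \<beta> y \<longleftrightarrow>
     y \<in> carrier_vec (dim_col A) \<and> A *\<^sub>v y = \<beta> \<and> 0\<^sub>v (dim_col A) \<le> y"

definition lp_optimal :: "real vec \<Rightarrow> real mat \<Rightarrow> real vec \<Rightarrow> real vec \<Rightarrow> bool" where
  "lp_optimal q A \<beta> y \<longleftrightarrow>
     lp_feasible A \<beta> y \<and> (\<forall>z. lp_feasible A \<beta> z \<longrightarrow> q \<bullet> y \<le> q \<bullet> z)"

definition optimal_basis :: "real vec \<Rightarrow> real mat \<Rightarrow> real vec \<Rightarrow> nat set \<Rightarrow> bool" where
  "optimal_basis q A \<beta> I \<longleftrightarrow> is_basis A I \<and> lp_optimal q A \<beta> (basic_solution A \<beta> I)"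

section \<open>The optimistic Basis Inverse Linear Feasibility Problem\<close>

record inst =
  matA :: "rat mat"
  matB :: "rat mat"
  vecb :: "rat vec"
  matC :: "rat mat"
  vecc :: "rat vec"
  matD :: "rat mat"
  vecd :: "rat vec"
  basis :: "nat set"

abbreviation dim_m :: "inst \<Rightarrow> nat" where "dim_m P \<equiv> dim_row (matA P)"
abbreviation dim_n :: "inst \<Rightarrow> nat" where "dim_n P \<equiv> dim_col (matA P)"
abbreviation dim_k :: "inst \<Rightarrow> nat" where "dim_k P \<equiv> dim_col (matB P)"
abbreviation dim_g :: "inst \<Rightarrow> nat" where "dim_g P \<equiv> dim_row (matD P)"

definition is_instance :: "inst \<Rightarrow> bool" where
  "is_instance P \<longleftrightarrow>
     matB P \<in> carrier_mat (dim_m P) (dim_k P) \<and> vecb P \<in> carrier_vec (dim_m P) \<and>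
     matC P \<in> carrier_mat (dim_n P) (dim_k P) \<and> vecc P \<in> carrier_vec (dim_n P) \<and>
     matD P \<in> carrier_mat (dim_g P) (dim_k P) \<and> vecd P \<in> carrier_vec (dim_g P) \<and>
     is_basis (matA P) (basis P)"

abbreviation real_mat :: "rat mat \<Rightarrow> real mat" where "real_mat \<equiv> map_mat real_of_rat"
abbreviation real_vec :: "rat vec \<Rightarrow> real vec" where "real_vec \<equiv> map_vec real_of_rat"

definition polyhedron :: "real mat \<Rightarrow> real vec \<Rightarrow> real vec set" where
  "polyhedron D d = {x \<in> carrier_vec (dim_col D). D *\<^sub>v x \<le> d}"

definition optimistic_BILFP :: "inst \<Rightarrow> bool" where
  "optimistic_BILFP P \<longleftrightarrow>
     (\<exists>x \<in> polyhedron (real_mat (matD P)) (real_vec (vecd P)).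
        optimal_basis (real_mat (matC P) *\<^sub>v x + real_vec (vecc P)) (real_mat (matA P))
          (real_mat (matB P) *\<^sub>v x + real_vec (vecb P)) (basis P))"

subsection \<open>Binary encoding of instances\<close>

text \<open>Numbers are written in binary, least significant bit first, each bit preceded by
  \<^term>\<open>True\<close> and the whole terminated by \<^term>\<open>False\<close>. Rationals are encoded as reduced
  fractions. Dimensions are written in unary, which does not change the order of magnitude of
  the input size, as all entries are listed anyway. The basis is given by its characteristic
  vector.\<close>

fun bits :: "nat \<Rightarrow> bool list" where
  "bits n = (if n = 0 then [] else odd n # bits (n div 2))"

declare bits.simps [simp del]

definition enc_nat :: "nat \<Rightarrow> bool list" where
  "enc_nat n = concat (map (\<lambda>b. [True, b]) (bits n)) @ [False]"

definition enc_int :: "int \<Rightarrow> bool list" where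
  "enc_int z = (z < 0) # enc_nat (nat \<bar>z\<bar>)"

definition enc_rat :: "rat \<Rightarrow> bool list" where
  "enc_rat r = enc_int (fst (quotient_of r)) @ enc_int (snd (quotient_of r))"

definition enc_unary :: "nat \<Rightarrow> bool list" where
  "enc_unary n = replicate n True @ [False]"

definition enc_vec :: "rat vec \<Rightarrow> bool list" where
  "enc_vec v = concat (map enc_rat (list_of_vec v))"

definition enc_mat :: "rat mat \<Rightarrow> bool list" where
  "enc_mat A = concat (map enc_vec (rows A))"

definition encode :: "inst \<Rightarrow> bool list" where
  "encode P =
     enc_unary (dim_m P) @ enc_unary (dim_n P) @ enc_unary (dim_k P) @ enc_unary (dim_g P) @
     enc_mat (matA P) @ enc_mat (matB P) @ enc_vec (vecb P) @ enc_mat (matC P) @ enc_vec (vecc P) @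
     enc_mat (matD P) @ enc_vec (vecd P) @ map (\<lambda>j. j \<in> basis P) [0..<dim_n P]"

text \<open>The language of a decision problem whose instances are the instances above that satisfy
  \<open>R\<close>: the encodings of the instances with a positive answer.\<close>

definition BILFP_language :: "(inst \<Rightarrow> bool) \<Rightarrow> bool list set" where
  "BILFP_language R = encode ` {P. is_instance P \<and> R P \<and> optimistic_BILFP P}"

definition fixed_objective :: "inst \<Rightarrow> bool" where
  "fixed_objective P \<longleftrightarrow> matC P = 0\<^sub>m (dim_n P) (dim_k P)"

text \<open>The encoding is unambiguous.\<close>

lemma bits_0: "bits 0 = []"
  by (subst bits.simps) simp

lemma bits_pos: "n \<noteq> 0 \<Longrightarrow> bits n = odd n # bits (n div 2)"
  by (subst bits.simps) simp

lemma bits_inj: "bits m = bits n \<Longrightarrow> m = n"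
proof (induction m arbitrary: n rule: less_induct)
  case (less m)
  consider "m = 0" "n = 0" | "m = 0" "n \<noteq> 0" | "m \<noteq> 0" "n = 0" | "m \<noteq> 0" "n \<noteq> 0" by blast
  then show ?case
  proof cases
    case 4
    have "odd m # bits (m div 2) = odd n # bits (n div 2)"
      using less.prems unfolding bits_pos[OF 4(1)] bits_pos[OF 4(2)] .
    then have par: "odd m = odd n" and half: "bits (m div 2) = bits (n div 2)"
      unfolding list.inject by blast+
    have "m div 2 = n div 2" using less.IH[OF _ half] 4 by simp
    then show ?thesis using par by presburger
  next
    case 2
    show ?thesis using less.prems unfolding 2(1) bits_0 bits_pos[OF 2(2)] by blast
  next
    case 3
    show ?thesis using less.prems unfolding 3(2) bits_0 bits_pos[OF 3(1)] by blast
  qed simp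
qed

lemma enc_nat_prefix: "enc_nat m @ u = enc_nat n @ v \<Longrightarrow> m = n \<and> u = v"
proof -
  have "concat (map (\<lambda>b. [True, b]) xs) @ False # u = concat (map (\<lambda>b. [True, b]) ys) @ False # v
    \<Longrightarrow> xs = ys \<and> u = v" for xs ys :: "bool list"
  proof (induction xs arbitrary: ys)
    case Nil then show ?case by (cases ys) auto
  next
    case (Cons x xs) then show ?case by (cases ys) auto
  qed
  then show "enc_nat m @ u = enc_nat n @ v \<Longrightarrow> m = n \<and> u = v"
    unfolding enc_nat_def append.assoc append.simps using bits_inj by blast
qed

lemma enc_int_prefix: "enc_int m @ u = enc_int n @ v \<Longrightarrow> m = n \<and> u = v"
proof -
  assume "enc_int m @ u = enc_int n @ v"
  then have 1: "(m < 0) = (n < 0)" and 2: "enc_nat (nat \<bar>m\<bar>) @ u = enc_nat (nat \<bar>n\<bar>) @ v"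
    unfolding enc_int_def by simp_all
  from enc_nat_prefix[OF 2] 1 show "m = n \<and> u = v" by linarith
qed

lemma enc_rat_prefix: "enc_rat r @ u = enc_rat s @ v \<Longrightarrow> r = s \<and> u = v"
proof -
  assume eq: "enc_rat r @ u = enc_rat s @ v"
  note 1 = enc_int_prefix[OF eq[unfolded enc_rat_def append.assoc]]
  note 2 = enc_int_prefix[OF conjunct2[OF 1]]
  show "r = s \<and> u = v"
    using 1 2 by (blast intro: quotient_of_inject prod_eqI)
qed

lemma enc_unary_prefix: "enc_unary m @ u = enc_unary n @ v \<Longrightarrow> m = n \<and> u = v"
proof (induction m arbitrary: n)
  case 0 then show ?case by (cases n) (auto simp: enc_unary_def)
next
  case (Suc m)
  show ?case
  proof (cases n)
    case 0 then show ?thesis using Suc.prems by (simp add: enc_unary_def)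
  next
    case n: (Suc n')
    have "enc_unary m @ u = enc_unary n' @ v" using Suc.prems n by (simp add: enc_unary_def)
    from Suc.IH[OF this] n show ?thesis by blast
  qed
qed

lemma concat_map_prefix:
  assumes "\<And>a b u v. P a b \<Longrightarrow> e a @ u = e b @ v \<Longrightarrow> a = b \<and> u = v"
    and "list_all2 P xs ys" and "concat (map e xs) @ u = concat (map e ys) @ v"
  shows "xs = ys \<and> u = v"
  using assms(2,3)
proof (induction rule: list_all2_induct)
  case (Cons x xs y ys)
  have "e x @ (concat (map e xs) @ u) = e y @ (concat (map e ys) @ v)" using Cons.prems by simp
  note hd = assms(1)[OF Cons.hyps(1) this]
  from hd Cons.IH[OF conjunct2[OF hd]] show ?case by blast
qed simp

lemma enc_vec_prefix:
  assumes "dim_vec a = dim_vec b" "enc_vec a @ u = enc_vec b @ v"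
  shows "a = b \<and> u = v"
proof -
  have len: "list_all2 (\<lambda>_ _. True) (list_of_vec a) (list_of_vec b)"
    using assms(1) by (simp add: list_all2_conv_all_nth)
  have "list_of_vec a = list_of_vec b \<and> u = v"
    by (rule concat_map_prefix[OF _ len assms(2)[unfolded enc_vec_def]]) (rule enc_rat_prefix)
  then show ?thesis using arg_cong[of "list_of_vec a" "list_of_vec b" vec_of_list]
    unfolding vec_list by blast
qed

lemma enc_mat_prefix:
  assumes "dim_row A = dim_row B" "dim_col A = dim_col B" "enc_mat A @ u = enc_mat B @ v"
  shows "A = B \<and> u = v"
proof -
  have dims: "list_all2 (\<lambda>a b. dim_vec a = dim_vec b) (rows A) (rows B)"
    using assms(1,2) by (simp add: list_all2_conv_all_nth)
  have "rows A = rows B \<and> u = v"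
    by (rule concat_map_prefix[OF _ dims assms(3)[unfolded enc_mat_def]]) (rule enc_vec_prefix)
  then have rows: "rows A = rows B" and "u = v" by blast+
  have "A = mat_of_rows (dim_col A) (rows A)" by (rule mat_of_rows_rows[symmetric])
  also have "\<dots> = B" unfolding rows assms(2) by (rule mat_of_rows_rows)
  finally show ?thesis using \<open>u = v\<close> by blast
qed

lemma encode_inj: "inj_on encode {P. is_instance P}"
proof (rule inj_onI, unfold mem_Collect_eq)
  fix P Q assume P: "is_instance P" and Q: "is_instance Q" and eq: "encode P = encode Q"
  note e1 = enc_unary_prefix[OF eq[unfolded encode_def]]
  note e2 = enc_unary_prefix[OF conjunct2[OF e1]]
  note e3 = enc_unary_prefix[OF conjunct2[OF e2]]
  note e4 = enc_unary_prefix[OF conjunct2[OF e3]]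
  note dims = conjunct1[OF e1] conjunct1[OF e2] conjunct1[OF e3] conjunct1[OF e4]
  have c: "matB X \<in> carrier_mat (dim_m X) (dim_k X)" "vecb X \<in> carrier_vec (dim_m X)"
    "matC X \<in> carrier_mat (dim_n X) (dim_k X)" "vecc X \<in> carrier_vec (dim_n X)"
    "matD X \<in> carrier_mat (dim_g X) (dim_k X)" "vecd X \<in> carrier_vec (dim_g X)"
    "basis X \<subseteq> {..<dim_n X}" if "is_instance X" for X
    using that by (simp_all add: is_instance_def is_basis_def)
  note cP = c[OF P] and cQ = c[OF Q]
  have d: "dim_row (matB P) = dim_row (matB Q)" "dim_vec (vecb P) = dim_vec (vecb Q)"
    "dim_row (matC P) = dim_row (matC Q)" "dim_col (matC P) = dim_col (matC Q)"
    "dim_vec (vecc P) = dim_vec (vecc Q)" "dim_col (matD P) = dim_col (matD Q)"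
    "dim_vec (vecd P) = dim_vec (vecd Q)"
    using cP cQ dims by (simp_all only: carrier_mat_def carrier_vec_def mem_Collect_eq)
  note f1 = enc_mat_prefix[OF dims(1,2) conjunct2[OF e4]]
  note f2 = enc_mat_prefix[OF d(1) dims(3) conjunct2[OF f1]]
  note f3 = enc_vec_prefix[OF d(2) conjunct2[OF f2]]
  note f4 = enc_mat_prefix[OF d(3,4) conjunct2[OF f3]]
  note f5 = enc_vec_prefix[OF d(5) conjunct2[OF f4]]
  note f6 = enc_mat_prefix[OF dims(4) d(6) conjunct2[OF f5]]
  note f7 = enc_vec_prefix[OF d(7) conjunct2[OF f6]]
  have "j \<in> basis P \<longleftrightarrow> j \<in> basis Q" if "j < dim_n Q" for j
    using conjunct2[OF f7] that unfolding dims(2) by (simp add: map_eq_conv)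
  then have "basis P = basis Q" using cP(7) cQ(7) unfolding dims(2) by blast
  then show "P = Q" using f1 f2 f3 f4 f5 f6 f7 by (intro inst.equality) simp_all
qed

text \<open>On a basis, the chosen matrix in \<^const>\<open>basic_solution\<close> is the inverse.\<close>

lemma invertible_mat_inverse:
  fixes S :: "'a :: field mat"
  assumes "invertible_mat S"
  shows "\<exists>N. mat_inverse S = Some N \<and> inverts_mat N S \<and> inverts_mat S N"
proof -
  define n where "n = dim_row S"
  obtain B where "square_mat S" and B: "S * B = 1\<^sub>m n" "B * S = 1\<^sub>m (dim_row B)"
    using assms unfolding invertible_mat_def inverts_mat_def n_def by blast
  then have S: "S \<in> carrier_mat n n" by (intro carrier_matI) (simp_all add: n_def)
  have "dim_col B = n"
    using arg_cong[OF B(1), of dim_col] by (simp only: index_mult_mat index_one_mat)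
  moreover have "dim_row B = n"
    using arg_cong[OF B(2), of dim_col] carrier_matD[OF S]
    by (simp only: index_mult_mat index_one_mat)
  ultimately have B': "B \<in> carrier_mat n n" "B * S = 1\<^sub>m n"
    using B(2) by (auto intro: carrier_matI)
  have U: "S \<in> Units (ring_mat TYPE('a) n ())"
    unfolding Units_def ring_mat_simps mem_Collect_eq using S B' B(1) by blast
  show ?thesis
  proof (cases "mat_inverse S")
    case None
    then show ?thesis using mat_inverse(1)[OF S None, where b = "()"] U by blast
  next
    case (Some N)
    have inv: "S * N = 1\<^sub>m n" "N * S = 1\<^sub>m n" "dim_row N = n"
      using mat_inverse(2)[OF S Some] by auto
    show ?thesis
      using Some inv unfolding inverts_mat_def n_def by simp
  qed
qed

end

theory Submission
  imports Defs "Jordan_Normal_Form.Determinant"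
begin

text \<open>Membership. A basis is optimal for some parameter iff a system of linear equations with sign
  and complementarity conditions is solvable: by duality it suffices to find a parameter, a primal
  and a dual solution with complementary slackness, and an inverse of the basis matrix. After
  homogenising the system, an integral solution of minimal support with the same signs has entries
  of polynomial length, by Cramer's rule for a Gram matrix; it is the certificate.

  Hardness. The runs of a nondeterministic polynomial-time verifier are described by a propositional
  formula in conjunctive normal form. Its variables become the parameters of an instance whose fixed
  objective rewards one column per clause. With the slack columns as the basis, the column of a
  clause has a negative reduced cost, so the basis is optimal iff these columns are blocked by
  vanishing right-hand sides, that is, iff every clause contains a true literal.

  Polynomial time is handled through a small language of programs on four stacks, which compile to
  Turing machines and compute a class of functions with good closure properties.\<close>

section \<open>Stack programs\<close>

text \<open>The verifier never parses its input: the certificate carries the numbers of an instance,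
  and the verifier writes down their encoding and compares it with the input. Since
  \<open>enc_rat\<close> admits reduced fractions only, reducedness has to be checked, and Bezout
  coefficients turn this into one equation between products. With numbers split into positive and
  negative parts and denominators cleared, the arithmetic consists of sums, products and comparisons
  of naturals; indices are small enough to be written in unary. The parameters are real, so a
  rational solution has to be extracted. The solution set need not have a vertex, and
  complementarity may make it nonconvex. A solution that has no sign which a given solution lacks
  inherits nonnegativity, complementarity and support conditions at once, so the search is
  restricted to such solutions. The Gram matrix avoids the choice of independent rows. In the
  reduction the parameters may be fractional. Only the vanishing of entries of the right-hand side
  counts, so integrality is never enforced.\<close>

datatype reg = R0 | R1 | R2 | R3

datatype com =
    Push reg bool
  | Write reg bool
  | Pop reg
  | Seq com com
  | Branch reg "bool option set" com com
  | Loop reg "bool option set" com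

fun top_bit :: "bool list \<Rightarrow> bool option" where
  "top_bit [] = None"
| "top_bit (b # _) = Some b"

text \<open>The times are exact counts of moves of the compiled machine, which is why a push costs 2
  and control flow costs 1. \<open>Write\<close> has no rule, as it is only the second half of a
  push. An empty register shows \<open>None\<close>, the blank.\<close>

inductive exec :: "com \<Rightarrow> (reg \<Rightarrow> bool list) \<Rightarrow> nat \<Rightarrow> (reg \<Rightarrow> bool list) \<Rightarrow> bool" where
  Push: "exec (Push r b) s 2 (s(r := b # s r))"
| Pop: "exec (Pop r) s 1 (s(r := tl (s r)))"
| Seq: "exec a s t s' \<Longrightarrow> exec b s' u s'' \<Longrightarrow> exec (Seq a b) s (Suc (t + u)) s''"
| BranchT: "top_bit (s r) \<in> X \<Longrightarrow> exec a s t s' \<Longrightarrow> exec (Branch r X a b) s (Suc t) s'"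
| BranchF: "top_bit (s r) \<notin> X \<Longrightarrow> exec b s t s' \<Longrightarrow> exec (Branch r X a b) s (Suc t) s'"
| LoopF: "top_bit (s r) \<notin> X \<Longrightarrow> exec (Loop r X a) s 1 s"
| LoopT: "top_bit (s r) \<in> X \<Longrightarrow> exec a s t s' \<Longrightarrow> exec (Loop r X a) s' u s'' \<Longrightarrow>
    exec (Loop r X a) s (Suc (t + u)) s''"

lemma exec_length: "exec c s t s' \<Longrightarrow> length (s' r) \<le> length (s r) + t"
  by (induction rule: exec.induct) auto

subsection \<open>Compilation to Turing machines\<close>

text \<open>The control state of the machine is the list of the commands that remain to be executed.
  A push takes two moves: to the cell left of the head, and then the write (\<^const>\<open>Write\<close> only
  arises in this way).\<close>

fun control :: "com list \<Rightarrow> (reg \<Rightarrow> bool option) \<Rightarrow> com list" where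
  "control [] y = []"
| "control (Push r b # k) y = Write r b # k"
| "control (Write r b # k) y = k"
| "control (Pop r # k) y = k"
| "control (Seq a b # k) y = a # b # k"
| "control (Branch r X a b # k) y = (if y r \<in> X then a else b) # k"
| "control (Loop r X a # k) y = (if y r \<in> X then a # Loop r X a # k else k)"

fun operate :: "com list \<Rightarrow> (reg \<Rightarrow> bool option) \<Rightarrow> reg \<Rightarrow> bool option \<times> move" where
  "operate (Push r b # k) y r' = (y r', if r' = r then Left else Stay)"
| "operate (Write r b # k) y r' = (if r' = r then Some b else y r', Stay)"
| "operate (Pop r # k) y r' = (if r' = r then (None, Right) else (y r', Stay))"
| "operate _ y r' = (y r', Stay)"

text \<open>The continuation of a loop body is always the same loop, so unrolling creates no new
  continuations and the set stays finite. The halting control \<open>[]\<close> is left out and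
  added separately where it is needed.\<close>

fun reachable :: "com \<Rightarrow> com list set" where
  "reachable (Push r b) = {[Push r b], [Write r b]}"
| "reachable (Seq a b) = {[Seq a b]} \<union> (\<lambda>k. k @ [b]) ` reachable a \<union> reachable b"
| "reachable (Branch r X a b) = {[Branch r X a b]} \<union> reachable a \<union> reachable b"
| "reachable (Loop r X a) = {[Loop r X a]} \<union> (\<lambda>k. k @ [Loop r X a]) ` reachable a"
| "reachable c = {[c]}"

lemma finite_reachable: "finite (reachable c)"
  by (induction c) auto

lemma self_reachable: "[c] \<in> reachable c"
  by (cases c) auto

lemma control_append: "k \<noteq> [] \<Longrightarrow> control (k @ l) y = control k y @ l"
  by (cases "(k, y)" rule: control.cases) auto

lemma Nil_not_reachable: "[] \<notin> reachable c"
  by (induction c) auto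

text \<open>Only the head of a control is rewritten, so a control inside a subcommand keeps its
  suffix (\<open>control_append\<close>) and the induction hypothesis applies to the prefix. If the
  prefix becomes empty, the suffix alone is again reachable.\<close>

lemma control_reachable: "k \<in> reachable c \<Longrightarrow> control k y \<in> insert [] (reachable c)"
proof (induction c arbitrary: k)
  case (Seq a b)
  show ?case
  proof (cases "k = [Seq a b]")
    case True
    then show ?thesis using self_reachable[of a] by (auto simp: image_iff)
  next
    case False
    then consider k' where "k = k' @ [b]" "k' \<in> reachable a" | "k \<in> reachable b"
      using Seq.prems by auto
    then show ?thesis
    proof cases
      case 1
      then have "k' \<noteq> []" using Nil_not_reachable by metis
      then show ?thesis
        using Seq.IH(1)[OF 1(2)] self_reachable[of b] 1(1)
        by (auto simp: control_append)
    qed (use Seq.IH in auto)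
  qed
next
  case (Branch r X a b)
  then show ?case using self_reachable[of a] self_reachable[of b] by auto
next
  case (Loop r X a)
  show ?case
  proof (cases "k = [Loop r X a]")
    case True
    then show ?thesis using self_reachable[of a] by (auto simp: image_iff)
  next
    case False
    then obtain k' where k': "k = k' @ [Loop r X a]" "k' \<in> reachable a"
      using Loop.prems by auto
    then have "k' \<noteq> []" using Nil_not_reachable by metis
    then show ?thesis
      using Loop.IH[OF k'(2)] k'(1) by (auto simp: control_append)
  qed
qed auto

abbreviation reg_list :: "reg list" where "reg_list \<equiv> [R0, R1, R2, R3]"

definition read_reg :: "bool option list \<Rightarrow> reg \<Rightarrow> bool option" where
  "read_reg syms r = (case r of R0 \<Rightarrow> syms ! 0 | R1 \<Rightarrow> syms ! 1 | R2 \<Rightarrow> syms ! 2 | R3 \<Rightarrow> syms ! 3)"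

text \<open>State 0 accepts, state 1 rejects, and the control states follow; \<open>h\<close> numbers the latter.
  The finished program accepts iff register \<open>R0\<close> has \<^term>\<open>True\<close> on top.\<close>

definition com_tm :: "com \<Rightarrow> (com list \<Rightarrow> nat) \<Rightarrow> tm" where
  "com_tm c h = \<lparr>num_tapes = 4, num_states = 2 + card (insert [] (reachable c)),
     start = 2 + h [c], accept = 0, reject = 1,
     delta = (\<lambda>q syms.
       if q < 2 then (0, map (\<lambda>r. (None, Stay)) reg_list)
       else let k = the_inv_into (insert [] (reachable c)) h (q - 2); y = read_reg syms in
         (if k = [] then (if y R0 = Some True then 0 else 1) else 2 + h (control k y),
          map (operate k y) reg_list))\<rparr>"

inductive steps :: "nat \<Rightarrow> com list \<times> (reg \<Rightarrow> tape) \<Rightarrow> com list \<times> (reg \<Rightarrow> tape) \<Rightarrow> bool" where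
  Stop: "steps 0 z z"
| Move: "k \<noteq> [] \<Longrightarrow>
    steps t (control k (\<lambda>r. T r 0), \<lambda>r. act (operate k (\<lambda>r. T r 0) r) (T r)) z \<Longrightarrow>
    steps (Suc t) (k, T) z"

lemma steps_trans: "steps t x y \<Longrightarrow> steps u y z \<Longrightarrow> steps (t + u) x z"
  by (induction rule: steps.induct) (auto intro: steps.intros)

lemma steps_1:
  assumes "k \<noteq> []" "k' = control k (\<lambda>r. T r 0)"
    "T' = (\<lambda>r. act (operate k (\<lambda>r. T r 0) r) (T r))"
  shows "steps 1 (k, T) (k', T')"
  using steps.Move[OF assms(1) steps.Stop] assms(2,3) by simp

lemma string_tape_0 [simp]: "string_tape l 0 = top_bit l"
  by (cases l) (auto simp: string_tape_def)

lemma act_stay [simp]: "act (t 0, Stay) t = t"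
  by (auto simp: act_def)

lemma act_stay_string_tape [simp]: "act (top_bit l, Stay) (string_tape l) = string_tape l"
  using act_stay[of "string_tape l"] by simp

lemma act_pop: "act (None, Right) (string_tape l) = string_tape (tl l)"
  by (rule ext, cases l) (auto simp: act_def string_tape_def nth_Cons' nat_add_distrib)

text \<open>A blank cell must be reached before the new bit can be written: the scanned symbol is
  rewritten unchanged, the head goes left, and the bit is written there.\<close>

lemma act_push:
  "act (Some b, Stay) (act (top_bit l, Left) (string_tape l)) = string_tape (b # l)"
proof -
  \<comment> \<open>True for all integers, because both sides truncate at 0.\<close>
  have "nat (i - 1) = nat i - 1" for i :: int by simp
  then show ?thesis
    by (intro ext, cases l) (auto simp: act_def string_tape_def nth_Cons')
qed

text \<open>The continuation \<open>k\<close> is arbitrary because the hypotheses for subcommands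
  are used with the rest of the program behind them.\<close>

lemma exec_steps:
  "exec c s t s' \<Longrightarrow> steps t (c # k, \<lambda>r. string_tape (s r)) (k, \<lambda>r. string_tape (s' r))"
proof (induction arbitrary: k rule: exec.induct)
  case (Push r b s)
  let ?T = "\<lambda>r'. act (operate [Push r b] (\<lambda>r. string_tape (s r) 0) r') (string_tape (s r'))"
  have 1: "steps 1 (Push r b # k, \<lambda>r. string_tape (s r)) (Write r b # k, ?T)"
    by (rule steps_1) auto
  have 2: "steps 1 (Write r b # k, ?T) (k, \<lambda>r'. string_tape ((s(r := b # s r)) r'))"
    by (rule steps_1) (auto simp: act_push)
  show ?case using steps_trans[OF 1 2] by (simp add: numeral_2_eq_2)
next
  case (Pop r s)
  show ?case by (rule steps_1) (auto simp: act_pop)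
next
  case (Seq a s t s' b u s'')
  have 1: "steps 1 (Seq a b # k, \<lambda>r. string_tape (s r)) (a # b # k, \<lambda>r. string_tape (s r))"
    by (rule steps_1) auto
  show ?case using steps_trans[OF 1 steps_trans[OF Seq.IH]] by simp
next
  case (BranchT s r X a t s' b)
  have 1: "steps 1 (Branch r X a b # k, \<lambda>r. string_tape (s r)) (a # k, \<lambda>r. string_tape (s r))"
    by (rule steps_1) (use BranchT.hyps in auto)
  show ?case using steps_trans[OF 1 BranchT.IH] by simp
next
  case (BranchF s r X b t s' a)
  have 1: "steps 1 (Branch r X a b # k, \<lambda>r. string_tape (s r)) (b # k, \<lambda>r. string_tape (s r))"
    by (rule steps_1) (use BranchF.hyps in auto)
  show ?case using steps_trans[OF 1 BranchF.IH] by simp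
next
  case (LoopF s r X a)
  show ?case by (rule steps_1) (use LoopF.hyps in auto)
next
  case (LoopT s r X a t s' u s'')
  have 1: "steps 1 (Loop r X a # k, \<lambda>r. string_tape (s r))
      (a # Loop r X a # k, \<lambda>r. string_tape (s r))"
    by (rule steps_1) (use LoopT.hyps in auto)
  show ?case using steps_trans[OF 1 steps_trans[OF LoopT.IH]] by simp
qed

section \<open>Correctness of the compiled machine\<close>

lemma step_halted: "halted M cf \<Longrightarrow> (step M ^^ t) cf = cf"
  by (induction t) (auto simp: step_def)

text \<open>The inequality \<open>t < n\<close> is strict because one more move leads from the empty
  control to the accepting or rejecting state; halted configurations do not change, so every later
  time is fine as well.\<close>

lemma com_tm_correct:
  "\<exists>M. wf_tm M \<and> (\<forall>ws s s' t n. length ws \<le> 2 \<longrightarrow>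
    s = (\<lambda>r. case r of R0 \<Rightarrow> (if 0 < length ws then ws ! 0 else [])
           | R1 \<Rightarrow> (if 1 < length ws then ws ! 1 else []) | _ \<Rightarrow> []) \<longrightarrow>
    exec c s t s' \<longrightarrow> t < n \<longrightarrow>
    halted M (run M n ws) \<and>
    (fst (run M n ws) = accept M \<longleftrightarrow> top_bit (s' R0) = Some True) \<and>
    snd (run M n ws) ! 1 = string_tape (s' R1))"
proof -
  let ?S = "insert [] (reachable c)"
  have fin: "finite ?S" using finite_reachable by simp
  obtain h where h: "bij_betw h ?S {0..<card ?S}"
    using ex_bij_betw_finite_nat[OF fin] by blast
  then have inj: "inj_on h ?S" and im: "h ` ?S = {0..<card ?S}" by (auto simp: bij_betw_def)
  have inv: "the_inv_into ?S h (h k) = k" if "k \<in> ?S" for k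
    by (rule the_inv_into_f_f[OF inj that])
  have inS: "control k y \<in> ?S" if "k \<in> ?S" for k y
    using that control_reachable[of k c y] by auto
  have hlt: "h k < card ?S" if "k \<in> ?S" for k
    using im that by (metis atLeastLessThan_iff image_eqI)
  define M where "M = com_tm c h"
  note M = M_def com_tm_def
  have start: "[c] \<in> ?S" using self_reachable by simp
  have wf: "wf_tm M"
    unfolding wf_tm_def
  proof (intro conjI allI impI)
    fix q and syms :: "bool option list" assume q: "q < num_states M"
    show "fst (delta M q syms) < num_states M"
    proof (cases "q < 2")
      case False
      then have "q - 2 \<in> h ` ?S" using q im by (simp add: M)
      then have k: "the_inv_into ?S h (q - 2) \<in> ?S"
        using the_inv_into_into[OF inj] by blast
      show ?thesis using False hlt[OF inS[OF k]] by (simp add: M Let_def)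
    qed (simp add: M)
    show "length (snd (delta M q syms)) = num_tapes M"
      by (simp add: M Let_def)
  qed (use hlt[OF start] in \<open>simp_all add: M\<close>)
  have rr: "read_reg [a, b, d, e] = (\<lambda>r. case r of R0 \<Rightarrow> a | R1 \<Rightarrow> b | R2 \<Rightarrow> d | R3 \<Rightarrow> e)"
    for a b d e by (rule ext) (auto simp: read_reg_def split: reg.split)
  have rT: "(\<lambda>r. case r of R0 \<Rightarrow> T R0 (0::int) | R1 \<Rightarrow> T R1 0 | R2 \<Rightarrow> T R2 0 | R3 \<Rightarrow> T R3 0)
      = (\<lambda>r. T r 0)" for T :: "reg \<Rightarrow> tape" by (rule ext) (auto split: reg.split)
  have one: "step M (2 + h k, map T reg_list) =
      (if k = [] then (if T R0 0 = Some True then 0 else 1) else 2 + h (control k (\<lambda>r. T r 0)),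
       map (\<lambda>r. act (operate k (\<lambda>r. T r 0) r) (T r)) reg_list)" if "k \<in> ?S" for k T
    using inv[OF that] by (simp add: step_def halted_def M rr rT Let_def)
  have sim: "(step M ^^ t) (2 + h k, map T reg_list) = (2 + h k', map T' reg_list)"
    if "steps t (k, T) (k', T')" "k \<in> ?S" for t k T k' T'
    using that
  proof (induction t "(k, T)" "(k', T')" arbitrary: k T rule: steps.induct)
    case (Move k t T)
    show ?case
      unfolding funpow_Suc_right comp_def one[OF Move.prems]
      using Move.hyps(3)[OF inS[OF Move.prems]] Move.hyps(1) by simp
  qed simp
  have sim_in: "k' \<in> ?S" if "steps t (k, T) (k', T')" "k \<in> ?S" for t k T k' T'
    using that
    by (induction t "(k, T)" "(k', T')" arbitrary: k T rule: steps.induct) (use inS in auto)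
  have main: "halted M (run M n ws) \<and> (fst (run M n ws) = accept M \<longleftrightarrow> top_bit (s' R0) = Some True)
      \<and> snd (run M n ws) ! 1 = string_tape (s' R1)"
    if ws: "length ws \<le> 2" and s: "s = (\<lambda>r. case r of R0 \<Rightarrow> (if 0 < length ws then ws ! 0 else [])
           | R1 \<Rightarrow> (if 1 < length ws then ws ! 1 else []) | _ \<Rightarrow> [])"
      and ex: "exec c s t s'" and tn: "t < n" for ws s s' t n
  proof -
    have init: "init_config M ws = (2 + h [c], map (\<lambda>r. string_tape (s r)) reg_list)"
      using ws by (simp add: init_config_def M s upt_rec)
    have st: "(step M ^^ t) (init_config M ws) = (2 + h [], map (\<lambda>r. string_tape (s' r)) reg_list)"
      unfolding init by (rule sim[OF exec_steps[OF ex] start])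
    \<comment> \<open>This is the extra move that turns the top of \<open>R0\<close> into the
      verdict. It leaves the tapes as they are.\<close>
    let ?cf = "step M (2 + h [], map (\<lambda>r. string_tape (s' r)) reg_list)"
    have cf: "?cf = (if top_bit (s' R0) = Some True then 0 else 1,
        map (\<lambda>r. string_tape (s' r)) reg_list)"
      by (subst one) simp_all
    have acc: "accept M = 0" "reject M = 1" by (simp_all add: M)
    have hl: "halted M ?cf" unfolding cf halted_def acc by simp
    obtain d where n: "n = d + Suc t" using tn by (metis add.commute less_iff_Suc_add add_Suc_right)
    have "run M n ws = (step M ^^ d) ((step M ^^ Suc t) (init_config M ws))"
      unfolding run_def n funpow_add comp_def ..
    also have "\<dots> = ?cf" unfolding funpow.simps(2) comp_def st by (rule step_halted[OF hl])
    finally have "run M n ws = ?cf" .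
    then show ?thesis using hl unfolding cf acc by simp
  qed
  show ?thesis using wf main by blast
qed

section \<open>Polynomial-time functions\<close>

subsection \<open>Polynomial bounds\<close>

definition poly_bounded :: "(nat \<Rightarrow> nat) \<Rightarrow> bool" where
  "poly_bounded f \<longleftrightarrow> (\<exists>p :: nat poly. \<forall>n. f n \<le> poly p n)"

text \<open>Natural coefficients cannot be negative, so there is no cancellation.\<close>

lemma poly_nat_mono: "m \<le> n \<Longrightarrow> poly (p :: nat poly) m \<le> poly p n"
  by (induction p) (auto intro!: add_mono mult_mono)

lemma poly_bounded_poly: "poly_bounded (\<lambda>n. poly p n)"
  by (auto simp: poly_bounded_def)

lemma poly_bounded_const: "poly_bounded (\<lambda>n. k)"
  unfolding poly_bounded_def by (rule exI[of _ "[:k:]"]) simp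

lemma poly_bounded_id: "poly_bounded (\<lambda>n. n)"
  unfolding poly_bounded_def by (rule exI[of _ "[:0, 1:]"]) simp

lemma poly_bounded_add: "poly_bounded f \<Longrightarrow> poly_bounded g \<Longrightarrow> poly_bounded (\<lambda>n. f n + g n)"
  unfolding poly_bounded_def by (metis add_mono poly_add)

lemma poly_bounded_mult: "poly_bounded f \<Longrightarrow> poly_bounded g \<Longrightarrow> poly_bounded (\<lambda>n. f n * g n)"
  unfolding poly_bounded_def by (metis mult_mono poly_mult zero_le)

lemma poly_bounded_Suc: "poly_bounded f \<Longrightarrow> poly_bounded (\<lambda>n. Suc (f n))"
  using poly_bounded_add[OF _ poly_bounded_const[of 1]] by fastforce

lemma poly_bounded_comp: "poly_bounded g \<Longrightarrow> poly_bounded (\<lambda>n. poly (p :: nat poly) (g n))"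
proof -
  assume "poly_bounded g"
  then obtain q where q: "\<And>n. g n \<le> poly q n" by (auto simp: poly_bounded_def)
  show ?thesis
    unfolding poly_bounded_def
    by (rule exI[of _ "pcompose p q"]) (auto simp: poly_pcompose intro: poly_nat_mono[OF q])
qed

lemma poly_boundedE:
  assumes "poly_bounded f" obtains p :: "nat poly" where "\<And>n. f n \<le> poly p n"
  using assms by (auto simp: poly_bounded_def)

lemmas poly_bounded_intros = poly_bounded_poly poly_bounded_const poly_bounded_id poly_bounded_add
  poly_bounded_mult poly_bounded_Suc poly_bounded_comp

subsection \<open>Timed execution\<close>

definition exec_le :: "com \<Rightarrow> (reg \<Rightarrow> bool list) \<Rightarrow> (reg \<Rightarrow> bool list) \<Rightarrow> nat \<Rightarrow> bool" where
  "exec_le c s s' n \<longleftrightarrow> (\<exists>t \<le> n. exec c s t s')"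

lemma exec_le_mono: "exec_le c s s' m \<Longrightarrow> m \<le> n \<Longrightarrow> exec_le c s s' n"
  unfolding exec_le_def by (meson order_trans)

lemma exec_le_Push: "exec_le (Push r b) s (s(r := b # s r)) 2"
  unfolding exec_le_def by (blast intro: exec.Push)

lemma exec_le_Pop: "exec_le (Pop r) s (s(r := tl (s r))) 1"
  unfolding exec_le_def by (blast intro: exec.Pop)

lemma exec_le_Seq:
  "exec_le a s s' m \<Longrightarrow> exec_le b s' s'' n \<Longrightarrow> exec_le (Seq a b) s s'' (Suc (m + n))"
  unfolding exec_le_def by (meson exec.Seq Suc_le_mono add_mono)

lemma exec_le_Branch:
  "exec_le (if top_bit (s r) \<in> X then a else b) s s' n \<Longrightarrow> exec_le (Branch r X a b) s s' (Suc n)"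
  unfolding exec_le_def by (metis Suc_le_mono exec.BranchF exec.BranchT)

lemma exec_le_LoopF: "top_bit (s r) \<notin> X \<Longrightarrow> exec_le (Loop r X a) s s 1"
  unfolding exec_le_def by (blast intro: exec.LoopF)

lemma exec_le_LoopT:
  "top_bit (s r) \<in> X \<Longrightarrow> exec_le a s s' m \<Longrightarrow> exec_le (Loop r X a) s' s'' n \<Longrightarrow>
   exec_le (Loop r X a) s s'' (Suc (m + n))"
  unfolding exec_le_def by (meson exec.LoopT Suc_le_mono add_mono)

lemma exec_le_eq: "exec_le c s s1 n \<Longrightarrow> s1 = s2 \<Longrightarrow> n \<le> m \<Longrightarrow> exec_le c s s2 m"
  using exec_le_mono by blast

subsection \<open>Moving strings between registers\<close>

fun dbl :: "bool list \<Rightarrow> bool list" where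
  "dbl [] = []"
| "dbl (b # l) = True # b # dbl l"

fun first :: "bool list \<Rightarrow> bool list" where
  "first (True # b # l) = b # first l"
| "first _ = []"

fun second :: "bool list \<Rightarrow> bool list" where
  "second (True # b # l) = second l"
| "second (False # l) = l"
| "second _ = []"

text \<open>This is the self-delimiting format of \<open>enc_nat\<close>: a natural number inside an
  encoded instance is literally \<open>pair (bits n) []\<close>. The projections are total, so
  malformed strings cause no trouble.\<close>

definition pair :: "bool list \<Rightarrow> bool list \<Rightarrow> bool list" where
  "pair x y = dbl x @ False # y"

lemma dbl_append: "dbl (x @ y) = dbl x @ dbl y"
  by (induction x rule: dbl.induct) auto

lemma first_pair [simp]: "first (pair x y) = x"
  by (induction x rule: dbl.induct) (auto simp: pair_def)

lemma second_pair [simp]: "second (pair x y) = y"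
  by (induction x rule: dbl.induct) (auto simp: pair_def)

lemma length_dbl [simp]: "length (dbl x) = 2 * length x"
  by (induction x rule: dbl.induct) auto

lemma length_pair [simp]: "length (pair x y) = Suc (2 * length x + length y)"
  by (simp add: pair_def)

lemma length_first: "length (first x) \<le> length x"
  by (induction x rule: first.induct) auto

lemma length_second: "length (second x) \<le> length x"
  by (induction x rule: second.induct) auto

text \<open>Pouring one stack into another reverses the string; the programs below pour twice to
  restore the order.\<close>

definition shift_reg :: "reg \<Rightarrow> reg \<Rightarrow> com" where
  "shift_reg r q = Loop r {Some True, Some False}
     (Branch r {Some True} (Seq (Pop r) (Push q True)) (Seq (Pop r) (Push q False)))"

lemma exec_shift_reg:
  "r \<noteq> q \<Longrightarrow> exec_le (shift_reg r q) s (s(r := [], q := rev (s r) @ s q)) (6 * length (s r) + 1)"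
proof (induction "s r" arbitrary: s)
  case Nil
  then have "s(r := [], q := rev (s r) @ s q) = s" by (intro ext) auto
  then show ?case
    using Nil.hyps[symmetric] unfolding shift_reg_def
    by (intro exec_le_eq[OF exec_le_LoopF]) auto
next
  case (Cons b l)
  let ?s = "s(r := l, q := b # s q)"
  have hd: "s r = b # l" using Cons.hyps by simp
  have "exec_le (Branch r {Some True} (Seq (Pop r) (Push q True)) (Seq (Pop r) (Push q False)))
      s ?s 5"
    by (rule exec_le_Branch[of _ _ _ _ _ _ 4, simplified])
      (use hd Cons.prems in \<open>auto intro!: exec_le_eq[OF exec_le_Seq[OF exec_le_Pop exec_le_Push]]\<close>)
  moreover have "exec_le (shift_reg r q) ?s (?s(r := [], q := rev (?s r) @ ?s q)) (6 * length (?s r) + 1)"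
    by (rule Cons.hyps) (use Cons.prems in auto)
  ultimately have "exec_le (shift_reg r q) s (?s(r := [], q := rev (?s r) @ ?s q))
      (Suc (5 + (6 * length (?s r) + 1)))"
    unfolding shift_reg_def by (intro exec_le_LoopT) (use hd in \<open>cases b; auto\<close>)
  then show ?case
    by (rule exec_le_eq) (use hd Cons.prems in \<open>auto intro!: ext\<close>)
qed

text \<open>The bit is pushed before its marker, so the marker ends up on top; as the source arrives
  in reversed order, the result is a doubled string in the right order.\<close>

definition dbl_reg :: "reg \<Rightarrow> reg \<Rightarrow> com" where
  "dbl_reg r q = Loop r {Some True, Some False}
     (Branch r {Some True} (Seq (Pop r) (Seq (Push q True) (Push q True)))
                           (Seq (Pop r) (Seq (Push q False) (Push q True))))"

lemma exec_dbl_reg: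
  "r \<noteq> q \<Longrightarrow>
   exec_le (dbl_reg r q) s (s(r := [], q := dbl (rev (s r)) @ s q)) (9 * length (s r) + 1)"
proof (induction "s r" arbitrary: s)
  case Nil
  then have "s(r := [], q := dbl (rev (s r)) @ s q) = s" by (intro ext) auto
  then show ?case
    using Nil.hyps[symmetric] unfolding dbl_reg_def
    by (intro exec_le_eq[OF exec_le_LoopF]) auto
next
  case (Cons b l)
  let ?s = "s(r := l, q := True # b # s q)"
  have hd: "s r = b # l" using Cons.hyps by simp
  have "exec_le (Branch r {Some True} (Seq (Pop r) (Seq (Push q True) (Push q True)))
      (Seq (Pop r) (Seq (Push q False) (Push q True)))) s ?s 8"
    by (rule exec_le_Branch[of _ _ _ _ _ _ 7, simplified])
      (use hd Cons.prems in \<open>auto intro!: exec_le_eq[OF exec_le_Seq[OF exec_le_Pop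
          exec_le_Seq[OF exec_le_Push exec_le_Push]]]\<close>)
  moreover have "exec_le (dbl_reg r q) ?s (?s(r := [], q := dbl (rev (?s r)) @ ?s q)) (9 * length (?s r) + 1)"
    by (rule Cons.hyps) (use Cons.prems in auto)
  ultimately have "exec_le (dbl_reg r q) s (?s(r := [], q := dbl (rev (?s r)) @ ?s q))
      (Suc (8 + (9 * length (?s r) + 1)))"
    unfolding dbl_reg_def by (intro exec_le_LoopT) (use hd in \<open>cases b; auto\<close>)
  then show ?case
    by (rule exec_le_eq) (use hd Cons.prems in \<open>auto intro!: ext simp: dbl_append\<close>)
qed

definition copy_dbl_reg :: "reg \<Rightarrow> reg \<Rightarrow> reg \<Rightarrow> com" where
  "copy_dbl_reg r p q = Loop r {Some True, Some False}
     (Branch r {Some True} (Seq (Pop r) (Seq (Push p True) (Seq (Push q True) (Push q True))))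
                           (Seq (Pop r) (Seq (Push p False) (Seq (Push q False) (Push q True)))))"

lemma exec_copy_dbl_reg:
  "r \<noteq> q \<Longrightarrow> r \<noteq> p \<Longrightarrow> p \<noteq> q \<Longrightarrow>
   exec_le (copy_dbl_reg r p q) s
     (s(r := [], p := rev (s r) @ s p, q := dbl (rev (s r)) @ s q)) (12 * length (s r) + 1)"
proof (induction "s r" arbitrary: s)
  case Nil
  then have "s(r := [], p := rev (s r) @ s p, q := dbl (rev (s r)) @ s q) = s" by (intro ext) auto
  then show ?case
    using Nil.hyps[symmetric] unfolding copy_dbl_reg_def
    by (intro exec_le_eq[OF exec_le_LoopF]) auto
next
  case (Cons b l)
  let ?s = "s(r := l, p := b # s p, q := True # b # s q)"
  have hd: "s r = b # l" using Cons.hyps by simp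
  have "exec_le (Branch r {Some True}
      (Seq (Pop r) (Seq (Push p True) (Seq (Push q True) (Push q True))))
      (Seq (Pop r) (Seq (Push p False) (Seq (Push q False) (Push q True))))) s ?s 11"
    by (rule exec_le_Branch[of _ _ _ _ _ _ 10, simplified])
      (use hd Cons.prems in \<open>auto intro!: exec_le_eq[OF exec_le_Seq[OF exec_le_Pop exec_le_Seq[OF
          exec_le_Push exec_le_Seq[OF exec_le_Push exec_le_Push]]]]\<close>)
  moreover have "exec_le (copy_dbl_reg r p q) ?s
      (?s(r := [], p := rev (?s r) @ ?s p, q := dbl (rev (?s r)) @ ?s q)) (12 * length (?s r) + 1)"
    by (rule Cons.hyps) (use Cons.prems in auto)
  ultimately have "exec_le (copy_dbl_reg r p q) s
      (?s(r := [], p := rev (?s r) @ ?s p, q := dbl (rev (?s r)) @ ?s q))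
      (Suc (11 + (12 * length (?s r) + 1)))"
    unfolding copy_dbl_reg_def by (intro exec_le_LoopT) (use hd in \<open>cases b; auto\<close>)
  then show ?case
    by (rule exec_le_eq) (use hd Cons.prems in \<open>auto intro!: ext simp: dbl_append\<close>)
qed

lemma exec_branch_move:
  assumes "s r = b # l" "r \<noteq> q"
  shows "exec_le (Branch r {Some True} (Seq (Pop r) (Push q True))
       (Branch r {Some False} (Seq (Pop r) (Push q False)) (Pop r))) s (s(r := l, q := b # s q)) 6"
proof -
  have "exec_le (Seq (Pop r) (Push q b)) s (s(r := l, q := b # s q)) 4"
    by (rule exec_le_eq[OF exec_le_Seq[OF exec_le_Pop exec_le_Push]]) (use assms in auto)
  then show ?thesis
    using assms(1)
    by (cases b) (auto intro!: exec_le_Branch[of _ _ _ _ _ _ 5, simplified] exec_le_Branch[of _ _ _ _ _ _ 4, simplified]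
        intro: exec_le_mono)
qed

text \<open>Each round consumes a marker \<open>True\<close> and the bit behind it. The loop leaves
  the separator in place, and the last \<open>Pop\<close> removes it.\<close>

definition split_reg :: "reg \<Rightarrow> reg \<Rightarrow> com" where
  "split_reg r q = Seq (Loop r {Some True} (Seq (Pop r)
     (Branch r {Some True} (Seq (Pop r) (Push q True))
       (Branch r {Some False} (Seq (Pop r) (Push q False)) (Pop r))))) (Pop r)"

lemma exec_split_reg:
  assumes "r \<noteq> q"
  shows "exec_le (split_reg r q) s (s(r := second (s r), q := rev (first (s r)) @ s q))
    (9 * length (s r) + 3)"
proof -
  let ?body = "Seq (Pop r) (Branch r {Some True} (Seq (Pop r) (Push q True))
       (Branch r {Some False} (Seq (Pop r) (Push q False)) (Pop r)))"
  \<comment> \<open>Stating the result after the pending \<open>Pop\<close> treats alike a loop that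
    stops at the separator and one that runs into the end of a malformed string.\<close>
  have "\<exists>s'. exec_le (Loop r {Some True} ?body) s s' (9 * length (s r) + 1) \<and>
     s'(r := tl (s' r)) = s(r := second (s r), q := rev (first (s r)) @ s q)"
  proof (induction "s r" arbitrary: s rule: second.induct)
    case (1 b l)
    let ?s = "s(r := l, q := b # s q)"
    have hd: "s r = True # b # l" using 1(2) by simp
    have "exec_le ?body s ?s 8"
      by (rule exec_le_eq[OF exec_le_Seq[OF exec_le_Pop exec_branch_move[of _ _ b l]]])
        (use hd \<open>r \<noteq> q\<close> in auto)
    moreover obtain s' where s': "exec_le (Loop r {Some True} ?body) ?s s' (9 * length (?s r) + 1)"
      "s'(r := tl (s' r)) = ?s(r := second (?s r), q := rev (first (?s r)) @ ?s q)"
      using 1(1)[of ?s] \<open>r \<noteq> q\<close> by auto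
    ultimately have "exec_le (Loop r {Some True} ?body) s s' (Suc (8 + (9 * length (?s r) + 1)))"
      by (intro exec_le_LoopT) (use hd in auto)
    then have "exec_le (Loop r {Some True} ?body) s s' (9 * length (s r) + 1)"
      by (rule exec_le_eq) (use hd \<open>r \<noteq> q\<close> in auto)
    moreover have "s'(r := tl (s' r)) = s(r := second (s r), q := rev (first (s r)) @ s q)"
      unfolding s'(2) using hd \<open>r \<noteq> q\<close> by (intro ext) auto
    ultimately show ?case by blast
  next
    case (2 l)
    then have "s r = False # l" by simp
    then show ?case
      using \<open>r \<noteq> q\<close> by (intro exI[of _ s] conjI exec_le_eq[OF exec_le_LoopF] ext) auto
  next
    case "3_1"
    then have "s r = []" by simp
    then show ?case
      using \<open>r \<noteq> q\<close> by (intro exI[of _ s] conjI exec_le_eq[OF exec_le_LoopF] ext) auto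
  next
    \<comment> \<open>A marker without a bit: the inner branch meets an empty register and its
      \<open>Pop\<close> does nothing.\<close>
    case "3_2"
    have hd: "s r = [True]" using "3_2" by simp
    let ?s = "s(r := [])"
    have "exec_le ?body s ?s 5"
    proof (rule exec_le_eq[OF exec_le_Seq[OF exec_le_Pop exec_le_Branch[OF _]]])
      have "exec_le (Branch r {Some False} (Seq (Pop r) (Push q False)) (Pop r)) ?s ?s 2"
        by (rule exec_le_eq[OF exec_le_Branch[of _ _ _ _ _ _ 1]])
          (auto intro!: exec_le_eq[OF exec_le_Pop])
      then show "exec_le (if top_bit ((s(r := tl (s r))) r) \<in> {Some True} then Seq (Pop r) (Push q True)
          else Branch r {Some False} (Seq (Pop r) (Push q False)) (Pop r)) (s(r := tl (s r))) ?s 2"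
        using hd by simp
    qed simp_all
    moreover have "exec_le (Loop r {Some True} ?body) ?s ?s 1" by (rule exec_le_LoopF) simp
    ultimately have "exec_le (Loop r {Some True} ?body) s ?s (Suc (5 + 1))"
      by (intro exec_le_LoopT) (use hd in auto)
    then have "exec_le (Loop r {Some True} ?body) s ?s (9 * length (s r) + 1)"
      by (rule exec_le_eq) (use hd in auto)
    moreover have "?s(r := tl (?s r)) = s(r := second (s r), q := rev (first (s r)) @ s q)"
      using hd \<open>r \<noteq> q\<close> by (intro ext) auto
    ultimately show ?case by blast
  qed
  then obtain s' where s': "exec_le (Loop r {Some True} ?body) s s' (9 * length (s r) + 1)"
     "s'(r := tl (s' r)) = s(r := second (s r), q := rev (first (s r)) @ s q)" by blast
  show ?thesis
    unfolding split_reg_def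
    by (rule exec_le_eq[OF exec_le_Seq[OF s'(1) exec_le_Pop] s'(2)]) simp
qed

definition clear_reg :: "reg \<Rightarrow> com" where
  "clear_reg r = Loop r {Some True, Some False} (Pop r)"

lemma exec_clear_reg: "exec_le (clear_reg r) s (s(r := [])) (2 * length (s r) + 1)"
proof (induction "s r" arbitrary: s)
  case Nil
  then have "s(r := []) = s" by (intro ext) auto
  then show ?case
    using Nil.hyps[symmetric] unfolding clear_reg_def
    by (intro exec_le_eq[OF exec_le_LoopF]) auto
next
  case (Cons b l)
  let ?s = "s(r := tl (s r))"
  have hd: "s r = b # l" using Cons.hyps by simp
  have "exec_le (clear_reg r) ?s (?s(r := [])) (2 * length (?s r) + 1)"
    by (rule Cons.hyps) (use hd in auto)
  then have "exec_le (clear_reg r) s (?s(r := [])) (Suc (1 + (2 * length (?s r) + 1)))"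
    unfolding clear_reg_def by (intro exec_le_LoopT[OF _ exec_le_Pop]) (use hd in \<open>cases b; auto\<close>)
  then show ?case
    by (rule exec_le_eq) (use hd in \<open>auto intro!: ext\<close>)
qed

subsection \<open>The class of polynomial-time functions\<close>

definition regs :: "bool list \<Rightarrow> bool list \<Rightarrow> bool list \<Rightarrow> bool list \<Rightarrow> reg \<Rightarrow> bool list" where
  "regs a b c d = (\<lambda>r. case r of R0 \<Rightarrow> a | R1 \<Rightarrow> b | R2 \<Rightarrow> c | R3 \<Rightarrow> d)"

lemma regs_simps [simp]:
  "regs a b c d R0 = a" "regs a b c d R1 = b" "regs a b c d R2 = c" "regs a b c d R3 = d"
  "(regs a b c d)(R0 := x) = regs x b c d" "(regs a b c d)(R1 := x) = regs a x c d"
  "(regs a b c d)(R2 := x) = regs a b x d" "(regs a b c d)(R3 := x) = regs a b c x"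
  by (auto simp: regs_def fun_eq_iff split: reg.split)

text \<open>Register \<open>R1\<close> is a stack, so that programs can be nested: its initial content is
  untouched and does not count for the running time.\<close>

definition polytime :: "(bool list \<Rightarrow> bool list) \<Rightarrow> bool" where
  "polytime f \<longleftrightarrow> (\<exists>c t. poly_bounded t \<and>
     (\<forall>x \<sigma>. exec_le c (regs x \<sigma> [] []) (regs (f x) \<sigma> [] []) (t (length x))))"

lemma polytimeI:
  assumes "poly_bounded t"
    "\<And>x \<sigma>. exec_le c (regs x \<sigma> [] []) (regs (f x) \<sigma> [] []) (t (length x))"
  shows "polytime f"
  using assms unfolding polytime_def by blast

lemma polytimeE:
  assumes "polytime f"
  obtains c p where
    "\<And>x \<sigma>. exec_le c (regs x \<sigma> [] []) (regs (f x) \<sigma> [] []) (poly p (length x))"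
  using assms exec_le_mono unfolding polytime_def poly_bounded_def by meson

text \<open>A move lengthens a register by at most one bit, so the running time also bounds the
  growth of the result.\<close>

lemma polytime_length:
  assumes "polytime f"
  shows "\<exists>p :: nat poly. \<forall>x. length (f x) \<le> poly p (length x)"
proof -
  obtain c and p :: "nat poly" where
    c: "\<And>x \<sigma>. exec_le c (regs x \<sigma> [] []) (regs (f x) \<sigma> [] []) (poly p (length x))"
    using polytimeE[OF assms] by blast
  have "length (f x) \<le> poly ([:0, 1:] + p) (length x)" for x
    using c[of x "[]"] exec_length[of c _ _ _ R0] unfolding exec_le_def by fastforce
  then show ?thesis by blast
qed

lemma polytime_id: "polytime (\<lambda>x. x)"
proof (rule polytimeI)
  \<comment> \<open>There is no empty command; a push that is undone replaces it.\<close>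
  show "exec_le (Seq (Push R0 True) (Pop R0)) (regs x \<sigma> [] []) (regs x \<sigma> [] []) 4" for x \<sigma>
    by (rule exec_le_eq[OF exec_le_Seq[OF exec_le_Push exec_le_Pop]]) simp_all
qed (rule poly_bounded_const)

lemma polytime_comp:
  assumes "polytime f" "polytime g"
  shows "polytime (\<lambda>x. f (g x))"
proof -
  obtain c p where c:
    "\<And>x \<sigma>. exec_le c (regs x \<sigma> [] []) (regs (f x) \<sigma> [] []) (poly p (length x))"
    using polytimeE[OF assms(1)] by blast
  obtain d q where d:
    "\<And>x \<sigma>. exec_le d (regs x \<sigma> [] []) (regs (g x) \<sigma> [] []) (poly q (length x))"
    using polytimeE[OF assms(2)] by blast
  obtain l where l: "\<And>x. length (g x) \<le> poly l (length x)" using polytime_length[OF assms(2)] by blast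
  show ?thesis
  proof (rule polytimeI)
    show "exec_le (Seq d c) (regs x \<sigma> [] []) (regs (f (g x)) \<sigma> [] [])
        (Suc (poly q (length x) + poly p (poly l (length x))))" for x \<sigma>
      by (rule exec_le_eq[OF exec_le_Seq[OF d c]]) (use poly_nat_mono[OF l[of x], of p] in auto)
  qed (intro poly_bounded_intros)
qed

lemma polytime_Cons: "polytime (\<lambda>x. b # x)"
  by (rule polytimeI[OF poly_bounded_const[of 2], of "Push R0 b"], rule exec_le_eq[OF exec_le_Push]) auto

lemma polytime_tl: "polytime tl"
  by (rule polytimeI[OF poly_bounded_const[of 1], of "Pop R0"], rule exec_le_eq[OF exec_le_Pop]) auto

lemma polytime_Nil: "polytime (\<lambda>x. [])"
proof (rule polytimeI)
  show "exec_le (clear_reg R0) (regs x \<sigma> [] []) (regs [] \<sigma> [] []) (2 * length x + 1)" for x \<sigma>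
    by (rule exec_le_eq[OF exec_clear_reg]) auto
qed (intro poly_bounded_intros)

lemma polytime_first: "polytime first"
proof (rule polytimeI)
  show "exec_le (Seq (split_reg R0 R2) (Seq (clear_reg R0) (shift_reg R2 R0)))
      (regs x \<sigma> [] []) (regs (first x) \<sigma> [] []) (17 * length x + 7)" for x \<sigma>
    by (rule exec_le_eq[OF exec_le_Seq[OF exec_split_reg exec_le_Seq[OF exec_clear_reg exec_shift_reg]]])
      (use length_first[of x] length_second[of x] in auto)
qed (intro poly_bounded_intros)

lemma polytime_second: "polytime second"
proof (rule polytimeI)
  show "exec_le (Seq (split_reg R0 R2) (clear_reg R2))
      (regs x \<sigma> [] []) (regs (second x) \<sigma> [] []) (11 * length x + 5)" for x \<sigma>
    by (rule exec_le_eq[OF exec_le_Seq[OF exec_split_reg exec_clear_reg]])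
      (use length_first[of x] in auto)
qed (intro poly_bounded_intros)

lemma polytime_branch:
  assumes "polytime f" "polytime g"
  shows "polytime (\<lambda>x. if top_bit x = Some True then f x else g x)"
proof -
  obtain c p where c:
    "\<And>x \<sigma>. exec_le c (regs x \<sigma> [] []) (regs (f x) \<sigma> [] []) (poly p (length x))"
    using polytimeE[OF assms(1)] by blast
  obtain d q where d:
    "\<And>x \<sigma>. exec_le d (regs x \<sigma> [] []) (regs (g x) \<sigma> [] []) (poly q (length x))"
    using polytimeE[OF assms(2)] by blast
  show ?thesis
  proof (rule polytimeI)
    show "exec_le (Branch R0 {Some True} c d) (regs x \<sigma> [] [])
        (regs (if top_bit x = Some True then f x else g x) \<sigma> [] [])
        (Suc (poly p (length x) + poly q (length x)))" for x \<sigma>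
      by (rule exec_le_Branch) (auto intro: exec_le_eq[OF c] exec_le_eq[OF d])
  qed (intro poly_bounded_intros)
qed

text \<open>Both programs need the argument in \<open>R0\<close>. A copy waits on the stack
  \<open>R1\<close> during the first run, is exchanged with the first result, and the first result
  waits there during the second run. This is why \<open>polytime\<close> demands that programs work
  on top of an arbitrary stack.\<close>

lemma polytime_pair:
  assumes "polytime f" "polytime g"
  shows "polytime (\<lambda>x. pair (f x) (g x))"
proof -
  obtain c p where c:
    "\<And>x \<sigma>. exec_le c (regs x \<sigma> [] []) (regs (f x) \<sigma> [] []) (poly p (length x))"
    using polytimeE[OF assms(1)] by blast
  obtain d q where d:
    "\<And>x \<sigma>. exec_le d (regs x \<sigma> [] []) (regs (g x) \<sigma> [] []) (poly q (length x))"
    using polytimeE[OF assms(2)] by blast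
  obtain l where l: "\<And>x. length (f x) \<le> poly l (length x)" using polytime_length[OF assms(1)] by blast
  \<comment> \<open>The copy on \<open>R1\<close> is stored in \<open>pair\<close> format above the
    old stack, so that its end can be recognised later.\<close>
  define save where
    "save = Seq (shift_reg R0 R2) (Seq (Push R1 False) (copy_dbl_reg R2 R0 R1))"
  have save: "exec_le save (regs x \<sigma> [] []) (regs x (pair x \<sigma>) [] []) (18 * length x + 6)" for x \<sigma>
    unfolding save_def
    by (rule exec_le_eq[OF exec_le_Seq[OF exec_shift_reg exec_le_Seq[OF exec_le_Push
          exec_copy_dbl_reg]]]) (auto simp: pair_def)
  \<comment> \<open>The saved string comes off the stack reversed in \<open>R2\<close>, the result
    waits in \<open>R3\<close>, and both are poured to each other's place.\<close>
  define swap where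
    "swap = Seq (split_reg R1 R2) (Seq (shift_reg R0 R3) (Seq (Push R1 False)
       (Seq (dbl_reg R3 R1) (shift_reg R2 R0))))"
  \<comment> \<open>a bound that does not depend on the stack: the loop stops at the end of the first component\<close>
  have split: "exec_le (split_reg R1 R2) (regs y (pair x \<sigma>) [] []) (regs y \<sigma> (rev x) []) (9 * length x + 3)"
    for x y \<sigma>
  proof -
    let ?body = "Seq (Pop R1) (Branch R1 {Some True} (Seq (Pop R1) (Push R2 True))
       (Branch R1 {Some False} (Seq (Pop R1) (Push R2 False)) (Pop R1)))"
    have "exec_le (Loop R1 {Some True} ?body) (regs y (pair x \<sigma>) z []) (regs y (False # \<sigma>) (rev x @ z) [])
        (9 * length x + 1)" for z
    proof (induction x arbitrary: z)
      case Nil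
      then show ?case
        by (intro exec_le_eq[OF exec_le_LoopF]) (simp_all add: pair_def)
    next
      case (Cons b x)
      have "exec_le ?body (regs y (pair (b # x) \<sigma>) z []) (regs y (pair x \<sigma>) (b # z) []) 8"
        by (rule exec_le_eq[OF exec_le_Seq[OF exec_le_Pop exec_branch_move[of _ _ b "pair x \<sigma>"]]])
          (auto simp: pair_def)
      from exec_le_LoopT[OF _ this Cons.IH] show ?case
        by (rule exec_le_eq) (auto simp: pair_def)
    qed
    from exec_le_Seq[OF this exec_le_Pop]
    show ?thesis unfolding split_reg_def by (rule exec_le_eq) auto
  qed
  have swap: "exec_le swap (regs y (pair x \<sigma>) [] []) (regs x (pair y \<sigma>) [] [])
      (15 * (length x + length y) + 12)" for x y \<sigma>
    unfolding swap_def
    by (rule exec_le_eq[OF exec_le_Seq[OF split exec_le_Seq[OF exec_shift_reg exec_le_Seq[OF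
        exec_le_Push exec_le_Seq[OF exec_dbl_reg exec_shift_reg]]]]]) (auto simp: pair_def)
  define fin where "fin = Seq (split_reg R1 R2) (Seq (Push R0 False) (dbl_reg R2 R0))"
  have fin: "exec_le fin (regs z (pair y \<sigma>) [] []) (regs (pair y z) \<sigma> [] []) (18 * length y + 8)"
    for y z \<sigma> unfolding fin_def
    by (rule exec_le_eq[OF exec_le_Seq[OF split exec_le_Seq[OF exec_le_Push exec_dbl_reg]]])
      (auto simp: pair_def)
  show ?thesis
  proof (rule polytimeI)
    show "exec_le (Seq save (Seq c (Seq swap (Seq d fin)))) (regs x \<sigma> [] [])
      (regs (pair (f x) (g x)) \<sigma> [] []) (33 * length x + 33 * poly l (length x) + poly p (length x)
        + poly q (length x) + 40)" for x \<sigma>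
      by (rule exec_le_eq[OF exec_le_Seq[OF save exec_le_Seq[OF c exec_le_Seq[OF swap exec_le_Seq[OF
          d fin]]]]]) (use l[of x] in auto)
  qed (intro poly_bounded_intros)
qed

text \<open>The counter \<open>g x\<close> is kept on the stack while \<open>f\<close> runs in
  \<open>R0\<close>. The bound is required of all iterates, since a function that merely doubles the
  length would otherwise grow exponentially.\<close>

lemma polytime_iterate:
  assumes "polytime f" "polytime g" "polytime h" "poly_bounded b"
    and "\<And>x i. i \<le> length (g x) \<Longrightarrow> length ((f ^^ i) (h x)) \<le> b (length x)"
  shows "polytime (\<lambda>x. (f ^^ length (g x)) (h x))"
proof -
  obtain B :: "nat poly" where B: "\<And>n. b n \<le> poly B n" using poly_boundedE[OF assms(4)] by blast
  obtain d and q :: "nat poly" where d: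
    "\<And>x \<sigma>. exec_le d (regs x \<sigma> [] []) (regs (pair (g x) (h x)) \<sigma> [] []) (poly q (length x))"
    using polytimeE[OF polytime_pair[OF assms(2,3)]] by blast
  obtain l where l: "\<And>x. length (g x) \<le> poly l (length x)" using polytime_length[OF assms(2)] by blast
  obtain c and p :: "nat poly" where c:
    "\<And>x \<sigma>. exec_le c (regs x \<sigma> [] []) (regs (f x) \<sigma> [] []) (poly p (length x))"
    using polytimeE[OF assms(1)] by blast
  \<comment> \<open>Two pops remove one marked bit of the counter; the loop ends at the
    separator.\<close>
  let ?body = "Seq (Pop R1) (Seq (Pop R1) c)"
  have loop: "exec_le (Loop R1 {Some True} ?body) (regs s (pair y \<sigma>) [] [])
      (regs ((f ^^ length y) s) (False # \<sigma>) [] []) (length y * (poly p b + 5) + 1)"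
    if "\<forall>i \<le> length y. length ((f ^^ i) s) \<le> b" for y s b \<sigma>
    using that
  proof (induction y arbitrary: s)
    case Nil
    show ?case by (intro exec_le_eq[OF exec_le_LoopF]) (simp_all add: pair_def)
  next
    case (Cons a y)
    have "length s \<le> b" using Cons.prems by (metis bot_nat_0.extremum funpow_0)
    then have "exec_le ?body (regs s (pair (a # y) \<sigma>) [] []) (regs (f s) (pair y \<sigma>) [] [])
        (poly p b + 4)"
      by (intro exec_le_eq[OF exec_le_Seq[OF exec_le_Pop exec_le_Seq[OF exec_le_Pop]]])
        (auto simp: pair_def intro!: exec_le_eq[OF c] poly_nat_mono)
    moreover have "\<forall>i \<le> length y. length ((f ^^ i) (f s)) \<le> b"
      using Cons.prems by (metis Suc_le_mono comp_apply funpow_Suc_right length_Cons)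
    note Cons.IH[OF this]
    ultimately have "exec_le (Loop R1 {Some True} ?body) (regs s (pair (a # y) \<sigma>) [] [])
        (regs ((f ^^ length y) (f s)) (False # \<sigma>) [] [])
        (Suc ((poly p b + 4) + (length y * (poly p b + 5) + 1)))"
      by (intro exec_le_LoopT) (auto simp: pair_def)
    then show ?case by (rule exec_le_eq) (auto simp: funpow_swap1)
  qed
  define save where "save = Seq (split_reg R0 R2) (Seq (Push R1 False) (dbl_reg R2 R1))"
  have save: "exec_le save (regs (pair y s) \<sigma> [] []) (regs s (pair y \<sigma>) [] []) (36 * length y + 9 * length s + 20)"
    for y s \<sigma> unfolding save_def
    by (rule exec_le_eq[OF exec_le_Seq[OF exec_split_reg exec_le_Seq[OF exec_le_Push exec_dbl_reg]]])
      (auto simp: pair_def[of _ \<sigma>])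
  show ?thesis
  proof (rule polytimeI)
    fix x \<sigma>
    have "length (h x) \<le> poly B (length x)"
      using assms(5)[of 0 x] B[of "length x"] by simp
    moreover have "exec_le (Loop R1 {Some True} ?body) (regs (h x) (pair (g x) \<sigma>) [] [])
       (regs ((f ^^ length (g x)) (h x)) (False # \<sigma>) [] [])
       (poly l (length x) * (poly p (poly B (length x)) + 5) + 1)"
      by (rule exec_le_mono[OF loop[where b = "poly B (length x)"]])
        (use assms(5) B l in \<open>auto intro: order_trans mult_right_mono\<close>)
    ultimately show "exec_le (Seq d (Seq save (Seq (Loop R1 {Some True} ?body) (Pop R1)))) (regs x \<sigma> [] [])
        (regs ((f ^^ length (g x)) (h x)) \<sigma> [] [])
        (poly q (length x) + 36 * poly l (length x) + 9 * poly B (length x)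
          + poly l (length x) * (poly p (poly B (length x)) + 5) + 30)"
      by (intro exec_le_eq[OF exec_le_Seq[OF d exec_le_Seq[OF save exec_le_Seq[OF _ exec_le_Pop]]]])
        (use l[of x] in auto)
  qed (intro poly_bounded_intros)
qed

subsection \<open>Polynomial-time functions on Turing machines\<close>

lemma polytime_imp_poly_time_computable:
  assumes "polytime f"
  shows "poly_time_computable f"
proof -
  obtain c and p :: "nat poly" where c:
    "\<And>x \<sigma>. exec_le c (regs x \<sigma> [] []) (regs (f x) \<sigma> [] []) (poly p (length x))"
    using polytimeE[OF assms] by blast
  obtain l where l: "\<And>x. length (f x) \<le> poly l (length x)" using polytime_length[OF assms] by blast
  \<comment> \<open>The output is expected on tape 1, that is, in \<open>R1\<close>; the detour
    through \<open>R2\<close> undoes the reversal.\<close>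
  let ?c = "Seq c (Seq (shift_reg R0 R2) (shift_reg R2 R1))"
  let ?p = "p + [:12:] * l + [:10:] :: nat poly"
  have ex: "exec_le ?c (regs w [] [] []) (regs [] (f w) [] [])
      (poly p (length w) + 12 * poly l (length w) + 5)" for w
    by (rule exec_le_eq[OF exec_le_Seq[OF c exec_le_Seq[OF exec_shift_reg exec_shift_reg]]])
      (use l[of w] in auto)
  obtain M where M: "wf_tm M" "\<And>ws s s' t n. length ws \<le> 2 \<Longrightarrow>
    s = (\<lambda>r. case r of R0 \<Rightarrow> (if 0 < length ws then ws ! 0 else [])
           | R1 \<Rightarrow> (if 1 < length ws then ws ! 1 else []) | _ \<Rightarrow> []) \<Longrightarrow>
    exec ?c s t s' \<Longrightarrow> t < n \<Longrightarrow>
    halted M (run M n ws) \<and>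
    (fst (run M n ws) = accept M \<longleftrightarrow> top_bit (s' R0) = Some True) \<and>
    snd (run M n ws) ! 1 = string_tape (s' R1)"
    using com_tm_correct[of ?c] by metis
  have "halted M (run M (poly ?p (length w)) [w]) \<and>
      reads_string (snd (run M (poly ?p (length w)) [w]) ! 1) (f w)" for w
  proof -
    obtain t where t: "t \<le> poly p (length w) + 12 * poly l (length w) + 5"
      "exec ?c (regs w [] [] []) t (regs [] (f w) [] [])" using ex[of w] unfolding exec_le_def by blast
    have "t < poly ?p (length w)" using t(1) by simp
    from M(2)[OF _ _ t(2) this, of "[w]"] show ?thesis
      by (auto simp: regs_def fun_eq_iff reads_string_def string_tape_def split: reg.split)
  qed
  then show ?thesis
    unfolding poly_time_computable_def Let_def using M(1) by blast
qed

lemma polytime_verifier_in_NP: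
  assumes "polytime f"
    and L: "\<And>w. w \<in> L \<longleftrightarrow> (\<exists>u. length u \<le> poly q (length w) \<and> f (pair w u) = [True])"
    and f: "\<And>x. f x = [True] \<or> f x = []"
  shows "L \<in> NP"
proof -
  obtain c and p :: "nat poly" where c:
    "\<And>x \<sigma>. exec_le c (regs x \<sigma> [] []) (regs (f x) \<sigma> [] []) (poly p (length x))"
    using polytimeE[OF assms(1)] by blast
  \<comment> \<open>Input and certificate start on separate tapes, whereas \<open>c\<close> expects
    their pair in \<open>R0\<close>.\<close>
  let ?load = "Seq (shift_reg R1 R2) (Seq (shift_reg R0 R3) (Seq (shift_reg R2 R0) (Seq (Push R0 False)
     (dbl_reg R3 R0))))"
  let ?c = "Seq ?load c"
  have load: "exec_le ?load (regs w u [] []) (regs (pair w u) [] [] []) (15 * length w + 12 * length u + 10)"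
    for w u
    by (rule exec_le_eq[OF exec_le_Seq[OF exec_shift_reg exec_le_Seq[OF exec_shift_reg exec_le_Seq[OF
        exec_shift_reg exec_le_Seq[OF exec_le_Push exec_dbl_reg]]]]]) (auto simp: pair_def)
  have ex: "exec_le ?c (regs w u [] []) (regs (f (pair w u)) [] [] [])
      (15 * length w + 12 * length u + 20 + poly p (1 + 2 * length w + length u))" for w u
    by (rule exec_le_eq[OF exec_le_Seq[OF load c]]) auto
  obtain r :: "nat poly" where r: "\<And>n. Suc (15 * n + 12 * poly q n + 20 + poly p (1 + 2 * n + poly q n)) \<le> poly r n"
    by (rule poly_boundedE[of "\<lambda>n. Suc (15 * n + 12 * poly q n + 20 + poly p (1 + 2 * n + poly q n))"])
      (auto intro!: poly_bounded_intros)
  obtain M where M: "wf_tm M" "\<And>ws s s' t n. length ws \<le> 2 \<Longrightarrow>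
    s = (\<lambda>r. case r of R0 \<Rightarrow> (if 0 < length ws then ws ! 0 else [])
           | R1 \<Rightarrow> (if 1 < length ws then ws ! 1 else []) | _ \<Rightarrow> []) \<Longrightarrow>
    exec ?c s t s' \<Longrightarrow> t < n \<Longrightarrow>
    halted M (run M n ws) \<and>
    (fst (run M n ws) = accept M \<longleftrightarrow> top_bit (s' R0) = Some True) \<and>
    snd (run M n ws) ! 1 = string_tape (s' R1)"
    using com_tm_correct[of ?c] by metis
  have main: "halted M (run M (poly r (length w)) [w, u]) \<and>
      (fst (run M (poly r (length w)) [w, u]) = accept M \<longleftrightarrow> f (pair w u) = [True])"
    if u: "length u \<le> poly q (length w)" for w u
  proof -
    obtain t where t: "t \<le> 15 * length w + 12 * length u + 20 + poly p (1 + 2 * length w + length u)"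
      "exec ?c (regs w u [] []) t (regs (f (pair w u)) [] [] [])"
      using ex[of w u] unfolding exec_le_def by blast
    have "poly p (1 + 2 * length w + length u) \<le> poly p (1 + 2 * length w + poly q (length w))"
      using u by (intro poly_nat_mono) simp
    then have "t < poly r (length w)" using t(1) r[of "length w"] u by linarith
    from M(2)[OF _ _ t(2) this, of "[w, u]"] show ?thesis
      using f[of "pair w u"] by (auto simp: regs_def fun_eq_iff split: reg.split)
  qed
  show ?thesis
    unfolding NP_def mem_Collect_eq
    by (rule exI[of _ M], rule exI[of _ r], rule exI[of _ q]) (use M(1) main L in metis)
qed

section \<open>Functional programming with polynomial-time functions\<close>

lemma polytime_length_bounded:
  assumes "polytime f" obtains b where "poly_bounded b" "mono b" "\<And>x. length (f x) \<le> b (length x)"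
  using polytime_length[OF assms] poly_bounded_poly poly_nat_mono by (metis monoI)

lemma polytime_const: "polytime (\<lambda>e. k)"
  by (induction k) (auto intro: polytime_Nil polytime_comp[OF polytime_Cons])

text \<open>The \<open>pt_\<close> rules speak of expressions in an environment \<open>e\<close>, so
  that a proof of polynomial time follows the syntax of a definition. Booleans are represented by
  one-element lists, small numbers by \<open>una\<close> and large numbers by \<open>bits\<close>. A
  bound variable is added to the environment by \<open>pair\<close>.\<close>

lemma pt_first: "polytime f \<Longrightarrow> polytime (\<lambda>e. first (f e))"
  by (rule polytime_comp[OF polytime_first])

lemma pt_second: "polytime f \<Longrightarrow> polytime (\<lambda>e. second (f e))"
  by (rule polytime_comp[OF polytime_second])

lemma pt_tl: "polytime f \<Longrightarrow> polytime (\<lambda>e. tl (f e))"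
  by (rule polytime_comp[OF polytime_tl])

lemma pt_True: "polytime f \<Longrightarrow> polytime (\<lambda>e. True # f e)"
  by (rule polytime_comp[OF polytime_Cons])

lemma pt_False: "polytime f \<Longrightarrow> polytime (\<lambda>e. False # f e)"
  by (rule polytime_comp[OF polytime_Cons])

lemma pt_binary:
  assumes "polytime (\<lambda>x. h (first x) (second x))" "polytime f" "polytime g"
  shows "polytime (\<lambda>e. h (f e) (g e))"
  using polytime_comp[OF assms(1) polytime_pair[OF assms(2,3)]] by simp

text \<open>In \<open>pair [P e] e\<close> the test bit comes right after a marker. Dropping the
  marker puts it on top for the branch, and dropping the bit and the separator gives
  \<open>e\<close> back.\<close>

lemma pt_if:
  assumes "polytime (\<lambda>e. [P e])" "polytime f" "polytime g"
  shows "polytime (\<lambda>e. if P e then f e else g e)"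
proof -
  have "polytime (\<lambda>x. if top_bit x = Some True then f (tl (tl x)) else g (tl (tl x)))"
    by (intro polytime_branch polytime_comp[OF assms(2)] polytime_comp[OF assms(3)] pt_tl polytime_id)
  moreover have "polytime (\<lambda>e. tl (pair [P e] e))"
    by (intro pt_tl polytime_pair assms polytime_id)
  ultimately have "polytime (\<lambda>e. if top_bit (tl (pair [P e] e)) = Some True
      then f (tl (tl (tl (pair [P e] e)))) else g (tl (tl (tl (pair [P e] e)))))"
    by (rule polytime_comp)
  moreover have "tl (tl (tl (pair [b] e))) = e" "top_bit (tl (pair [b] e)) = Some b" for b e
    by (simp_all add: pair_def)
  ultimately show ?thesis by (simp cong: if_cong)
qed

lemma pt_top: "polytime f \<Longrightarrow> polytime (\<lambda>e. [top_bit (f e) = Some True])"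
proof -
  assume f: "polytime f"
  have "(\<lambda>x. [top_bit x = Some True]) = (\<lambda>x. if top_bit x = Some True then [True] else [False])"
    by auto
  then have "polytime (\<lambda>x. [top_bit x = Some True])"
    using polytime_branch[OF polytime_const polytime_const] by simp
  from polytime_comp[OF this f] show ?thesis .
qed

lemma top_bit_pair: "top_bit (pair x y) = Some True \<longleftrightarrow> x \<noteq> []"
  by (cases x) (auto simp: pair_def)

lemma pt_not_Nil: "polytime f \<Longrightarrow> polytime (\<lambda>e. [f e \<noteq> []])"
  using pt_top[OF polytime_pair[OF _ polytime_const], of f "[]"] by (simp add: top_bit_pair)

lemma pt_not: "polytime (\<lambda>e. [P e]) \<Longrightarrow> polytime (\<lambda>e. [\<not> P e])"
proof -
  assume P: "polytime (\<lambda>e. [P e])"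
  have "(\<lambda>e. [\<not> P e]) = (\<lambda>e. if P e then [False] else [True])" by auto
  then show ?thesis using pt_if[OF P polytime_const polytime_const] by simp
qed

lemma pt_conj:
  assumes "polytime (\<lambda>e. [P e])" "polytime (\<lambda>e. [Q e])"
  shows "polytime (\<lambda>e. [P e \<and> Q e])"
proof -
  have "(\<lambda>e. [P e \<and> Q e]) = (\<lambda>e. if P e then [Q e] else [False])" by auto
  then show ?thesis using pt_if[OF assms polytime_const] by simp
qed

lemma pt_disj:
  assumes "polytime (\<lambda>e. [P e])" "polytime (\<lambda>e. [Q e])"
  shows "polytime (\<lambda>e. [P e \<or> Q e])"
proof -
  have "(\<lambda>e. [P e \<or> Q e]) = (\<lambda>e. if P e then [True] else [Q e])" by auto
  then show ?thesis using pt_if[OF assms(1) polytime_const assms(2)] by simp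
qed

lemma pt_imp:
  assumes "polytime (\<lambda>e. [P e])" "polytime (\<lambda>e. [Q e])"
  shows "polytime (\<lambda>e. [P e \<longrightarrow> Q e])"
  unfolding imp_conv_disj by (intro pt_disj pt_not assms)

lemma pt_iff:
  assumes "polytime (\<lambda>e. [P e])" "polytime (\<lambda>e. [Q e])"
  shows "polytime (\<lambda>e. [P e = Q e])"
proof -
  have "(\<lambda>e. [P e = Q e]) = (\<lambda>e. if P e then [Q e] else [\<not> Q e])" by auto
  then show ?thesis using pt_if[OF assms(1,2) pt_not[OF assms(2)]] by simp
qed

lemma pt_Nil: "polytime f \<Longrightarrow> polytime (\<lambda>e. [f e = []])"
  using pt_not[OF pt_not_Nil] by simp

subsection \<open>Recursion\<close>

definition una :: "nat \<Rightarrow> bool list" where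
  "una n = replicate n True"

lemma length_una [simp]: "length (una n) = n" by (simp add: una_def)

lemma una_simps: "una 0 = []" "una (Suc n) = True # una n" by (simp_all add: una_def)

text \<open>Bounded primitive recursion is the iteration of a map on triples of environment, counter
  and value. The counter is a unary string, so the step function sees the index as a length.\<close>

lemma polytime_rec:
  assumes h: "polytime (\<lambda>x. h (first x) (length (first (second x))) (second (second x)))"
    and "polytime g" "polytime l" and b: "poly_bounded b"
    and 0: "\<And>e. R e 0 = g e" and Suc: "\<And>e i. i < length (l e) \<Longrightarrow> R e (Suc i) = h e i (R e i)"
    and le: "\<And>e i. i \<le> length (l e) \<Longrightarrow> length (R e i) \<le> b (length e)"
  shows "polytime (\<lambda>e. R e (length (l e)))"
proof -
  let ?f = "\<lambda>x. pair (first x) (pair (True # first (second x))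
      (h (first x) (length (first (second x))) (second (second x))))"
  let ?s = "\<lambda>e. pair e (pair [] (g e))"
  have it: "(?f ^^ i) (?s e) = pair e (pair (una i) (R e i))" if "i \<le> length (l e)" for e i
    using that by (induction i) (auto simp: 0 Suc una_simps)
  obtain c where c: "poly_bounded c" "\<And>x. length (l x) \<le> c (length x)"
    using polytime_length_bounded[OF assms(3)] by metis
  have "polytime (\<lambda>e. (?f ^^ length (l e)) (?s e))"
  proof (rule polytime_iterate)
    show "poly_bounded (\<lambda>n. 2 * n + 2 * c n + b n + 2)" by (intro poly_bounded_intros c b)
    show "length ((?f ^^ i) (?s e)) \<le> 2 * length e + 2 * c (length e) + b (length e) + 2"
      if "i \<le> length (l e)" for e i
      using that it[OF that] le[OF that] c(2)[of e] by simp
  qed (intro polytime_pair pt_first pt_second pt_True polytime_id polytime_const assms)+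
  from pt_second[OF pt_second[OF this]] show ?thesis by (simp add: it)
qed

lemma pt_una_length: "polytime f \<Longrightarrow> polytime (\<lambda>e. una (length (f e)))"
proof -
  assume f: "polytime f"
  obtain c where c: "poly_bounded c" "\<And>x. length (f x) \<le> c (length x)"
    using polytime_length_bounded[OF f] by metis
  show ?thesis
    by (rule polytime_rec[where h = "\<lambda>e i r. True # r" and R = "\<lambda>e. una" and g = "\<lambda>_. []" and l = f and b = c, OF _ _ f c(1)])
      (auto intro!: pt_True pt_second polytime_id polytime_const simp: una_simps intro: order_trans[OF _ c(2)])
qed

lemma pt_una_rec:
  assumes h: "polytime (\<lambda>x. h (first x) (length (first (second x))) (second (second x)))"
    and "polytime g" "polytime (\<lambda>e. una (N e))" and b: "poly_bounded b"
    and 0: "\<And>e. R e 0 = g e" and Suc: "\<And>e i. i < N e \<Longrightarrow> R e (Suc i) = h e i (R e i)"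
    and le: "\<And>e i. i \<le> N e \<Longrightarrow> length (R e i) \<le> b (length e)"
  shows "polytime (\<lambda>e. R e (N e))"
  using polytime_rec[where R = R and h = h and g = g and l = "\<lambda>e. una (N e)" and b = b] assms by simp

lemma pt_una_bounded:
  assumes "polytime (\<lambda>e. una (N e))" obtains b where "poly_bounded b" "\<And>x. N x \<le> b (length x)"
  using polytime_length_bounded[OF assms] by (metis length_una)

lemma pt_rev_append:
  assumes f: "polytime f" and g: "polytime g"
  shows "polytime (\<lambda>e. rev (f e) @ g e)"
proof -
  \<comment> \<open>Part of the state is the unread rest of \<open>f e\<close>, whose top is the bit
    to be moved next.\<close>
  let ?R = "\<lambda>e i. pair (drop i (f e)) (rev (take i (f e)) @ g e)"
  let ?h = "\<lambda>e i r. pair (tl (first r)) (if top_bit (first r) = Some True then True # second r else False # second r)"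
  obtain c where c: "poly_bounded c" "\<And>x. length (f x) \<le> c (length x)"
    using polytime_length_bounded[OF f] by metis
  obtain d where d: "poly_bounded d" "\<And>x. length (g x) \<le> d (length x)"
    using polytime_length_bounded[OF g] by metis
  have "polytime (\<lambda>e. ?R e (length (f e)))"
  proof (rule polytime_rec[where h = ?h and R = ?R and l = f and g = "\<lambda>e. pair (f e) (g e)"
      and b = "\<lambda>n. 2 * c n + (c n + d n) + 1"])
    show "?R e (Suc i) = ?h e i (?R e i)" if "i < length (f e)" for e i
      using that by (cases "f e ! i") (simp_all add: Cons_nth_drop_Suc[symmetric] take_Suc_conv_app_nth)
    show "length (?R e i) \<le> 2 * c (length e) + (c (length e) + d (length e)) + 1" for e i
      using c(2)[of e] d(2)[of e] by simp
    show "poly_bounded (\<lambda>n. 2 * c n + (c n + d n) + 1)" by (intro poly_bounded_intros c d)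
  qed (intro polytime_pair pt_tl pt_first pt_second pt_if pt_top pt_True pt_False polytime_id
      poly_bounded_intros c d f g | simp)+
  from pt_second[OF this] show ?thesis by simp
qed

lemma pt_append: "polytime f \<Longrightarrow> polytime g \<Longrightarrow> polytime (\<lambda>e. f e @ g e)"
  using pt_rev_append[OF pt_rev_append[OF _ polytime_const, of f "[]"]] by simp

lemma pt_drop:
  assumes N: "polytime (\<lambda>e. una (N e))" and f: "polytime f"
  shows "polytime (\<lambda>e. drop (N e) (f e))"
proof -
  obtain c where c: "poly_bounded c" "\<And>x. length (f x) \<le> c (length x)"
    using polytime_length_bounded[OF f] by metis
  show ?thesis
    by (rule pt_una_rec[where h = "\<lambda>e i r. tl r" and g = f and N = N and b = c and R = "\<lambda>e i. drop i (f e)", OF _ f N c(1)])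
      (auto simp: drop_Suc tl_drop[symmetric] intro!: pt_tl pt_second polytime_id intro: le_diff_conv2[THEN iffD2] order_trans[OF _ c(2)])
qed

definition nth_bit :: "bool list \<Rightarrow> nat \<Rightarrow> bool" where
  "nth_bit l i \<longleftrightarrow> top_bit (drop i l) = Some True"

lemma nth_bit_iff: "nth_bit l i \<longleftrightarrow> i < length l \<and> l ! i"
  by (cases "i < length l") (simp_all add: nth_bit_def Cons_nth_drop_Suc[symmetric])

lemma pt_nth_bit: "polytime f \<Longrightarrow> polytime (\<lambda>e. una (N e)) \<Longrightarrow> polytime (\<lambda>e. [nth_bit (f e) (N e)])"
  unfolding nth_bit_def by (intro pt_top pt_drop)

text \<open>An index below \<open>N e\<close> lengthens the argument of \<open>h\<close> only
  polynomially, so all pieces have a common polynomial bound. The size condition of the recursion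
  thus disappears, and quantifiers and counting can be reduced to this rule without side
  conditions.\<close>

lemma pt_concat:
  assumes h: "polytime (\<lambda>x. h (first x) (length (second x)))" and N: "polytime (\<lambda>e. una (N e))"
  shows "polytime (\<lambda>e. concat (map (\<lambda>i. h e i) [0..<N e]))"
proof -
  obtain c where c: "poly_bounded c" "\<And>x. N x \<le> c (length x)"
    using pt_una_bounded[OF N] by metis
  obtain d where d: "poly_bounded d" "mono d"
    "\<And>x. length (h (first x) (length (second x))) \<le> d (length x)"
    using polytime_length_bounded[OF h] by metis
  have hl: "length (h e i) \<le> d (2 * length e + c (length e) + 1)" if "i < N e" for e i
  proof -
    have "length (h e i) \<le> d (2 * length e + i + 1)" using d(3)[of "pair e (una i)"] by simp
    also have "\<dots> \<le> d (2 * length e + c (length e) + 1)"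
      using that c(2)[of e] by (intro monoD[OF d(2)]) simp
    finally show ?thesis .
  qed
  obtain p where p: "\<And>n. d n \<le> poly p n" using poly_boundedE[OF d(1)] by blast
  have len: "length (concat (map (\<lambda>i. h e i) [0..<i])) \<le> i * d (2 * length e + c (length e) + 1)"
    if "i \<le> N e" for e i
    using that
  proof (induction i)
    case (Suc i)
    show ?case using Suc.IH Suc.prems hl[of i e] by simp
  qed simp
  show ?thesis
  proof (rule pt_una_rec[where h = "\<lambda>e i r. r @ h e i" and R = "\<lambda>e i. concat (map (\<lambda>i. h e i) [0..<i])"
      and g = "\<lambda>e. []" and N = N and b = "\<lambda>n. c n * poly p (2 * n + c n + 1)"])
    have "polytime (\<lambda>x. h (first (pair (first x) (first (second x))))
        (length (second (pair (first x) (first (second x))))))"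
      by (intro polytime_comp[OF h] polytime_pair pt_first pt_second polytime_id)
    then show "polytime (\<lambda>x. second (second x) @ h (first x) (length (first (second x))))"
      by (intro pt_append pt_second polytime_id) simp
    show "length (concat (map (\<lambda>i. h e i) [0..<i])) \<le> c (length e) * poly p (2 * length e + c (length e) + 1)"
      if "i \<le> N e" for e i
      by (rule order_trans[OF len[OF that] mult_mono]) (use that c(2)[of e] p in auto)
    show "poly_bounded (\<lambda>n. c n * poly p (2 * n + c n + 1))"
      by (intro poly_bounded_intros c)
  qed (auto intro: polytime_const N)
qed

lemma concat_eq_Nil_upt: "concat (map f [0..<n]) = [] \<longleftrightarrow> (\<forall>i<n. f i = [])"
  by (auto simp: set_upt)

text \<open>Each counterexample contributes a bit to a concatenation, which is empty iff the
  statement holds.\<close>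

lemma pt_all:
  assumes P: "polytime (\<lambda>x. [P (first x) (length (second x))])" and N: "polytime (\<lambda>e. una (N e))"
  shows "polytime (\<lambda>e. [\<forall>i<N e. P e i])"
proof -
  have "polytime (\<lambda>x. if P (first x) (length (second x)) then [] else [True])"
    by (intro pt_if P polytime_const)
  from pt_Nil[OF pt_concat[of "\<lambda>e i. if P e i then [] else [True]", OF this N]]
  have "polytime (\<lambda>e. [\<forall>i<N e. (if P e i then [] else [True]) = []])"
    unfolding concat_eq_Nil_upt .
  moreover have "((if b then [] else [True]) = []) = b" for b by simp
  ultimately show ?thesis by (simp only:)
qed

lemma pt_ex:
  assumes P: "polytime (\<lambda>x. [P (first x) (length (second x))])" and N: "polytime (\<lambda>e. una (N e))"
  shows "polytime (\<lambda>e. [\<exists>i<N e. P e i])"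
  using pt_not[OF pt_all[of "\<lambda>e i. \<not> P e i", OF pt_not[OF P] N]] by simp

subsection \<open>Unary numbers\<close>

lemma una_add: "una (m + n) = una m @ una n" by (simp add: una_def replicate_add)

lemma pt_una_const: "polytime (\<lambda>e. una k)" by (rule polytime_const)

lemma pt_una_Suc: "polytime (\<lambda>e. una (N e)) \<Longrightarrow> polytime (\<lambda>e. una (Suc (N e)))"
  unfolding una_simps by (rule pt_True)

lemma pt_una_add:
  "polytime (\<lambda>e. una (N e)) \<Longrightarrow> polytime (\<lambda>e. una (M e)) \<Longrightarrow> polytime (\<lambda>e. una (N e + M e))"
  unfolding una_add by (rule pt_append)

lemma pt_una_diff:
  "polytime (\<lambda>e. una (N e)) \<Longrightarrow> polytime (\<lambda>e. una (M e)) \<Longrightarrow> polytime (\<lambda>e. una (N e - M e))"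
  using pt_drop[of M "\<lambda>e. una (N e)"] by (simp add: una_def)

lemma pt_una_mult:
  assumes "polytime (\<lambda>e. una (N e))" "polytime (\<lambda>e. una (M e))"
  shows "polytime (\<lambda>e. una (N e * M e))"
proof -
  have *: "concat (map (\<lambda>i. una m) [0..<n]) = una (n * m)" for m n
    by (induction n) (auto simp: una_add[symmetric] una_simps add.commute)
  show ?thesis
    using pt_concat[of "\<lambda>e i. una (M e)", OF polytime_comp[OF assms(2) polytime_first] assms(1)]
    by (simp add: *)
qed

lemma pt_una_if:
  "polytime (\<lambda>e. [P e]) \<Longrightarrow> polytime (\<lambda>e. una (N e)) \<Longrightarrow> polytime (\<lambda>e. una (M e)) \<Longrightarrow>
   polytime (\<lambda>e. una (if P e then N e else M e))"
  using pt_if[of P "\<lambda>e. una (N e)" "\<lambda>e. una (M e)"] by (simp add: if_distrib)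

lemma pt_le:
  "polytime (\<lambda>e. una (N e)) \<Longrightarrow> polytime (\<lambda>e. una (M e)) \<Longrightarrow> polytime (\<lambda>e. [N e \<le> M e])"
  using pt_Nil[OF pt_una_diff[of N M]] by (simp add: una_def)

lemma pt_less:
  "polytime (\<lambda>e. una (N e)) \<Longrightarrow> polytime (\<lambda>e. una (M e)) \<Longrightarrow> polytime (\<lambda>e. [N e < M e])"
  using pt_not[OF pt_le[of M N]] by (simp add: not_le)

lemma pt_eq:
  "polytime (\<lambda>e. una (N e)) \<Longrightarrow> polytime (\<lambda>e. una (M e)) \<Longrightarrow> polytime (\<lambda>e. [(N e :: nat) = M e])"
  using pt_conj[OF pt_le[of N M] pt_le[of M N]] by (simp add: eq_iff)

lemma length_concat_upt_if: "length (concat (map (\<lambda>i. if P i then [True] else []) [0..<n])) = card {i. i < n \<and> P i}"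
proof (induction n)
  case (Suc n)
  have "{i. i < Suc n \<and> P i} = {i. i < n \<and> P i} \<union> (if P n then {n} else {})"
    by (auto simp: less_Suc_eq)
  then show ?case using Suc by (auto simp: card_insert_if)
qed simp

lemma pt_una_card:
  assumes P: "polytime (\<lambda>x. [P (first x) (length (second x))])" and N: "polytime (\<lambda>e. una (N e))"
  shows "polytime (\<lambda>e. una (card {i. i < N e \<and> P e i}))"
proof -
  have "polytime (\<lambda>x. if P (first x) (length (second x)) then [True] else [])"
    by (intro pt_if P polytime_const)
  from pt_una_length[OF pt_concat[of "\<lambda>e i. if P e i then [True] else []", OF this N]] show ?thesis
    by (simp only: length_concat_upt_if)
qed

lemma pt_una_div:
  assumes "polytime (\<lambda>e. una (N e))" "polytime (\<lambda>e. una (M e))"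
  shows "polytime (\<lambda>e. una (N e div M e))"
proof -
  \<comment> \<open>The quotient counts the positive multiples of \<open>m\<close> up to
    \<open>n\<close>; the condition \<open>0 < m\<close> yields the value 0 for division by
    0.\<close>
  have *: "n div m = card {i. i < n \<and> 0 < m \<and> Suc i * m \<le> n}" for n m :: nat
  proof (cases "m = 0")
    case False
    then have "{i. i < n \<and> 0 < m \<and> Suc i * m \<le> n} = {..<n div m}"
      by (auto simp: less_eq_div_iff_mult_less_eq Suc_le_eq[symmetric] simp del: mult_Suc)
        (meson False Suc_le_lessD div_le_dividend less_eq_div_iff_mult_less_eq not_gr_zero order_trans)
    then show ?thesis by simp
  qed simp
  show ?thesis
    unfolding *
    by (intro pt_una_card pt_conj pt_less pt_le pt_una_mult pt_una_Suc pt_una_const pt_una_length pt_second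
        polytime_id polytime_comp[OF assms(1)] polytime_comp[OF assms(2)] assms pt_first)
qed

lemma pt_una_mod:
  assumes "polytime (\<lambda>e. una (N e))" "polytime (\<lambda>e. una (M e))"
  shows "polytime (\<lambda>e. una (N e mod M e))"
  unfolding modulo_nat_def by (intro pt_una_diff pt_una_mult pt_una_div assms)

lemma pt_una_poly: "polytime (\<lambda>e. una (N e)) \<Longrightarrow> polytime (\<lambda>e. una (poly p (N e)))"
  by (induction p) (auto intro: pt_una_const pt_una_add pt_una_mult)

text \<open>Any finite table is computable by a fixed chain of comparisons, whatever
  \<open>f\<close> is. In this way the transition function of a machine enters the
  reduction.\<close>

lemma pt_una_table:
  assumes "polytime (\<lambda>e. una (N e))"
  shows "polytime (\<lambda>e. una (if N e < k then f (N e) else 0))"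
proof (induction k)
  case (Suc k)
  have "(if n < Suc k then f n else 0) = (if n = k then f k else if n < k then f n else 0)" for n
    by auto
  then show ?case
    using pt_una_if[OF pt_eq[OF assms pt_una_const[of k]] pt_una_const[of "f k"] Suc] by simp
qed (simp add: pt_una_const)

lemma pt_list_eq:
  assumes "polytime f" "polytime g"
  shows "polytime (\<lambda>e. [f e = g e])"
proof -
  have *: "f e = g e \<longleftrightarrow> length (f e) = length (g e) \<and> (\<forall>i<length (f e). nth_bit (f e) i = nth_bit (g e) i)" for e
    by (auto simp: nth_bit_iff list_eq_iff_nth_eq)
  show ?thesis
    unfolding *
    by (intro pt_conj pt_eq pt_una_length pt_all pt_iff pt_nth_bit assms pt_second polytime_id
        polytime_comp[OF assms(1)] polytime_comp[OF assms(2)] pt_first)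
qed

subsection \<open>Binary numbers\<close>

fun val :: "bool list \<Rightarrow> nat" where
  "val [] = 0"
| "val (b # l) = of_bool b + 2 * val l"

lemma val_bits [simp]: "val (bits n) = n"
proof (induction n rule: less_induct)
  case (less n)
  then show ?case by (cases "n = 0") (simp_all add: bits_0 bits_pos)
qed

lemma val_eq_0_iff: "val l = 0 \<longleftrightarrow> (\<forall>i<length l. \<not> l ! i)"
  by (induction l) (auto simp: nth_Cons' less_Suc_eq_0_disj)

lemma bits_val_Cons: "bits (val (b # l)) = (if val (b # l) = 0 then [] else b # bits (val l))"
  by (auto simp: bits_0 bits_pos)

text \<open>Normalisation of a binary numeral: a bit is kept iff a set bit occurs at its position or
  a more significant one.\<close>

lemma bits_val:
  "bits (val l) = concat (map (\<lambda>i. if \<exists>j<length l. i \<le> j \<and> l ! j then [l ! i] else []) [0..<length l])"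
proof (induction l)
  case (Cons b l)
  have upt: "[0..<length (b # l)] = 0 # map Suc [0..<length l]"
    using upt_conv_Cons[of 0 "Suc (length l)"] by (simp add: map_Suc_upt del: upt_Suc)
  have 0: "(\<exists>j<length (b # l). 0 \<le> j \<and> (b # l) ! j) \<longleftrightarrow> val (b # l) \<noteq> 0"
    unfolding val_eq_0_iff by auto
  have S: "(\<exists>j<length (b # l). Suc i \<le> j \<and> (b # l) ! j) \<longleftrightarrow> (\<exists>j<length l. i \<le> j \<and> l ! j)" for i
    by (metis (no_types, lifting) Suc_le_D Suc_le_mono length_Cons Suc_less_eq nth_Cons_Suc)
  have "val (b # l) = 0 \<Longrightarrow> bits (val l) = []" by (simp add: bits_0)
  then show ?case
    unfolding bits_val_Cons[of b l] upt list.map concat.simps map_map comp_def 0 S Cons.IH[symmetric]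
      nth_Cons_Suc by auto
qed (simp add: bits_0)

lemma pt_bits_val:
  assumes "polytime f"
  shows "polytime (\<lambda>e. bits (val (f e)))"
proof -
  have *: "(if \<exists>j<length l. i \<le> j \<and> l ! j then [l ! i] else []) =
    (if \<exists>j<length l. i \<le> j \<and> nth_bit l j then [nth_bit l i] else [])" for l i
    by (auto simp: nth_bit_iff)
  show ?thesis
    unfolding bits_val *
    by (intro pt_concat pt_if pt_ex pt_conj pt_le pt_nth_bit pt_una_length
        pt_first pt_second polytime_id polytime_const polytime_comp[OF assms] assms)
qed

lemma val_eq_sum: "length l \<le> n \<Longrightarrow> val l = (\<Sum>i<n. of_bool (nth_bit l i) * 2 ^ i)"
proof (induction l arbitrary: n)
  case (Cons b l)
  then obtain m where n: "n = Suc m" "length l \<le> m" by (cases n) auto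
  have "nth_bit (b # l) (Suc i) = nth_bit l i" "nth_bit (b # l) 0 = b" for i
    by (auto simp: nth_bit_iff)
  then show ?case
    unfolding n(1) sum.lessThan_Suc_shift val.simps Cons.IH[OF n(2)] sum_distrib_left
    by (simp add: mult.left_commute del: sum_of_bool_mult_eq)
qed (simp add: nth_bit_iff)

lemma val_map: "val (map f [0..<n]) = (\<Sum>i<n. of_bool (f i) * 2 ^ i)"
  by (subst val_eq_sum[of _ n]) (auto simp: nth_bit_iff intro!: sum.cong)

text \<open>Carry look-ahead: there is a carry into a position iff it was generated at some lower
  position and propagated by all positions in between.\<close>

definition carry :: "bool list \<Rightarrow> bool list \<Rightarrow> nat \<Rightarrow> bool" where
  "carry x y i \<longleftrightarrow> (\<exists>j<i. (nth_bit x j \<and> nth_bit y j) \<and> (\<forall>k<i. j < k \<longrightarrow> nth_bit x k \<or> nth_bit y k))"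

lemma carry_Suc:
  "carry x y (Suc i) \<longleftrightarrow> nth_bit x i \<and> nth_bit y i \<or> carry x y i \<and> (nth_bit x i \<or> nth_bit y i)"
  unfolding carry_def by (auto simp: less_Suc_eq)

text \<open>The bit is the exclusive or of both digits and the carry, written with two equalities.
  The length exceeds those of both arguments, so no carry is left over. No recursion is involved,
  only bounded quantifiers.\<close>

definition add_bits :: "bool list \<Rightarrow> bool list \<Rightarrow> bool list" where
  "add_bits x y = concat (map (\<lambda>i. [(nth_bit x i = nth_bit y i) = carry x y i])
     [0..<Suc (length x + length y)])"

lemma val_add_bits: "val (add_bits x y) = val x + val y"
proof -
  \<comment> \<open>The invariant of an adder: the lowest \<open>n\<close> digits are correct up to
    the carry into position \<open>n\<close>.\<close>
  have inv: "(\<Sum>i<n. of_bool (nth_bit x i) * 2 ^ i) + (\<Sum>i<n. of_bool (nth_bit y i) * 2 ^ i) =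
      (\<Sum>i<n. of_bool ((nth_bit x i = nth_bit y i) = carry x y i) * 2 ^ i)
      + of_bool (carry x y n) * (2 ^ n :: nat)" for n
  proof (induction n)
    case 0
    then show ?case by (simp add: carry_def)
  next
    case (Suc n)
    show ?case
      using Suc unfolding carry_Suc
      by (cases "nth_bit x n"; cases "nth_bit y n"; cases "carry x y n") auto
  qed
  let ?n = "Suc (length x + length y)"
  have "\<not> carry x y ?n"
    unfolding carry_def by (auto simp: nth_bit_iff dest!: spec[of _ "length x + length y"])
  moreover have "concat (map (\<lambda>i. [f i]) xs) = map f xs" for f :: "nat \<Rightarrow> bool" and xs
    by (induction xs) auto
  ultimately show ?thesis
    using inv[of ?n] unfolding add_bits_def val_map
    by (simp add: val_map val_eq_sum[of x ?n] val_eq_sum[of y ?n] del: sum.lessThan_Suc upt_Suc)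
qed

lemma pt_bits_const: "polytime (\<lambda>e. bits k)" by (rule polytime_const)

lemma pt_bits_if:
  "polytime (\<lambda>e. [P e]) \<Longrightarrow> polytime (\<lambda>e. bits (N e)) \<Longrightarrow> polytime (\<lambda>e. bits (M e)) \<Longrightarrow>
   polytime (\<lambda>e. bits (if P e then N e else M e))"
  using pt_if[of P "\<lambda>e. bits (N e)" "\<lambda>e. bits (M e)"] by (simp add: if_distrib)

lemma pt_bits_add:
  assumes "polytime (\<lambda>e. bits (N e))" "polytime (\<lambda>e. bits (M e))"
  shows "polytime (\<lambda>e. bits (N e + M e))"
proof -
  have "polytime (\<lambda>x. add_bits (first x) (second x))"
    unfolding add_bits_def carry_def
    by (intro pt_concat pt_iff pt_ex pt_all pt_disj pt_conj pt_imp pt_less pt_nth_bit pt_una_Suc pt_una_add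
        pt_una_length pt_first pt_second polytime_id)
  from pt_bits_val[OF pt_binary[OF this assms]] show ?thesis by (simp add: val_add_bits)
qed

lemma length_bits_le_iff: "length (bits n) \<le> k \<longleftrightarrow> n < 2 ^ k"
proof (induction n arbitrary: k rule: less_induct)
  case (less n)
  then show ?case
  proof (cases "n = 0")
    case False
    have IH: "length (bits (n div 2)) \<le> j \<longleftrightarrow> n div 2 < 2 ^ j" for j
      by (rule less) (use False in auto)
    have len: "length (bits n) = Suc (length (bits (n div 2)))"
      by (subst bits_pos[OF False]) simp
    have half: "a div 2 < b \<longleftrightarrow> a < 2 * b" for a b :: nat by presburger
    show ?thesis
    proof (cases k)
      case (Suc j)
      have "length (bits n) \<le> k \<longleftrightarrow> n div 2 < 2 ^ j"
        unfolding len Suc using IH[of j] by simp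
      also have "\<dots> \<longleftrightarrow> n < 2 * 2 ^ j" using half .
      finally show ?thesis unfolding Suc power_Suc .
    qed (use False len in simp)
  qed (simp add: bits_0)
qed

lemma pt_bits_rec:
  assumes h: "polytime (\<lambda>x. bits (h (first x) (length (first (second x))) (val (second (second x)))))"
    and g: "polytime (\<lambda>e. bits (R e 0))" and N: "polytime (\<lambda>e. una (N e))" and b: "poly_bounded b"
    and Suc: "\<And>e i. i < N e \<Longrightarrow> R e (Suc i) = h e i (R e i)"
    and le: "\<And>e i. i \<le> N e \<Longrightarrow> R e i < 2 ^ b (length e)"
  shows "polytime (\<lambda>e. bits (R e (N e)))"
  by (rule pt_una_rec[where h = "\<lambda>e i r. bits (h e i (val r))" and R = "\<lambda>e i. bits (R e i)"
        and g = "\<lambda>e. bits (R e 0)" and N = N and b = b, OF h g N b])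
    (simp_all add: Suc le length_bits_le_iff)

lemma pt_bits_family:
  assumes h: "polytime (\<lambda>x. bits (f (first x) (length (second x))))" and N: "polytime (\<lambda>e. una (N e))"
  obtains b where "poly_bounded b" "\<And>e i. i < N e \<Longrightarrow> f e i < 2 ^ b (length e)"
    "\<And>e. N e \<le> b (length e)"
    "polytime (\<lambda>x. bits (f (first x) (length (first (second x)))))"
proof -
  obtain c where c: "poly_bounded c" "\<And>x. N x \<le> c (length x)"
    using pt_una_bounded[OF N] by metis
  obtain d where d: "poly_bounded d" "mono d"
    "\<And>x. length (bits (f (first x) (length (second x)))) \<le> d (length x)"
    using polytime_length_bounded[OF h] by metis
  obtain p where p: "\<And>n. d n \<le> poly p n" using poly_boundedE[OF d(1)] by blast
  let ?b = "\<lambda>n. poly p (2 * n + c n + 1) + c n"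
  have "f e i < 2 ^ ?b (length e)" if "i < N e" for e i
  proof -
    have "length (bits (f e i)) \<le> d (2 * length e + i + 1)" using d(3)[of "pair e (una i)"] by simp
    also have "\<dots> \<le> d (2 * length e + c (length e) + 1)"
      using that c(2)[of e] by (intro monoD[OF d(2)]) simp
    also have "\<dots> \<le> ?b (length e)" using p trans_le_add1 by blast
    finally show ?thesis by (simp add: length_bits_le_iff)
  qed
  moreover have "poly_bounded ?b" by (intro poly_bounded_intros c)
  moreover have "N e \<le> ?b (length e)" for e using c(2)[of e] by (simp add: trans_le_add2)
  moreover have "polytime (\<lambda>x. bits (f (first (pair (first x) (first (second x))))
      (length (second (pair (first x) (first (second x)))))))"
    by (intro polytime_comp[OF h] polytime_pair pt_first pt_second polytime_id)
  ultimately show ?thesis using that[of ?b] by simp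
qed

lemma pt_bits_sum:
  assumes f: "polytime (\<lambda>x. bits (f (first x) (length (second x))))" and N: "polytime (\<lambda>e. una (N e))"
  shows "polytime (\<lambda>e. bits (\<Sum>i<N e. f e i))"
proof -
  obtain b where b: "poly_bounded b" "\<And>e i. i < N e \<Longrightarrow> f e i < 2 ^ b (length e)"
    "\<And>e. N e \<le> b (length e)" "polytime (\<lambda>x. bits (f (first x) (length (first (second x)))))"
    using pt_bits_family[OF assms] by metis
  have "(\<Sum>i<n. f e i) < 2 ^ (b (length e) + n)" if "n \<le> N e" for e n
    using that
  proof (induction n)
    case (Suc n)
    have "f e n < 2 ^ (b (length e) + n)"
      by (rule less_le_trans[OF b(2)]) (use Suc.prems in auto)
    then show ?case using Suc by simp
  qed simp
  moreover have "2 ^ (b (length e) + n) \<le> (2 :: nat) ^ (b (length e) + b (length e))" if "n \<le> N e" for e n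
    using b(3)[of e] that by (intro power_increasing) auto
  ultimately have bd: "(\<Sum>i<n. f e i) < 2 ^ (b (length e) + b (length e))" if "n \<le> N e" for e n
    using that less_le_trans by blast
  show ?thesis
    by (intro pt_bits_rec[where h = "\<lambda>e i r. r + f e i" and R = "\<lambda>e n. \<Sum>i<n. f e i" and N = N and b = "\<lambda>n. b n + b n"]
       pt_bits_add pt_bits_val pt_second polytime_id b N poly_bounded_intros)
     (simp_all add: bd pt_bits_const del: power_add)
qed

lemma pt_bits_mult:
  assumes "polytime (\<lambda>e. bits (N e))" "polytime (\<lambda>e. bits (M e))"
  shows "polytime (\<lambda>e. bits (N e * M e))"
proof -
  \<comment> \<open>School multiplication: \<open>i\<close> zeros at the least significant end
    multiply by \<open>2 ^ i\<close>.\<close>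
  let ?f = "\<lambda>e i. if nth_bit (bits (N e)) i then val (concat (map (\<lambda>k. [False]) [0..<i]) @ bits (M e)) else 0"
  have sh: "val (map (\<lambda>k. False) [0..<i] @ l) = 2 ^ i * val l" for i l
    by (induction i arbitrary: l) auto
  have "N e * M e = (\<Sum>i<length (bits (N e)). of_bool (nth_bit (bits (N e)) i) * 2 ^ i) * M e" for e
    by (subst val_eq_sum[symmetric]) simp_all
  then have *: "N e * M e = (\<Sum>i<length (bits (N e)). ?f e i)" for e
    by (subst (asm) sum_distrib_right) (auto simp: sh intro!: sum.cong)
  show ?thesis
    unfolding *
    by (intro pt_bits_sum pt_bits_if pt_nth_bit pt_bits_val pt_append pt_concat pt_bits_const polytime_const
       pt_una_length pt_first pt_second polytime_id assms polytime_comp[OF assms(1)] polytime_comp[OF assms(2)])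
qed

lemma pt_bits_prod:
  assumes f: "polytime (\<lambda>x. bits (f (first x) (length (second x))))" and N: "polytime (\<lambda>e. una (N e))"
  shows "polytime (\<lambda>e. bits (\<Prod>i<N e. f e i))"
proof -
  obtain b where b: "poly_bounded b" "\<And>e i. i < N e \<Longrightarrow> f e i < 2 ^ b (length e)"
    "\<And>e. N e \<le> b (length e)" "polytime (\<lambda>x. bits (f (first x) (length (first (second x)))))"
    using pt_bits_family[OF assms] by metis
  have "(\<Prod>i<n. f e i) \<le> 2 ^ (b (length e) * n)" if "n \<le> N e" for e n
    using that
  proof (induction n)
    case (Suc n)
    have "(\<Prod>i<n. f e i) * f e n \<le> 2 ^ (b (length e) * n) * 2 ^ b (length e)"
      using Suc b(2)[of n e] by (intro mult_mono) auto
    then show ?case by (simp add: power_add mult.commute)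
  qed simp
  moreover have "2 ^ (b (length e) * n) < (2 :: nat) ^ (b (length e) * b (length e) + 1)" if "n \<le> N e" for e n
    using b(3)[of e] that by (intro power_strict_increasing) (auto simp: less_Suc_eq_le)
  ultimately have bd: "(\<Prod>i<n. f e i) < 2 ^ (b (length e) * b (length e) + 1)" if "n \<le> N e" for e n
    using that le_less_trans by blast
  show ?thesis
    by (intro pt_bits_rec[where h = "\<lambda>e i r. r * f e i" and R = "\<lambda>e n. \<Prod>i<n. f e i" and N = N and b = "\<lambda>n. b n * b n + 1"]
       pt_bits_mult pt_bits_val pt_second polytime_id b N poly_bounded_intros)
     (simp_all add: bd[simplified] pt_bits_const)
qed

lemma bits_eq_iff: "bits m = bits n \<longleftrightarrow> m = n"
  using bits_inj by blast

lemma pt_bits_eq: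
  "polytime (\<lambda>e. bits (N e)) \<Longrightarrow> polytime (\<lambda>e. bits (M e)) \<Longrightarrow> polytime (\<lambda>e. [N e = M e])"
  using pt_list_eq[of "\<lambda>e. bits (N e)" "\<lambda>e. bits (M e)"] by (simp add: bits_eq_iff)

subsection \<open>Lists of strings\<close>

text \<open>Lists are right-nested pairs. The function is total on arbitrary strings, so a
  certificate never has to be checked for its format.\<close>

definition item :: "nat \<Rightarrow> bool list \<Rightarrow> bool list" where
  "item i u = first ((second ^^ i) u)"

definition join :: "bool list list \<Rightarrow> bool list" where
  "join xs = foldr pair xs []"

lemma item_join [simp]: "i < length xs \<Longrightarrow> item i (join xs) = xs ! i"
proof (induction xs arbitrary: i)
  case (Cons x xs)
  then show ?case
    by (cases i) (auto simp: item_def join_def funpow_Suc_right simp del: funpow.simps(2))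
qed simp

lemma length_join: "length (join xs) = length xs + 2 * (\<Sum>x\<leftarrow>xs. length x)"
  by (induction xs) (auto simp: join_def)

lemma length_funpow_second: "length ((second ^^ i) u) \<le> length u"
  by (induction i) (auto intro: order_trans[OF length_second])

lemma pt_item:
  assumes N: "polytime (\<lambda>e. una (N e))" and f: "polytime f"
  shows "polytime (\<lambda>e. item (N e) (f e))"
proof -
  obtain c where c: "poly_bounded c" "\<And>x. length (f x) \<le> c (length x)"
    using polytime_length_bounded[OF f] by metis
  show ?thesis
    unfolding item_def
    by (rule pt_first, rule pt_una_rec[where h = "\<lambda>e i r. second r" and g = f and N = N and b = c and R = "\<lambda>e i. (second ^^ i) (f e)", OF _ f N c(1)])
      (auto intro!: pt_second polytime_id intro: order_trans[OF length_funpow_second c(2)])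
qed

section \<open>The tableau of a verifier\<close>

definition code :: "bool option \<Rightarrow> nat" where
  "code x = (case x of None \<Rightarrow> 0 | Some b \<Rightarrow> if b then 2 else 1)"

lemma code_simps [simp]: "code None = 0" "code (Some True) = 2" "code (Some False) = 1"
  by (simp_all add: code_def)

lemma code_inject [simp]: "code x = code y \<longleftrightarrow> x = y"
  by (cases x; cases y) (auto simp: code_def split: if_splits)

lemma code_less: "code x < 3" by (auto simp: code_def split: option.split)

text \<open>The displacement of the head plus 1, which makes it a natural number; after the move,
  cell \<open>x\<close> shows what was in cell \<open>x + offset - 1\<close>.\<close>

definition offset :: "move \<Rightarrow> nat" where
  "offset d = (case d of Left \<Rightarrow> 0 | Stay \<Rightarrow> 1 | Right \<Rightarrow> 2)"

lemma act_apply: "act a t x = (if x + int (offset (snd a)) - 1 = 0 then fst a else t (x + int (offset (snd a)) - 1))"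
  by (cases "snd a") (auto simp: act_def offset_def add.commute)

text \<open>A variable \<open>x\<close> of a propositional formula yields the literals \<open>2 * x\<close> (negative) and
  \<open>2 * x + 1\<close> (positive).\<close>

definition holds :: "(nat \<Rightarrow> bool) \<Rightarrow> nat \<Rightarrow> bool" where
  "holds \<nu> r \<longleftrightarrow> \<nu> (r div 2) = odd r"

definition satisfiable :: "nat \<Rightarrow> nat \<Rightarrow> (nat \<Rightarrow> nat \<Rightarrow> bool) \<Rightarrow> bool" where
  "satisfiable V N inc \<longleftrightarrow> (\<exists>\<nu>. \<forall>c<N. \<exists>r<2 * V. inc r c \<and> holds \<nu> r)"

abbreviation neg :: "nat \<Rightarrow> nat" where "neg x \<equiv> 2 * x"
abbreviation pos :: "nat \<Rightarrow> nat" where "pos x \<equiv> Suc (2 * x)"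

lemma holds_simps [simp]: "holds \<nu> (neg x) \<longleftrightarrow> \<not> \<nu> x" "holds \<nu> (pos x) \<longleftrightarrow> \<nu> x"
  by (simp_all add: holds_def)

text \<open>Tuples of indices for variables, clauses and matrix entries are flattened to mixed-radix
  numbers \<open>a + m * x\<close>.\<close>

lemma mod_div_mixed: "a < m \<Longrightarrow> (a + m * x) mod m = (a::nat)" "a < m \<Longrightarrow> (a + m * x) div m = x"
  by simp_all

lemma less_mixed: "a < m \<Longrightarrow> x < y \<Longrightarrow> a + m * x < m * (y :: nat)"
proof -
  assume "a < m" "x < y"
  then have "a + m * x < m * Suc x" by simp
  also have "\<dots> \<le> m * y" using \<open>x < y\<close> by (intro mult_le_mono2) simp
  finally show ?thesis .
qed

text \<open>The list \<open>combos\<close> contains the finitely many arguments on which the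
  transition function matters. The formula refers to its positions, so the machine enters only
  through constant tables.\<close>

locale tableau =
  fixes M :: tm and p q :: "nat poly" and combos :: "(nat \<times> bool option list) list"
  assumes wf: "wf_tm M"
    and combos: "set combos = {(s, ys). s < num_states M \<and> length ys = num_tapes M}"
begin

abbreviation K where "K \<equiv> num_tapes M"
abbreviation Q where "Q \<equiv> num_states M"
abbreviation "n_combos \<equiv> length combos"

text \<open>Halting states get the identity transition, just as \<open>step\<close> leaves halted
  configurations alone; the formula needs no separate case for a run that halts early.\<close>

definition trans :: "nat \<Rightarrow> nat \<times> (bool option \<times> move) list" where
  "trans \<kappa> = (let (s, ys) = combos ! \<kappa> in
     if s = accept M \<or> s = reject M then (s, map (\<lambda>y. (y, Stay)) ys) else delta M s ys)"

definition table1 :: "(nat \<Rightarrow> nat) \<Rightarrow> nat \<Rightarrow> nat" where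
  "table1 g \<kappa> = (if \<kappa> < n_combos then g \<kappa> else 0)"

text \<open>The two arguments are flattened and recovered by division, since
  \<open>pt_una_table\<close> handles tables with a single argument.\<close>

definition table2 :: "(nat \<Rightarrow> nat \<Rightarrow> nat) \<Rightarrow> nat \<Rightarrow> nat \<Rightarrow> nat" where
  "table2 g \<kappa> j = (if j + K * \<kappa> < K * n_combos then g ((j + K * \<kappa>) div K) ((j + K * \<kappa>) mod K) else 0)"

definition "old_state \<kappa> = fst (combos ! \<kappa>)"
definition "old_sym \<kappa> j = code (snd (combos ! \<kappa>) ! j)"
definition "new_state \<kappa> = fst (trans \<kappa>)"
definition "new_sym \<kappa> j = code (fst (snd (trans \<kappa>) ! j))"
definition "moved \<kappa> j = offset (snd (snd (trans \<kappa>) ! j))"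

lemma table1 [simp]: "\<kappa> < n_combos \<Longrightarrow> table1 g \<kappa> = g \<kappa>" by (simp add: table1_def)

lemma table2 [simp]: "\<kappa> < n_combos \<Longrightarrow> j < K \<Longrightarrow> table2 g \<kappa> j = g \<kappa> j"
  using less_mixed[of j K \<kappa> n_combos] by (simp add: table2_def mod_div_mixed)

subsection \<open>Runs of the verifier\<close>

definition conf :: "bool list \<Rightarrow> bool list \<Rightarrow> nat \<Rightarrow> config" where
  "conf w u t = run M t [w, u]"

definition cell :: "bool list \<Rightarrow> bool list \<Rightarrow> nat \<Rightarrow> nat \<Rightarrow> int \<Rightarrow> nat" where
  "cell w u t j x = code ((snd (conf w u t) ! j) x)"

lemma conf_wf: "fst (conf w u t) < Q \<and> length (snd (conf w u t)) = K"
proof (induction t)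
  case 0
  then show ?case using wf by (simp add: conf_def run_def init_config_def wf_tm_def)
next
  case (Suc t)
  obtain s ts where c: "conf w u t = (s, ts)" by fastforce
  have "fst (delta M s (map (\<lambda>t. t 0) ts)) < Q" "length (snd (delta M s (map (\<lambda>t. t 0) ts))) = K"
    using wf Suc c by (simp_all add: wf_tm_def)
  moreover have "conf w u (Suc t) = step M (s, ts)" using c by (simp add: conf_def run_def)
  ultimately show ?case
    using Suc c by (auto simp: step_def Let_def split: prod.splits)
qed

lemma conf_Suc:
  assumes "\<kappa> < n_combos" "combos ! \<kappa> = (fst (conf w u t), map (\<lambda>T. T 0) (snd (conf w u t)))"
  shows "conf w u (Suc t) = (fst (trans \<kappa>), map2 act (snd (trans \<kappa>)) (snd (conf w u t)))"
proof -
  obtain s T where c: "conf w u t = (s, T)" by fastforce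
  have "map2 act (map (\<lambda>y. (y, Stay)) (map (\<lambda>T. T 0) T)) T = T" by (induction T) auto
  then show ?thesis
    using assms(2) c
    by (auto simp: conf_def run_def step_def trans_def halted_def Let_def split: prod.splits)
qed

lemma trans_length: "\<kappa> < n_combos \<Longrightarrow> length (snd (trans \<kappa>)) = K"
proof -
  assume "\<kappa> < n_combos"
  then have "combos ! \<kappa> \<in> set combos" by simp
  then show ?thesis
    using wf unfolding combos wf_tm_def by (auto simp: trans_def Let_def)
qed

text \<open>Locality of a move. As tapes are described relative to the head, the scanned symbols are
  always in cell 0, and a move shifts all cells of a tape by the same amount.\<close>

lemma run_step:
  assumes \<kappa>: "\<kappa> < n_combos" and s: "old_state \<kappa> = fst (conf w u t)"
    and y: "\<forall>j<K. old_sym \<kappa> j = cell w u t j 0"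
  shows "fst (conf w u (Suc t)) = new_state \<kappa>"
    and "j < K \<Longrightarrow> cell w u (Suc t) j x =
      (if x + int (moved \<kappa> j) - 1 = 0 then new_sym \<kappa> j else cell w u t j (x + int (moved \<kappa> j) - 1))"
proof -
  have len: "length (snd (combos ! \<kappa>)) = K"
  proof -
    have "combos ! \<kappa> \<in> set combos" using \<kappa> by simp
    then show ?thesis unfolding combos by auto
  qed
  have "snd (combos ! \<kappa>) = map (\<lambda>T. T 0) (snd (conf w u t))"
    using y len conf_wf[of w u t]
    by (intro nth_equalityI) (auto simp: old_sym_def cell_def)
  then have c: "combos ! \<kappa> = (fst (conf w u t), map (\<lambda>T. T 0) (snd (conf w u t)))"
    using s by (simp add: old_state_def prod_eq_iff)
  note conf = conf_Suc[OF \<kappa> c]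
  show "fst (conf w u (Suc t)) = new_state \<kappa>" by (simp add: conf new_state_def)
  show "cell w u (Suc t) j x =
      (if x + int (moved \<kappa> j) - 1 = 0 then new_sym \<kappa> j else cell w u t j (x + int (moved \<kappa> j) - 1))"
    if "j < K"
    using that trans_length[OF \<kappa>] conf_wf[of w u t]
    by (simp add: cell_def conf act_apply moved_def new_sym_def)
qed

lemma combo_exists:
  "\<exists>\<kappa><n_combos. old_state \<kappa> = fst (conf w u t) \<and> (\<forall>j<K. old_sym \<kappa> j = cell w u t j 0)"
proof -
  have "(fst (conf w u t), map (\<lambda>T. T 0) (snd (conf w u t))) \<in> set combos"
    using conf_wf[of w u t] by (simp add: combos)
  then obtain \<kappa> where "\<kappa> < n_combos" "combos ! \<kappa> = (fst (conf w u t), map (\<lambda>T. T 0) (snd (conf w u t)))"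
    by (auto simp: in_set_conv_nth)
  then show ?thesis
    using conf_wf[of w u t] by (intro exI[of _ \<kappa>]) (auto simp: old_state_def old_sym_def cell_def)
qed

lemma combo_state_exists: "s < Q \<Longrightarrow> \<exists>\<kappa><n_combos. old_state \<kappa> = s"
proof -
  assume "s < Q"
  then have "(s, replicate K None) \<in> set combos" by (simp add: combos)
  then show ?thesis by (auto simp: in_set_conv_nth old_state_def)
qed

lemma combo_bounds:
  assumes "\<kappa> < n_combos"
  shows "old_state \<kappa> < Q" "new_state \<kappa> < Q" "old_sym \<kappa> j < 3" "new_sym \<kappa> j < 3" "moved \<kappa> j < 3"
proof -
  have "combos ! \<kappa> \<in> set combos" using assms by simp
  then show "old_state \<kappa> < Q" "new_state \<kappa> < Q"
    using wf unfolding combos wf_tm_def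
    by (auto simp: old_state_def new_state_def trans_def Let_def)
qed (auto simp: old_sym_def new_sym_def moved_def code_less offset_def split: move.split)

subsection \<open>The formula\<close>

text \<open>Times range over \<open>0, \<dots>, T\<close>, and cell \<open>i\<close> of the window of width \<open>2 * T + 1\<close> is cell \<open>i - T\<close>
  of a tape. Cells outside the window cannot influence the state at time \<open>T\<close>.\<close>

definition T :: "bool list \<Rightarrow> nat" where "T w = poly p (length w)"
definition width :: "bool list \<Rightarrow> nat" where "width w = Suc (2 * T w)"
definition layer :: "bool list \<Rightarrow> nat" where "layer w = Q + 3 * (K * width w)"
definition n_vars :: "bool list \<Rightarrow> nat" where "n_vars w = layer w * Suc (T w)"

definition state_var :: "bool list \<Rightarrow> nat \<Rightarrow> nat \<Rightarrow> nat" where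
  "state_var w t s = s + layer w * t"
definition cell_var :: "bool list \<Rightarrow> nat \<Rightarrow> nat \<Rightarrow> nat \<Rightarrow> nat \<Rightarrow> nat" where
  "cell_var w t j i a = (Q + (a + 3 * (j + K * i))) + layer w * t"

definition init_sym :: "bool list \<Rightarrow> nat \<Rightarrow> nat \<Rightarrow> nat" where
  "init_sym w j i = (if j = 0 \<and> T w \<le> i \<and> i - T w < length w
     then (if nth_bit w (i - T w) then 2 else 1) else 0)"

definition premise :: "bool list \<Rightarrow> nat \<Rightarrow> nat \<Rightarrow> nat \<Rightarrow> bool" where
  "premise w t \<kappa> r \<longleftrightarrow> r = neg (state_var w t (table1 old_state \<kappa>)) \<or>
     (\<exists>j<K. r = neg (cell_var w t j (T w) (table2 old_sym \<kappa> j)))"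

text \<open>The formula forces the variables describing an actual run to be true. Unless \<open>ty = 5\<close>,
  where any other final state than the accepting one is forbidden, nothing else is needed about
  the other variables.\<close>

definition clause :: "bool list \<Rightarrow> nat \<Rightarrow> nat \<Rightarrow> nat \<Rightarrow> nat \<Rightarrow> nat \<Rightarrow> nat \<Rightarrow> nat \<Rightarrow> bool" where
  "clause w ty a j i t \<kappa> r \<longleftrightarrow>
    (if ty = 0 \<and> t < T w
     then premise w t \<kappa> r \<or> r = pos (state_var w (Suc t) (table1 new_state \<kappa>))
     else if ty = 1 \<and> t < T w \<and> Suc (Suc i) < width w
     then premise w t \<kappa> r \<or> r = neg (cell_var w t j (i + table2 moved \<kappa> j) a) \<or>
       r = pos (cell_var w (Suc t) j (Suc i) (if i + table2 moved \<kappa> j = T w then table2 new_sym \<kappa> j else a))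
     else if ty = 3
     then (if j = 1 \<and> T w \<le> i \<and> i < T w + poly q (length w)
           then \<exists>b<3. r = pos (cell_var w 0 1 i b)
           else r = pos (cell_var w 0 j i (init_sym w j i)))
     else if ty = 4 \<and> T w \<le> i \<and> Suc i < width w
     then r = neg (cell_var w 0 1 i 0) \<or> r = pos (cell_var w 0 1 (Suc i) 0)
     else if ty = 5 \<and> table1 old_state \<kappa> \<noteq> accept M
     then r = neg (state_var w (T w) (table1 old_state \<kappa>))
     else r = pos (state_var w 0 (start M)))"

definition inc :: "bool list \<Rightarrow> nat \<Rightarrow> nat \<Rightarrow> bool" where
  "inc w r c \<longleftrightarrow> clause w (c mod 6) (c div 6 mod 3) (c div 6 div 3 mod K)
     (c div 6 div 3 div K mod width w) (c div 6 div 3 div K div width w mod Suc (T w))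
     (c div 6 div 3 div K div width w div Suc (T w)) r"

definition n_clauses :: "bool list \<Rightarrow> nat" where
  "n_clauses w = 6 * (3 * (K * (width w * (Suc (T w) * n_combos))))"

lemma K_pos: "0 < K" using wf by (simp add: wf_tm_def)

lemma inc_all_iff:
  "(\<forall>c<n_clauses w. P (\<lambda>r. inc w r c)) \<longleftrightarrow>
   (\<forall>ty<6. \<forall>a<3. \<forall>j<K. \<forall>i<width w. \<forall>t\<le>T w. \<forall>\<kappa><n_combos. P (clause w ty a j i t \<kappa>))"
proof (intro iffI allI impI)
  fix ty a j i t \<kappa> :: nat
  assume *: "\<forall>c<n_clauses w. P (\<lambda>r. inc w r c)" "ty < 6" "a < 3" "j < K" "i < width w" "t \<le> T w"
    "\<kappa> < n_combos"
  let ?c = "ty + 6 * (a + 3 * (j + K * (i + width w * (t + Suc (T w) * \<kappa>))))"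
  have "?c < n_clauses w"
    unfolding n_clauses_def using * by (intro less_mixed) auto
  moreover have "t < Suc (T w)" using * by simp
  then have "(\<lambda>r. inc w r ?c) = clause w ty a j i t \<kappa>"
    unfolding inc_def using *(2-5,7) by (simp only: mod_div_mixed)
  ultimately show "P (clause w ty a j i t \<kappa>)" using *(1) by metis
next
  fix c
  assume *: "\<forall>ty<6. \<forall>a<3. \<forall>j<K. \<forall>i<width w. \<forall>t\<le>T w. \<forall>\<kappa><n_combos. P (clause w ty a j i t \<kappa>)"
    and c: "c < n_clauses w"
  have "c div 6 div 3 div K div width w div Suc (T w) < n_combos"
    using c unfolding n_clauses_def
    by (metis less_mult_imp_div_less mult.commute)
  moreover have "c div 6 div 3 div K div width w mod Suc (T w) \<le> T w"
    using mod_less_divisor[of "Suc (T w)"] less_Suc_eq_le by blast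
  ultimately show "P (\<lambda>r. inc w r c)"
    unfolding inc_def using * K_pos by (simp add: width_def)
qed

lemma state_var_less: "s < Q \<Longrightarrow> t \<le> T w \<Longrightarrow> state_var w t s < n_vars w"
  unfolding state_var_def n_vars_def by (intro less_mixed) (auto simp: layer_def)

lemma cell_offset_less: "a < 3 \<Longrightarrow> j < K \<Longrightarrow> i < width w \<Longrightarrow> Q + (a + 3 * (j + K * i)) < layer w"
  unfolding layer_def by (intro add_strict_left_mono less_mixed)

lemma cell_var_less:
  "a < 3 \<Longrightarrow> j < K \<Longrightarrow> i < width w \<Longrightarrow> t \<le> T w \<Longrightarrow> cell_var w t j i a < n_vars w"
  unfolding cell_var_def n_vars_def by (intro less_mixed cell_offset_less) auto

definition csat :: "(nat \<Rightarrow> bool) \<Rightarrow> bool list \<Rightarrow> (nat \<Rightarrow> bool) \<Rightarrow> bool" where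
  "csat \<nu> w cl \<longleftrightarrow> (\<exists>r<2 * n_vars w. cl r \<and> holds \<nu> r)"

lemma csat_simps:
  "x < n_vars w \<Longrightarrow> csat \<nu> w (\<lambda>r. r = neg x) \<longleftrightarrow> \<not> \<nu> x"
  "x < n_vars w \<Longrightarrow> csat \<nu> w (\<lambda>r. r = pos x) \<longleftrightarrow> \<nu> x"
  "csat \<nu> w (\<lambda>r. P r \<or> P' r) \<longleftrightarrow> csat \<nu> w P \<or> csat \<nu> w P'"
  "csat \<nu> w (\<lambda>r. \<exists>b<m. R b r) \<longleftrightarrow> (\<exists>b<m. csat \<nu> w (R b))"
proof -
  assume x: "x < n_vars w"
  then have "2 * x < 2 * n_vars w" "Suc (2 * x) < 2 * n_vars w" by auto
  then show "csat \<nu> w (\<lambda>r. r = neg x) \<longleftrightarrow> \<not> \<nu> x" "csat \<nu> w (\<lambda>r. r = pos x) \<longleftrightarrow> \<nu> x"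
    unfolding csat_def by auto
qed (auto simp: csat_def)

lemma csat_premise:
  assumes "t \<le> T w" "\<kappa> < n_combos"
  shows "csat \<nu> w (premise w t \<kappa>) \<longleftrightarrow>
    \<not> (\<nu> (state_var w t (old_state \<kappa>)) \<and> (\<forall>j<K. \<nu> (cell_var w t j (T w) (old_sym \<kappa> j))))"
proof -
  have "T w < width w" by (simp add: width_def)
  moreover have "(\<exists>b<K. csat \<nu> w (\<lambda>r. r = neg (cell_var w t b (T w) (table2 old_sym \<kappa> b)))) \<longleftrightarrow>
      (\<exists>b<K. \<not> \<nu> (cell_var w t b (T w) (old_sym \<kappa> b)))"
  proof (intro ex_cong1 conj_cong refl)
    fix b assume b: "b < K"
    have "cell_var w t b (T w) (old_sym \<kappa> b) < n_vars w"
      using assms b \<open>T w < width w\<close> by (intro cell_var_less combo_bounds)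
    then show "csat \<nu> w (\<lambda>r. r = neg (cell_var w t b (T w) (table2 old_sym \<kappa> b))) =
        (\<not> \<nu> (cell_var w t b (T w) (old_sym \<kappa> b)))"
      unfolding table2[OF assms(2) b] by (rule csat_simps(1))
  qed
  ultimately show ?thesis
    using assms unfolding premise_def csat_simps
    by (simp add: csat_simps state_var_less combo_bounds)
qed

text \<open>The clauses read as implications. Type 1 speaks of cell \<open>Suc i\<close>, whose
  content comes from cell \<open>i + moved \<kappa> j\<close>, so no index is subtracted. Type 2 is
  the default; clauses whose side condition fails become copies of it, which keeps the numbering of
  clauses a full product.\<close>

lemma csat_clause:
  assumes "a < 3" "j < K" "i < width w" "t \<le> T w" "\<kappa> < n_combos"
  shows
    "t < T w \<Longrightarrow> csat \<nu> w (clause w 0 a j i t \<kappa>) \<longleftrightarrow>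
      (\<nu> (state_var w t (old_state \<kappa>)) \<and> (\<forall>j<K. \<nu> (cell_var w t j (T w) (old_sym \<kappa> j)))
        \<longrightarrow> \<nu> (state_var w (Suc t) (new_state \<kappa>)))"
    "t < T w \<Longrightarrow> Suc (Suc i) < width w \<Longrightarrow> csat \<nu> w (clause w 1 a j i t \<kappa>) \<longleftrightarrow>
      (\<nu> (state_var w t (old_state \<kappa>)) \<and> (\<forall>j<K. \<nu> (cell_var w t j (T w) (old_sym \<kappa> j))) \<and>
         \<nu> (cell_var w t j (i + moved \<kappa> j) a) \<longrightarrow>
       \<nu> (cell_var w (Suc t) j (Suc i) (if i + moved \<kappa> j = T w then new_sym \<kappa> j else a)))"
    "csat \<nu> w (clause w 2 a j i t \<kappa>) \<longleftrightarrow> \<nu> (state_var w 0 (start M))"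
    "csat \<nu> w (clause w 3 a j i t \<kappa>) \<longleftrightarrow>
       (if j = 1 \<and> T w \<le> i \<and> i < T w + poly q (length w) then \<exists>b<3. \<nu> (cell_var w 0 1 i b)
        else \<nu> (cell_var w 0 j i (init_sym w j i)))"
    "T w \<le> i \<Longrightarrow> Suc i < width w \<Longrightarrow> csat \<nu> w (clause w 4 a j i t \<kappa>) \<longleftrightarrow>
       (\<nu> (cell_var w 0 1 i 0) \<longrightarrow> \<nu> (cell_var w 0 1 (Suc i) 0))"
    "old_state \<kappa> \<noteq> accept M \<Longrightarrow> csat \<nu> w (clause w 5 a j i t \<kappa>) \<longleftrightarrow>
       \<not> \<nu> (state_var w (T w) (old_state \<kappa>))"
proof -
  have st: "start M < Q" and K1: "1 < K" using wf by (auto simp: wf_tm_def)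
  note less = state_var_less cell_var_less combo_bounds assms st K1
  have init: "init_sym w j i < 3" by (simp add: init_sym_def)
  show "csat \<nu> w (clause w 2 a j i t \<kappa>) \<longleftrightarrow> \<nu> (state_var w 0 (start M))"
    unfolding clause_def by (simp add: csat_simps less)
  show "csat \<nu> w (clause w 0 a j i t \<kappa>) \<longleftrightarrow>
      (\<nu> (state_var w t (old_state \<kappa>)) \<and> (\<forall>j<K. \<nu> (cell_var w t j (T w) (old_sym \<kappa> j)))
        \<longrightarrow> \<nu> (state_var w (Suc t) (new_state \<kappa>)))" if "t < T w"
    unfolding clause_def using that assms
    by (simp add: csat_simps csat_premise less) blast
  show "csat \<nu> w (clause w 1 a j i t \<kappa>) \<longleftrightarrow>
      (\<nu> (state_var w t (old_state \<kappa>)) \<and> (\<forall>j<K. \<nu> (cell_var w t j (T w) (old_sym \<kappa> j))) \<and>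
         \<nu> (cell_var w t j (i + moved \<kappa> j) a) \<longrightarrow>
       \<nu> (cell_var w (Suc t) j (Suc i) (if i + moved \<kappa> j = T w then new_sym \<kappa> j else a)))"
    if "t < T w" "Suc (Suc i) < width w"
  proof -
    have "i + moved \<kappa> j < width w" using that(2) combo_bounds(5)[OF assms(5), of j] by linarith
    then show ?thesis
      unfolding clause_def using that assms
      by (simp add: csat_simps csat_premise less) blast
  qed
  show "csat \<nu> w (clause w 3 a j i t \<kappa>) \<longleftrightarrow>
       (if j = 1 \<and> T w \<le> i \<and> i < T w + poly q (length w) then \<exists>b<3. \<nu> (cell_var w 0 1 i b)
        else \<nu> (cell_var w 0 j i (init_sym w j i)))"
    unfolding clause_def using assms K1 by (auto simp: csat_simps less init)
  show "csat \<nu> w (clause w 4 a j i t \<kappa>) \<longleftrightarrow>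
       (\<nu> (cell_var w 0 1 i 0) \<longrightarrow> \<nu> (cell_var w 0 1 (Suc i) 0))"
    if "T w \<le> i" "Suc i < width w"
    unfolding clause_def using that K1 by (simp add: csat_simps less)
  show "csat \<nu> w (clause w 5 a j i t \<kappa>) \<longleftrightarrow>
       \<not> \<nu> (state_var w (T w) (old_state \<kappa>))" if "old_state \<kappa> \<noteq> accept M"
    unfolding clause_def using that assms by (simp add: csat_simps less)
qed

section \<open>Satisfying assignments correspond to accepting runs\<close>

lemma satisfiable_iff:
  "satisfiable (n_vars w) (n_clauses w) (inc w) \<longleftrightarrow>
   (\<exists>\<nu>. \<forall>ty<6. \<forall>a<3. \<forall>j<K. \<forall>i<width w. \<forall>t\<le>T w. \<forall>\<kappa><n_combos. csat \<nu> w (clause w ty a j i t \<kappa>))"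
  using inc_all_iff[of w "csat _ w"] unfolding satisfiable_def csat_def by simp

lemma conf_0: "fst (conf w u 0) = start M"
  "j < K \<Longrightarrow> cell w u 0 j x = code (string_tape (if j = 0 then w else if j = 1 then u else []) x)"
  by (auto simp: conf_def cell_def run_def init_config_def less_Suc_eq)

lemma init_cell:
  assumes "i < width w"
  shows "code (string_tape w (int i - int (T w))) = init_sym w 0 i"
    "j < K \<Longrightarrow> j \<noteq> 1 \<Longrightarrow> cell w u 0 j (int i - int (T w)) = init_sym w j i"
proof -
  show "code (string_tape w (int i - int (T w))) = init_sym w 0 i"
    by (auto simp: string_tape_def init_sym_def nth_bit_iff code_def nat_diff_distrib)
  then show "cell w u 0 j (int i - int (T w)) = init_sym w j i" if "j < K" "j \<noteq> 1"
    using that by (auto simp: conf_0) (auto simp: string_tape_def init_sym_def)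
qed

lemma accepting_imp_satisfiable:
  assumes u: "length u \<le> poly q (length w)" and acc: "fst (run M (T w) [w, u]) = accept M"
  shows "satisfiable (n_vars w) (n_clauses w) (inc w)"
proof -
  \<comment> \<open>The number of a variable is decoded into time, tape, cell and symbol, and the
    variable is compared with the actual run.\<close>
  define \<nu> where "\<nu> x = (let t = x div layer w; y = x mod layer w in
    if y < Q then fst (conf w u t) = y
    else let z = y - Q in
      cell w u t (z div 3 mod K) (int (z div 3 div K) - int (T w)) = z mod 3)" for x
  have \<nu>s: "\<nu> (state_var w t s) \<longleftrightarrow> fst (conf w u t) = s" if "s < Q" for t s
  proof -
    have "s < layer w" using that by (simp add: layer_def)
    then show ?thesis using that by (simp add: \<nu>_def state_var_def mod_div_mixed)
  qed
  have \<nu>c: "\<nu> (cell_var w t j i a) \<longleftrightarrow> cell w u t j (int i - int (T w)) = a"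
    if "a < 3" "j < K" "i < width w" for t j i a
    unfolding \<nu>_def cell_var_def Let_def mod_div_mixed[OF cell_offset_less[OF that]]
    by (simp only: not_add_less1 if_False diff_add_inverse mod_div_mixed that)
  have st: "start M < Q" and K1: "1 < K" using wf by (auto simp: wf_tm_def)
  have Tw: "T w < width w" by (simp add: width_def)
  have "csat \<nu> w (clause w ty a j i t \<kappa>)"
    if *: "ty < 6" and b: "a < 3" "j < K" "i < width w" "t \<le> T w" "\<kappa> < n_combos" for ty a j i t \<kappa>
  proof -
    note cl = csat_clause[OF b]
    note kb = combo_bounds[OF b(5)]
    have 2: "csat \<nu> w (clause w 2 a j i t \<kappa>)" unfolding cl(3) by (simp add: \<nu>s st conf_0)
    \<comment> \<open>A clause whose side condition fails falls through to the clause for the start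
      state.\<close>
    have other: "clause w ty a j i t \<kappa> = clause w 2 a j i t \<kappa>"
      if "ty = 0 \<longrightarrow> \<not> t < T w" "ty = 1 \<longrightarrow> \<not> (t < T w \<and> Suc (Suc i) < width w)" "ty \<noteq> 3"
        "ty = 4 \<longrightarrow> \<not> (T w \<le> i \<and> Suc i < width w)" "ty = 5 \<longrightarrow> old_state \<kappa> = accept M"
    proof -
      have "(ty = 0 \<and> t < T w) = False" "(ty = 1 \<and> t < T w \<and> Suc (Suc i) < width w) = False"
        "(ty = 3) = False" "(ty = 4 \<and> T w \<le> i \<and> Suc i < width w) = False"
        "(ty = 5 \<and> table1 old_state \<kappa> \<noteq> accept M) = False"
        using that b(5) by auto
      then show ?thesis unfolding clause_def by (simp only: if_False) simp
    qed
    have prem: "\<nu> (state_var w t (old_state \<kappa>)) \<and> (\<forall>j<K. \<nu> (cell_var w t j (T w) (old_sym \<kappa> j))) \<longleftrightarrow>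
        old_state \<kappa> = fst (conf w u t) \<and> (\<forall>j<K. old_sym \<kappa> j = cell w u t j 0)"
      using kb by (auto simp: \<nu>s \<nu>c Tw)
    consider "ty = 0" "t < T w" | "ty = 1" "t < T w" "Suc (Suc i) < width w" | "ty = 3"
      | "ty = 4" "T w \<le> i" "Suc i < width w" | "ty = 5" "old_state \<kappa> \<noteq> accept M"
      | "clause w ty a j i t \<kappa> = clause w 2 a j i t \<kappa>"
      using other by blast
    then show ?thesis
    proof cases
      case 1
      then show ?thesis
        unfolding 1(1) cl(1)[OF 1(2)] prem using run_step(1)[OF b(5)] kb by (auto simp: \<nu>s)
    next
      case 2
      let ?i = "i + moved \<kappa> j"
      have i: "?i < width w" "Suc i < width w" using 2(3) kb(5)[of j] by auto
      have eq: "int (Suc i) - int (T w) + int (moved \<kappa> j) - 1 = int ?i - int (T w)" by simp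
      show ?thesis
        unfolding 2(1) cl(2)[OF 2(2,3)] conj_assoc[symmetric] prem
      proof (intro impI, elim conjE)
        assume p: "old_state \<kappa> = fst (conf w u t)" "\<forall>j<K. old_sym \<kappa> j = cell w u t j 0"
          and "\<nu> (cell_var w t j ?i a)"
        then have a: "cell w u t j (int ?i - int (T w)) = a" using b i by (simp add: \<nu>c)
        have "cell w u (Suc t) j (int (Suc i) - int (T w)) = (if ?i = T w then new_sym \<kappa> j else a)"
          unfolding run_step(2)[OF b(5) p b(2)] eq a by auto
        then show "\<nu> (cell_var w (Suc t) j (Suc i) (if ?i = T w then new_sym \<kappa> j else a))"
          using b i kb by (subst \<nu>c) auto
      qed
    next
      case 3
      have "\<exists>c<3. \<nu> (cell_var w 0 1 i c)"
        using b K1 by (intro exI[of _ "cell w u 0 1 (int i - int (T w))"]) (simp add: \<nu>c cell_def code_less)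
      moreover have "cell w u 0 j (int i - int (T w)) = init_sym w j i"
        if "\<not> (j = 1 \<and> T w \<le> i \<and> i < T w + poly q (length w))"
      proof (cases "j = 1")
        case True
        then show ?thesis
          using that u K1 by (auto simp: init_sym_def conf_0 string_tape_def)
      qed (use init_cell(2)[OF b(3) b(2)] in simp)
      moreover have "init_sym w j i < 3" by (simp add: init_sym_def)
      ultimately show ?thesis
        unfolding 3 cl(4) using b by (auto simp: \<nu>c)
    next
      case 4
      then show ?thesis
        unfolding 4(1) cl(5)[OF 4(2,3)]
        using b K1 by (auto simp: \<nu>c conf_0 string_tape_def code_def split: if_splits option.splits)
    next
      case 5
      then show ?thesis
        unfolding 5(1) cl(6)[OF 5(2)] using kb acc by (simp add: \<nu>s conf_def)
    qed (use 2 in simp)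
  qed
  then show ?thesis unfolding satisfiable_iff by blast
qed

text \<open>The assignment may make several symbols of one cell true. It is enough that a
  certificate read off from it has all its own initial cells true, for then the transition clauses
  force the variables of that run, and the final clauses exclude any other state than the accepting
  one.\<close>

lemma satisfiable_imp_accepting:
  assumes "satisfiable (n_vars w) (n_clauses w) (inc w)"
  shows "\<exists>u. length u \<le> poly q (length w) \<and> fst (run M (T w) [w, u]) = accept M"
proof -
  obtain \<nu> where \<nu>: "\<And>ty a j i t \<kappa>. ty < 6 \<Longrightarrow> a < 3 \<Longrightarrow> j < K \<Longrightarrow> i < width w \<Longrightarrow> t \<le> T w \<Longrightarrow>
      \<kappa> < n_combos \<Longrightarrow> csat \<nu> w (clause w ty a j i t \<kappa>)"
    using assms unfolding satisfiable_iff by blast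
  have st: "start M < Q" and K1: "1 < K" using wf by (auto simp: wf_tm_def)
  obtain \<kappa>0 where \<kappa>0: "\<kappa>0 < n_combos" using combo_exists by blast
  have Tw: "T w < width w" by (simp add: width_def)
  define \<alpha> where "\<alpha> k = \<nu> (cell_var w 0 1 (T w + k) 0)" for k
  \<comment> \<open>Only \<open>Suc (T w)\<close> cells of the window lie at or right of the head,
    and later symbols cannot be read within \<open>T w\<close> moves.\<close>
  let ?U = "min (poly q (length w)) (Suc (T w))"
  have blank: "\<alpha> (Suc k)" if "\<alpha> k" "k < T w" for k
    using \<nu>[of 4 0 1 "T w + k" 0 \<kappa>0] csat_clause(5)[of 0 1 "T w + k" w 0 \<kappa>0] that K1 \<kappa>0
    by (simp add: \<alpha>_def width_def)
  have blank_le: "\<alpha> l" if "\<alpha> k" "k \<le> l" "l \<le> T w" for k l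
    using that(2,3) by (induction l rule: dec_induct) (use that(1) blank in auto)
  have init: "(if j = 1 \<and> T w \<le> i \<and> i < T w + poly q (length w) then \<exists>b<3. \<nu> (cell_var w 0 1 i b)
        else \<nu> (cell_var w 0 j i (init_sym w j i)))" if "j < K" "i < width w" for i j
    using \<nu>[of 3 0 j i 0 \<kappa>0] csat_clause(4)[of 0 j i w 0 \<kappa>0] that \<kappa>0 by simp
  \<comment> \<open>The certificate ends before the first cell that is marked blank, or at
    \<open>?U\<close> if there is none.\<close>
  define m where "m = (LEAST k. k = ?U \<or> \<alpha> k)"
  have m: "m = ?U \<or> \<alpha> m" unfolding m_def by (rule LeastI[of _ ?U]) simp
  have m_le: "m \<le> ?U" unfolding m_def by (rule Least_le) simp
  have m_min: "\<not> \<alpha> k" if "k < m" for k using that not_less_Least unfolding m_def by blast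
  \<comment> \<open>Code 2 stands for \<open>Some True\<close>. Where it is not marked, code 1 must
    be, because the cells before \<open>m\<close> are not marked blank.\<close>
  define u where "u = map (\<lambda>k. \<nu> (cell_var w 0 1 (T w + k) 2)) [0..<m]"
  have lu: "length u = m" by (simp add: u_def)
  have u1: "\<nu> (cell_var w 0 1 i (cell w u 0 1 (int i - int (T w))))" if i: "i < width w" for i
  proof (cases "T w \<le> i")
    case False
    then show ?thesis
      using init[of 1 i] i K1 by (simp add: conf_0 string_tape_def init_sym_def)
  next
    case True
    define k where "k = i - T w"
    have ik: "i = T w + k" "k \<le> T w" using True i by (auto simp: k_def width_def)
    show ?thesis
    proof (cases "k < m")
      case k: True
      then have "k < poly q (length w)" using m_le by simp
      then obtain b where b: "b < 3" "\<nu> (cell_var w 0 1 i b)"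
        using init[of 1 i] i K1 ik by auto
      have "b \<noteq> 0" by (rule notI) (use m_min[OF k] b ik in \<open>simp add: \<alpha>_def\<close>)
      then have "b = 1 \<or> b = 2" using b(1) by auto
      moreover have "cell w u 0 1 (int i - int (T w)) = (if \<nu> (cell_var w 0 1 i 2) then 2 else 1)"
        using k K1 by (simp add: conf_0 string_tape_def lu ik) (simp add: u_def)
      ultimately show ?thesis using b by auto
    next
      case k: False
      have "\<alpha> k"
      proof (cases "\<alpha> m")
        case True
        then show ?thesis using blank_le k ik by auto
      next
        case False
        then have "m = ?U" using m by simp
        then have "poly q (length w) \<le> k" using k ik by (auto simp: min_def split: if_splits)
        then show ?thesis
          using init[of 1 i] i K1 ik by (simp add: \<alpha>_def init_sym_def)
      qed
      then show ?thesis using k K1 by (simp add: conf_0 string_tape_def lu ik \<alpha>_def)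
    qed
  qed
  \<comment> \<open>The reliable window loses one cell on both sides per move, as a cell depends on
    its neighbours. At each time \<open>t \<le> T w\<close> it still contains the middle cell
    \<open>T w\<close>, the scanned one.\<close>
  have inv: "\<nu> (state_var w t (fst (conf w u t))) \<and>
      (\<forall>j<K. \<forall>i. t \<le> i \<and> i + t < width w \<longrightarrow> \<nu> (cell_var w t j i (cell w u t j (int i - int (T w)))))"
    if "t \<le> T w" for t
    using that
  proof (induction t)
    case 0
    have "\<nu> (state_var w 0 (start M))"
      using \<nu>[of 2 0 0 0 0 \<kappa>0] csat_clause(3)[of 0 0 0 w 0 \<kappa>0] K_pos \<kappa>0 by (simp add: width_def)
    moreover have "\<nu> (cell_var w 0 j i (cell w u 0 j (int i - int (T w))))"
      if "j < K" "i < width w" for j i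
      using u1[of i] init[OF that] that init_cell(2)[OF that(2,1), of u] by (cases "j = 1") auto
    ultimately show ?case by (simp add: conf_0)
  next
    case (Suc t)
    then have IH: "\<nu> (state_var w t (fst (conf w u t)))"
      "\<And>j i. j < K \<Longrightarrow> t \<le> i \<Longrightarrow> i + t < width w \<Longrightarrow> \<nu> (cell_var w t j i (cell w u t j (int i - int (T w))))"
      by auto
    obtain \<kappa> where \<kappa>: "\<kappa> < n_combos" "old_state \<kappa> = fst (conf w u t)" "\<forall>j<K. old_sym \<kappa> j = cell w u t j 0"
      using combo_exists by blast
    have prem: "\<nu> (state_var w t (old_state \<kappa>))" "\<forall>j<K. \<nu> (cell_var w t j (T w) (old_sym \<kappa> j))"
      using IH(1) IH(2)[of _ "T w"] \<kappa>(2,3) Suc.prems by (auto simp: width_def)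
    have t: "t < T w" "t \<le> T w" using Suc.prems by auto
    have "\<nu> (state_var w (Suc t) (new_state \<kappa>))"
      using \<nu>[of 0 0 0 0 t \<kappa>] csat_clause(1)[of 0 0 0 w t \<kappa>] prem t \<kappa>(1) K_pos by (simp add: width_def)
    moreover have "\<nu> (cell_var w (Suc t) j i (cell w u (Suc t) j (int i - int (T w))))"
      if j: "j < K" and i: "Suc t \<le> i" "i + Suc t < width w" for j i
    proof -
      obtain k where k: "i = Suc k" using i(1) by (cases i) auto
      let ?s = "k + moved \<kappa> j"
      have kw: "Suc (Suc k) < width w" using i k t by simp
      have "\<nu> (cell_var w t j ?s (cell w u t j (int ?s - int (T w))))"
        using combo_bounds(5)[OF \<kappa>(1), of j] i k by (intro IH(2) j) auto
      then have "\<nu> (cell_var w (Suc t) j (Suc k)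
          (if ?s = T w then new_sym \<kappa> j else cell w u t j (int ?s - int (T w))))"
        using \<nu>[of 1 "cell w u t j (int ?s - int (T w))" j k t \<kappa>] kw t prem j \<kappa>(1)
          csat_clause(2)[of "cell w u t j (int ?s - int (T w))" j k w t \<kappa>]
        by (simp add: cell_def code_less)
      moreover have eq: "int (Suc k) - int (T w) + int (moved \<kappa> j) - 1 = int ?s - int (T w)" by simp
      have "cell w u (Suc t) j (int (Suc k) - int (T w)) =
          (if ?s = T w then new_sym \<kappa> j else cell w u t j (int ?s - int (T w)))"
        unfolding run_step(2)[OF \<kappa> j] eq by auto
      ultimately show ?thesis unfolding k by simp
    qed
    ultimately show ?case using run_step(1)[OF \<kappa>] by simp
  qed
  have fin: "\<nu> (state_var w (T w) (fst (conf w u (T w))))" using inv by blast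
  have "fst (conf w u (T w)) = accept M"
  proof (rule ccontr)
    assume n: "fst (conf w u (T w)) \<noteq> accept M"
    obtain \<kappa> where "\<kappa> < n_combos" "old_state \<kappa> = fst (conf w u (T w))"
      using combo_state_exists conf_wf by metis
    then show False
      using \<nu>[of 5 0 0 0 0 \<kappa>] csat_clause(6)[of 0 0 0 w 0 \<kappa>] n fin K_pos by (simp add: width_def)
  qed
  then show ?thesis using lu m_le by (intro exI[of _ u]) (simp add: conf_def)
qed

lemma satisfiable_iff_accepting:
  "satisfiable (n_vars w) (n_clauses w) (inc w) \<longleftrightarrow>
   (\<exists>u. length u \<le> poly q (length w) \<and> fst (run M (poly p (length w)) [w, u]) = accept M)"
  using satisfiable_imp_accepting accepting_imp_satisfiable unfolding T_def by blast

subsection \<open>Computing the formula\<close>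

lemma pt_table1: "polytime (\<lambda>e. una (k e)) \<Longrightarrow> polytime (\<lambda>e. una (table1 g (k e)))"
  unfolding table1_def by (rule pt_una_table)

lemma pt_table2:
  assumes "polytime (\<lambda>e. una (k e))" "polytime (\<lambda>e. una (j e))"
  shows "polytime (\<lambda>e. una (table2 g (k e) (j e)))"
  unfolding table2_def
  by (rule pt_una_table[where f = "\<lambda>x. g (x div K) (x mod K)"]) (intro pt_una_add pt_una_mult pt_una_const assms)

lemmas pt_arith = pt_una_if pt_una_length pt_una_Suc pt_una_add pt_una_diff pt_una_mult pt_una_div
  pt_una_mod pt_una_poly pt_una_const pt_not pt_conj pt_disj pt_imp pt_less pt_le pt_eq pt_nth_bit

lemma pt_T: "polytime f \<Longrightarrow> polytime (\<lambda>e. una (T (f e)))"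
  unfolding T_def by (intro pt_arith)

lemma pt_width: "polytime f \<Longrightarrow> polytime (\<lambda>e. una (width (f e)))"
  unfolding width_def by (intro pt_arith pt_T)

lemma pt_layer: "polytime f \<Longrightarrow> polytime (\<lambda>e. una (layer (f e)))"
  unfolding layer_def by (intro pt_arith pt_width)

lemma pt_n_vars: "polytime f \<Longrightarrow> polytime (\<lambda>e. una (n_vars (f e)))"
  unfolding n_vars_def by (intro pt_arith pt_T pt_layer)

lemma pt_n_clauses: "polytime f \<Longrightarrow> polytime (\<lambda>e. una (n_clauses (f e)))"
  unfolding n_clauses_def by (intro pt_arith pt_T pt_width)

lemma pt_state_var:
  "polytime f \<Longrightarrow> polytime (\<lambda>e. una (t e)) \<Longrightarrow> polytime (\<lambda>e. una (s e)) \<Longrightarrow>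
   polytime (\<lambda>e. una (state_var (f e) (t e) (s e)))"
  unfolding state_var_def by (intro pt_arith pt_layer)

lemma pt_cell_var:
  "polytime f \<Longrightarrow> polytime (\<lambda>e. una (t e)) \<Longrightarrow> polytime (\<lambda>e. una (j e)) \<Longrightarrow> polytime (\<lambda>e. una (i e)) \<Longrightarrow>
   polytime (\<lambda>e. una (a e)) \<Longrightarrow> polytime (\<lambda>e. una (cell_var (f e) (t e) (j e) (i e) (a e)))"
  unfolding cell_var_def by (intro pt_arith pt_layer)

lemma pt_init_sym:
  "polytime f \<Longrightarrow> polytime (\<lambda>e. una (j e)) \<Longrightarrow> polytime (\<lambda>e. una (i e)) \<Longrightarrow>
   polytime (\<lambda>e. una (init_sym (f e) (j e) (i e)))"
  unfolding init_sym_def by (intro pt_arith pt_T)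

lemma pt_premise:
  assumes "polytime f" "polytime (\<lambda>e. una (t e))" "polytime (\<lambda>e. una (k e))" "polytime (\<lambda>e. una (r e))"
  shows "polytime (\<lambda>e. [premise (f e) (t e) (k e) (r e)])"
  unfolding premise_def
  by (intro pt_arith pt_ex pt_state_var pt_cell_var pt_T pt_table1 pt_table2 pt_first pt_second polytime_id
      assms polytime_comp[OF assms(1)] polytime_comp[OF assms(2)] polytime_comp[OF assms(3)]
      polytime_comp[OF assms(4)])

lemma pt_bool_if:
  assumes "polytime (\<lambda>e. [P e])" "polytime (\<lambda>e. [P' e])" "polytime (\<lambda>e. [R e])"
  shows "polytime (\<lambda>e. [if P e then P' e else R e])"
proof -
  have "(\<lambda>e. [if P e then P' e else R e]) = (\<lambda>e. if P e then [P' e] else [R e])" by auto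
  then show ?thesis using pt_if[OF assms] by simp
qed

lemma pt_clause:
  assumes "polytime f" "polytime (\<lambda>e. una (ty e))" "polytime (\<lambda>e. una (a e))" "polytime (\<lambda>e. una (j e))"
    "polytime (\<lambda>e. una (i e))" "polytime (\<lambda>e. una (t e))" "polytime (\<lambda>e. una (k e))"
    "polytime (\<lambda>e. una (r e))"
  shows "polytime (\<lambda>e. [clause (f e) (ty e) (a e) (j e) (i e) (t e) (k e) (r e)])"
  unfolding clause_def
  by (intro pt_bool_if pt_arith pt_ex pt_state_var pt_cell_var pt_T pt_width pt_premise pt_init_sym pt_table1
      pt_table2 pt_first pt_second polytime_id assms polytime_comp[OF assms(1)] polytime_comp[OF assms(5)]
      polytime_comp[OF assms(8)])

lemma pt_inc:
  assumes "polytime f" "polytime (\<lambda>e. una (r e))" "polytime (\<lambda>e. una (c e))"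
  shows "polytime (\<lambda>e. [inc (f e) (r e) (c e)])"
  unfolding inc_def by (intro pt_clause pt_arith pt_T pt_width assms)

end

section \<open>Satisfiability as a basis feasibility problem\<close>

lemma sum_lessThan_add: "sum f {..<a + b :: nat} = sum f {..<a} + (\<Sum>j<b. f (a + j))"
  by (induction b) (auto simp: add.assoc)

lemma mult_mat_vec_index:
  "A \<in> carrier_mat m n \<Longrightarrow> z \<in> carrier_vec n \<Longrightarrow> i < m \<Longrightarrow>
   (A *\<^sub>v z) $ i = (\<Sum>j<n. A $$ (i, j) * z $ j)"
  by (simp add: scalar_prod_def atLeast0LessThan)

lemma scalar_prod_sum: "z \<in> carrier_vec n \<Longrightarrow> q \<bullet> z = (\<Sum>j<n. q $ j * z $ j)"
  by (simp add: scalar_prod_def atLeast0LessThan)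

lemma zero_le_vec_iff: "y \<in> carrier_vec n \<Longrightarrow> 0\<^sub>v n \<le> (y :: real vec) \<longleftrightarrow> (\<forall>i<n. 0 \<le> y $ i)"
  by (auto simp: less_eq_vec_def)

text \<open>Row \<open>r\<close> of \<open>B x + b\<close> is \<open>x\<^sub>v\<close> for the literal \<open>r\<close> that negates \<open>v\<close>, and \<open>1 - x\<^sub>v\<close> for the
  positive one, so that a literal is true iff its row vanishes. The column of a clause has cost
  -1 and can enter the basis unless one of the literals of the clause is true.\<close>

definition gadget :: "nat \<Rightarrow> nat \<Rightarrow> (nat \<Rightarrow> nat \<Rightarrow> bool) \<Rightarrow> inst" where
  "gadget V N inc = \<lparr>
     matA = mat (2 * V) (2 * V + N) (\<lambda>(r, c). if c < 2 * V then (if c = r then 1 else 0)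
       else (if inc r (c - 2 * V) then 1 else 0)),
     matB = mat (2 * V) V (\<lambda>(r, v). if r = neg v then 1 else (if r = pos v then - 1 else 0)),
     vecb = vec (2 * V) (\<lambda>r. if r mod 2 = 1 then 1 else 0),
     matC = mat (2 * V + N) V (\<lambda>(j, v). 0),
     vecc = vec (2 * V + N) (\<lambda>j. if j < 2 * V then 0 else - 1),
     matD = mat 0 V (\<lambda>(i, v). 0), vecd = vec 0 (\<lambda>i. 0), basis = {..<2 * V}\<rparr>"

lemma pick_lessThan: "j < n \<Longrightarrow> pick {..<n} j = j"
proof -
  assume j: "j < n"
  then have "card {a \<in> {..<n}. a < j} = j"
    by (metis (mono_tags, lifting) Collect_cong card_lessThan lessThan_def lessThan_iff mem_Collect_eq order_less_trans)
  then show ?thesis using pick_card_in_set[of j "{..<n}"] j by simp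
qed

lemma submatrix_lessThan:
  "n \<le> dim_col A \<Longrightarrow> submatrix A UNIV {..<n} = mat (dim_row A) n (\<lambda>(i, j). A $$ (i, j))"
proof -
  assume "n \<le> dim_col A"
  then have "{j. j < dim_col A \<and> j \<in> {..<n}} = {..<n}" "{i. i < dim_row A \<and> i \<in> UNIV} = {..<dim_row A}" by auto
  then show ?thesis
    unfolding submatrix_def by (intro eq_matI) (auto simp: pick_lessThan pick_UNIV)
qed

lemma mat_inverse_one: "mat_inverse (1\<^sub>m n :: 'a :: field mat) = Some (1\<^sub>m n)"
proof -
  have "invertible_mat (1\<^sub>m n :: 'a mat)"
    unfolding invertible_mat_def inverts_mat_def by (intro conjI exI[of _ "1\<^sub>m n"]) simp_all
  from invertible_mat_inverse[OF this] obtain N where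
    N: "mat_inverse (1\<^sub>m n :: 'a mat) = Some N" by blast
  then have "1\<^sub>m n * N = 1\<^sub>m n" "N \<in> carrier_mat n n"
    using mat_inverse(2)[OF one_carrier_mat N] by auto
  then show ?thesis using N left_mult_one_mat by simp
qed

context
  fixes V N :: nat and inc :: "nat \<Rightarrow> nat \<Rightarrow> bool"
begin

lemma gadget_submatrix: "submatrix (map_mat f (matA (gadget V N inc))) UNIV {..<2 * V} = map_mat f (1\<^sub>m (2 * V))"
  by (subst submatrix_lessThan) (auto simp: gadget_def intro!: eq_matI)

lemma gadget_basis: "is_basis (matA (gadget V N inc)) {..<2 * V}"
proof -
  have "submatrix (matA (gadget V N inc)) UNIV {..<2 * V} = 1\<^sub>m (2 * V)"
    by (subst submatrix_lessThan) (auto simp: gadget_def intro!: eq_matI)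
  then have "invertible_mat (submatrix (matA (gadget V N inc)) UNIV {..<2 * V})"
    by (simp add: invertible_mat_def inverts_mat_def) (intro exI[of _ "1\<^sub>m (2 * V)"], simp)
  then show ?thesis by (auto simp: is_basis_def gadget_def)
qed

lemma gadget_instance: "is_instance (gadget V N inc)" "fixed_objective (gadget V N inc)"
  using gadget_basis by (auto simp: is_instance_def fixed_objective_def gadget_def)

lemma real_one_mat: "real_mat (1\<^sub>m n) = 1\<^sub>m n" by (auto intro!: eq_matI)

lemma gadget_real_basis: "is_basis (real_mat (matA (gadget V N inc))) {..<2 * V}"
proof -
  have "invertible_mat (1\<^sub>m (2 * V) :: real mat)"
    by (simp add: invertible_mat_def inverts_mat_def) (intro exI[of _ "1\<^sub>m (2 * V)"], simp)
  then show ?thesis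
    using gadget_submatrix[of real_of_rat] by (auto simp: is_basis_def gadget_def real_one_mat)
qed

lemma gadget_basic_solution:
  assumes "\<beta> \<in> carrier_vec (2 * V)"
  shows "basic_solution (real_mat (matA (gadget V N inc))) \<beta> {..<2 * V} = vec (2 * V + N) (\<lambda>i. if i < 2 * V then \<beta> $ i else 0)"
proof -
  have "card {j. j < 2 * V \<and> j < i} = i" if "i < 2 * V" for i
  proof -
    have "{j. j < 2 * V \<and> j < i} = {..<i}" using that by auto
    then show ?thesis by simp
  qed
  then show ?thesis
    unfolding basic_solution_def gadget_submatrix real_one_mat mat_inverse_one
    using assms by (auto simp: gadget_def intro!: eq_vecI)
qed

definition rhs :: "real vec \<Rightarrow> real vec" where
  "rhs x = vec (2 * V) (\<lambda>r. if even r then x $ (r div 2) else 1 - x $ (r div 2))"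

lemma gadget_rhs:
  assumes "x \<in> carrier_vec V"
  shows "real_mat (matB (gadget V N inc)) *\<^sub>v x + real_vec (vecb (gadget V N inc)) = rhs x"
proof (rule eq_vecI)
  fix r assume "r < dim_vec (rhs x)"
  then have r: "r < 2 * V" by (simp add: rhs_def)
  define v where "v = r div 2"
  have v: "v < V" using r by (simp add: v_def)
  have "r = (if even r then neg v else pos v)" by (simp add: v_def)
  have B: "(real_mat (matB (gadget V N inc))) $$ (r, j) = (if j = v then (if even r then 1 else - 1) else 0)" if "j < V" for j
  proof -
    have iff: "r = neg j \<longleftrightarrow> j = v \<and> even r" "r = pos j \<longleftrightarrow> j = v \<and> odd r"
      unfolding v_def by presburger+
    have "real_mat (matB (gadget V N inc)) $$ (r, j) =
        real_of_rat (if r = neg j then 1 else (if r = pos j then - 1 else 0))"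
      using r that by (simp add: gadget_def)
    then show ?thesis unfolding iff by auto
  qed
  have "(real_mat (matB (gadget V N inc)) *\<^sub>v x) $ r = (\<Sum>j<V. real_mat (matB (gadget V N inc)) $$ (r, j) * x $ j)"
    using assms r by (intro mult_mat_vec_index) (auto simp: gadget_def)
  also have "\<dots> = (\<Sum>j<V. if j = v then (if even r then 1 else - 1) * x $ j else 0)"
    by (intro sum.cong) (auto simp: B)
  also have "\<dots> = (if even r then 1 else - 1) * x $ v" using v by simp
  finally show "(real_mat (matB (gadget V N inc)) *\<^sub>v x + real_vec (vecb (gadget V N inc))) $ r = rhs x $ r"
    using r by (auto simp: rhs_def v_def gadget_def odd_iff_mod_2_eq_one)
qed (simp add: rhs_def gadget_def)

lemma gadget_objective:
  assumes "x \<in> carrier_vec V"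
  shows "real_mat (matC (gadget V N inc)) *\<^sub>v x + real_vec (vecc (gadget V N inc)) = vec (2 * V + N) (\<lambda>j. if j < 2 * V then 0 else - 1)"
    (is "_ = ?q")
proof (rule eq_vecI)
  fix r assume "r < dim_vec ?q"
  then have r: "r < 2 * V + N" by simp
  have "(real_mat (matC (gadget V N inc)) *\<^sub>v x) $ r = (\<Sum>j<V. real_mat (matC (gadget V N inc)) $$ (r, j) * x $ j)"
    using assms r by (intro mult_mat_vec_index) (auto simp: gadget_def)
  also have "\<dots> = 0" by (intro sum.neutral) (use r in \<open>auto simp: gadget_def\<close>)
  finally show "(real_mat (matC (gadget V N inc)) *\<^sub>v x + real_vec (vecc (gadget V N inc))) $ r = ?q $ r"
    using r by (auto simp: gadget_def)
qed (simp add: gadget_def)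

lemma gadget_row:
  assumes "z \<in> carrier_vec (2 * V + N)" "r < 2 * V"
  shows "(real_mat (matA (gadget V N inc)) *\<^sub>v z) $ r = z $ r + (\<Sum>c<N. if inc r c then z $ (2 * V + c) else 0)"
proof -
  have "(real_mat (matA (gadget V N inc)) *\<^sub>v z) $ r = (\<Sum>j<2 * V + N. real_mat (matA (gadget V N inc)) $$ (r, j) * z $ j)"
    using assms by (intro mult_mat_vec_index) (auto simp: gadget_def)
  also have "\<dots> = (\<Sum>j<2 * V. if j = r then z $ j else 0) + (\<Sum>c<N. if inc r c then z $ (2 * V + c) else 0)"
    unfolding sum_lessThan_add using assms(2)
    by (intro arg_cong2[where f = "(+)"] sum.cong) (auto simp: gadget_def)
  finally show ?thesis using assms(2) by simp
qed

text \<open>If no row of a clause vanishes, its column can be raised from 0 at the expense of the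
  slack columns, which lowers the cost. If for every clause some row vanishes, all clause columns
  are 0 in every feasible solution, and every feasible solution has cost 0.\<close>

lemma gadget_optimal_iff:
  assumes \<beta>: "\<beta> \<in> carrier_vec (2 * V)"
  shows "lp_optimal (vec (2 * V + N) (\<lambda>j. if j < 2 * V then 0 else - 1)) (real_mat (matA (gadget V N inc))) \<beta>
      (vec (2 * V + N) (\<lambda>i. if i < 2 * V then \<beta> $ i else 0)) \<longleftrightarrow>
    (\<forall>r<2 * V. 0 \<le> \<beta> $ r) \<and> (\<forall>c<N. \<exists>r<2 * V. inc r c \<and> \<beta> $ r = 0)"
    (is "lp_optimal ?q ?A \<beta> ?y \<longleftrightarrow> ?rhs")
proof -
  have dims: "dim_col ?A = 2 * V + N" "dim_row ?A = 2 * V" by (simp_all add: gadget_def)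
  have feas: "lp_feasible ?A \<beta> z \<longleftrightarrow> z \<in> carrier_vec (2 * V + N) \<and> (\<forall>j<2 * V + N. 0 \<le> z $ j) \<and>
      (\<forall>r<2 * V. z $ r + (\<Sum>c<N. if inc r c then z $ (2 * V + c) else 0) = \<beta> $ r)" for z
  proof (cases "z \<in> carrier_vec (2 * V + N)")
    case True
    have "?A *\<^sub>v z = \<beta> \<longleftrightarrow> (\<forall>r<2 * V. (?A *\<^sub>v z) $ r = \<beta> $ r)"
      using \<beta> dims by (auto intro!: eq_vecI)
    also have "\<dots> \<longleftrightarrow> (\<forall>r<2 * V. z $ r + (\<Sum>c<N. if inc r c then z $ (2 * V + c) else 0) = \<beta> $ r)"
      using gadget_row[OF True] by metis
    finally show ?thesis
      unfolding lp_feasible_def dims zero_le_vec_iff[OF True] using True by blast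
  next
    case False
    then show ?thesis unfolding lp_feasible_def dims by blast
  qed
  have q: "?q \<bullet> z = - (\<Sum>c<N. z $ (2 * V + c))" if "z \<in> carrier_vec (2 * V + N)" for z
    unfolding scalar_prod_sum[OF that] sum_lessThan_add by (simp add: sum_negf)
  have y: "lp_feasible ?A \<beta> ?y \<longleftrightarrow> (\<forall>r<2 * V. 0 \<le> \<beta> $ r)"
  proof -
    have "(\<Sum>c<N. if inc r c then ?y $ (2 * V + c) else 0) = 0" for r
      by (intro sum.neutral) auto
    then show ?thesis unfolding feas by auto
  qed
  have "(\<Sum>c<N. ?y $ (2 * V + c)) = 0" by (intro sum.neutral) auto
  then have qy: "?q \<bullet> ?y = 0" by (subst q) auto
  show ?thesis
  proof
    assume opt: "lp_optimal ?q ?A \<beta> ?y"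
    then have nn: "\<forall>r<2 * V. 0 \<le> \<beta> $ r" using y by (simp add: lp_optimal_def)
    moreover have "\<exists>r<2 * V. inc r c \<and> \<beta> $ r = 0" if c: "c < N" for c
    proof (rule ccontr)
      assume no: "\<not> (\<exists>r<2 * V. inc r c \<and> \<beta> $ r = 0)"
      \<comment> \<open>The largest admissible step of the clause column is the least right-hand
        side in its rows; the element 1 covers a clause without literals.\<close>
      define S where "S = insert 1 ((\<lambda>r. \<beta> $ r) ` {r. r < 2 * V \<and> inc r c})"
      have S: "finite S" "S \<noteq> {}" unfolding S_def by auto
      define \<epsilon> where "\<epsilon> = Min S"
      have "\<forall>s\<in>S. 0 < s" using nn no by (auto simp: S_def less_le)
      then have "\<epsilon> > 0" using Min_in[OF S] unfolding \<epsilon>_def by blast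
      have le: "\<epsilon> \<le> \<beta> $ r" if "r < 2 * V" "inc r c" for r
        unfolding \<epsilon>_def using that by (intro Min_le[OF S(1)]) (auto simp: S_def)
      \<comment> \<open>A pivot step from the basic solution: clause column \<open>c\<close> enters
        with value \<open>\<epsilon>\<close>, and the slack columns of its rows compensate.\<close>
      define z where "z = vec (2 * V + N) (\<lambda>i. if i < 2 * V then \<beta> $ i - (if inc i c then \<epsilon> else 0)
         else if i = 2 * V + c then \<epsilon> else 0)"
      have zc: "z $ (2 * V + d) = (if d = c then \<epsilon> else 0)" if "d < N" for d
        using that by (auto simp: z_def)
      have s: "(\<Sum>d<N. if inc r d then z $ (2 * V + d) else 0) = (if inc r c then \<epsilon> else 0)" for r
      proof -
        have "(\<Sum>d<N. if inc r d then z $ (2 * V + d) else 0) = (\<Sum>d<N. if d = c then (if inc r c then \<epsilon> else 0) else 0)"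
          by (intro sum.cong) (auto simp: zc)
        then show ?thesis using c by simp
      qed
      have zcar: "z \<in> carrier_vec (2 * V + N)" by (simp add: z_def)
      have "lp_feasible ?A \<beta> z"
        unfolding feas s using nn le \<open>\<epsilon> > 0\<close> by (auto simp: z_def)
      moreover have "?q \<bullet> z = - \<epsilon>"
      proof -
        have "(\<Sum>d<N. z $ (2 * V + d)) = (\<Sum>d<N. if d = c then \<epsilon> else 0)"
          by (intro sum.cong) (auto simp: zc)
        then show ?thesis unfolding q[OF zcar] using c by simp
      qed
      ultimately show False using opt qy \<open>\<epsilon> > 0\<close> unfolding lp_optimal_def by fastforce
    qed
    ultimately show ?rhs by blast
  next
    assume r: ?rhs
    have "?q \<bullet> ?y \<le> ?q \<bullet> z" if "lp_feasible ?A \<beta> z" for z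
    proof -
      from that have z: "z \<in> carrier_vec (2 * V + N)" "\<And>j. j < 2 * V + N \<Longrightarrow> 0 \<le> z $ j"
        "\<And>r. r < 2 * V \<Longrightarrow> z $ r + (\<Sum>c<N. if inc r c then z $ (2 * V + c) else 0) = \<beta> $ r"
        unfolding feas by auto
      have "z $ (2 * V + c) = 0" if c: "c < N" for c
      proof -
        obtain r where r: "r < 2 * V" "inc r c" "\<beta> $ r = 0" using r c by blast
        have "(if inc r c then z $ (2 * V + c) else 0) \<le> (\<Sum>c<N. if inc r c then z $ (2 * V + c) else 0)"
          using c z(2) by (intro member_le_sum) auto
        then show ?thesis using r z(3)[OF r(1)] z(2)[of r] z(2)[of "2 * V + c"] c by simp
      qed
      then show ?thesis unfolding qy q[OF z(1)] by simp
    qed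
    then show "lp_optimal ?q ?A \<beta> ?y" using r y unfolding lp_optimal_def by blast
  qed
qed

text \<open>Nonnegativity of the rows confines the parameters to the unit interval, but not to its
  ends. Taking exactly the parameters with value 1 as true makes the literal of every vanishing row
  true.\<close>

lemma gadget_optimistic_iff: "optimistic_BILFP (gadget V N inc) \<longleftrightarrow> satisfiable V N inc"
proof -
  have dims: "basis (gadget V N inc) = {..<2 * V}" "dim_col (real_mat (matD (gadget V N inc))) = V" "dim_row (real_mat (matD (gadget V N inc))) = 0"
     "dim_vec (vecd (gadget V N inc)) = 0" by (simp_all add: gadget_def)
  have poly: "polyhedron (real_mat (matD (gadget V N inc))) (real_vec (vecd (gadget V N inc))) = carrier_vec V"
    unfolding polyhedron_def dims using dims by (auto simp: less_eq_vec_def)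
  have "optimistic_BILFP (gadget V N inc) \<longleftrightarrow> (\<exists>x \<in> carrier_vec V.
      (\<forall>r<2 * V. 0 \<le> rhs x $ r) \<and> (\<forall>c<N. \<exists>r<2 * V. inc r c \<and> rhs x $ r = 0))"
    unfolding optimistic_BILFP_def poly optimal_basis_def dims(1)
  proof (intro bex_cong refl)
    fix x :: "real vec" assume x: "x \<in> carrier_vec V"
    have rc: "rhs x \<in> carrier_vec (2 * V)" by (simp add: rhs_def)
    show "(is_basis (real_mat (matA (gadget V N inc))) {..<2 * V} \<and>
      lp_optimal (real_mat (matC (gadget V N inc)) *\<^sub>v x + real_vec (vecc (gadget V N inc))) (real_mat (matA (gadget V N inc)))
       (real_mat (matB (gadget V N inc)) *\<^sub>v x + real_vec (vecb (gadget V N inc)))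
       (basic_solution (real_mat (matA (gadget V N inc))) (real_mat (matB (gadget V N inc)) *\<^sub>v x + real_vec (vecb (gadget V N inc))) {..<2 * V})) \<longleftrightarrow>
      ((\<forall>r<2 * V. 0 \<le> rhs x $ r) \<and> (\<forall>c<N. \<exists>r<2 * V. inc r c \<and> rhs x $ r = 0))"
      unfolding gadget_rhs[OF x] gadget_objective[OF x] gadget_basic_solution[OF rc]
        gadget_optimal_iff[OF rc] using gadget_real_basis by blast
  qed
  also have "\<dots> \<longleftrightarrow> satisfiable V N inc"
  proof
    assume "\<exists>x \<in> carrier_vec V.
      (\<forall>r<2 * V. 0 \<le> rhs x $ r) \<and> (\<forall>c<N. \<exists>r<2 * V. inc r c \<and> rhs x $ r = 0)"
    then obtain x where x: "\<And>c. c < N \<Longrightarrow> \<exists>r<2 * V. inc r c \<and> rhs x $ r = 0" by blast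
    have "holds (\<lambda>v. x $ v = 1) r" if "r < 2 * V" "rhs x $ r = 0" for r
      using that by (auto simp: holds_def rhs_def split: if_splits)
    then show "satisfiable V N inc"
      unfolding satisfiable_def using x by blast
  next
    assume "satisfiable V N inc"
    then obtain \<nu> where \<nu>: "\<And>c. c < N \<Longrightarrow> \<exists>r<2 * V. inc r c \<and> holds \<nu> r"
      unfolding satisfiable_def by blast
    define x where "x = vec V (\<lambda>v. if \<nu> v then 1 else 0 :: real)"
    have rx: "rhs x $ r = (if holds \<nu> r then 0 else 1)" if "r < 2 * V" for r
      using that by (auto simp: holds_def rhs_def x_def)
    have "\<forall>r<2 * V. 0 \<le> rhs x $ r" using rx by simp
    moreover have "\<forall>c<N. \<exists>r<2 * V. inc r c \<and> rhs x $ r = 0" using rx \<nu> by metis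
    moreover have "x \<in> carrier_vec V" by (simp add: x_def)
    ultimately show "\<exists>x \<in> carrier_vec V.
      (\<forall>r<2 * V. 0 \<le> rhs x $ r) \<and> (\<forall>c<N. \<exists>r<2 * V. inc r c \<and> rhs x $ r = 0)"
      by blast
  qed
  finally show ?thesis .
qed

end

subsection \<open>Encodings\<close>

lemma enc_vec_vec: "enc_vec (vec n f) = concat (map (\<lambda>i. enc_rat (f i)) [0..<n])"
  by (simp add: enc_vec_def list_of_vec_vec comp_def)

lemma enc_mat_mat:
  "enc_mat (mat m n f) = concat (map (\<lambda>i. concat (map (\<lambda>j. enc_rat (f (i, j))) [0..<n])) [0..<m])"
proof -
  have "rows (mat m n f) = map (\<lambda>i. vec n (\<lambda>j. f (i, j))) [0..<m]"
    unfolding rows_def by (auto intro!: eq_vecI)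
  then show ?thesis by (simp add: enc_mat_def enc_vec_vec comp_def)
qed

lemma pt_enc_rat_if:
  assumes "polytime (\<lambda>e. [P e])" "polytime (\<lambda>e. enc_rat (x e))" "polytime (\<lambda>e. enc_rat (y e))"
  shows "polytime (\<lambda>e. enc_rat (if P e then x e else y e))"
  using pt_if[OF assms] by (simp add: if_distrib)

lemma enc_unary_una: "enc_unary n = una n @ [False]"
  by (simp add: enc_unary_def una_def)

lemma pt_gadget:
  assumes V: "polytime (\<lambda>w. una (V w))" and N: "polytime (\<lambda>w. una (N w))"
    and inc: "\<And>f r c. polytime f \<Longrightarrow> polytime (\<lambda>e. una (r e)) \<Longrightarrow> polytime (\<lambda>e. una (c e)) \<Longrightarrow>
      polytime (\<lambda>e. [inc (f e) (r e) (c e)])"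
  shows "polytime (\<lambda>w. encode (gadget (V w) (N w) (inc w)))"
proof -
  have basis: "map (\<lambda>j. j \<in> {..<k}) xs = concat (map (\<lambda>j. [j < k]) xs)" for k :: nat and xs
    by (induction xs) auto
  have dims: "dim_m (gadget v n i) = 2 * v" "dim_n (gadget v n i) = 2 * v + n"
    "dim_k (gadget v n i) = v" "dim_g (gadget v n i) = 0" for v n i by (simp_all add: gadget_def)
  show ?thesis
    unfolding encode_def dims unfolding gadget_def inst.simps enc_unary_una enc_mat_mat enc_vec_vec prod.case basis
    by (intro pt_append pt_concat pt_enc_rat_if pt_una_add pt_una_mult pt_una_const pt_una_Suc pt_una_diff
      pt_less pt_eq pt_una_mod pt_una_length inc pt_first pt_second polytime_id polytime_const
      V N polytime_comp[OF V] polytime_comp[OF N])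
qed

text \<open>All gadgets have a fixed objective, so one reduction serves the general and the
  restricted problem; \<open>R\<close> stands for the restriction.\<close>

theorem BILFP_NP_hard:
  assumes "\<And>V N inc. R (gadget V N inc)"
  shows "NP_hard (BILFP_language R)"
  unfolding NP_hard_def
proof
  fix L assume "L \<in> NP"
  then obtain M and p q :: "nat poly" where M: "wf_tm M" and L: "\<And>w. w \<in> L \<longleftrightarrow>
      (\<exists>u. length u \<le> poly q (length w) \<and> fst (run M (poly p (length w)) [w, u]) = accept M)"
    unfolding NP_def by blast
  have "finite {ys :: bool option list. length ys = num_tapes M}"
    using finite_lists_length_eq[of "UNIV :: bool option set"] by simp
  then have "finite ({..<num_states M} \<times> {ys :: bool option list. length ys = num_tapes M})" by simp
  then obtain combos where "set combos = {..<num_states M} \<times> {ys :: bool option list. length ys = num_tapes M}"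
    using finite_list by blast
  then interpret tableau M p q combos by unfold_locales (auto simp: M)
  let ?f = "\<lambda>w. encode (gadget (n_vars w) (n_clauses w) (inc w))"
  have "polytime ?f"
    by (rule pt_gadget) (intro pt_n_vars pt_n_clauses pt_inc polytime_id | assumption)+
  moreover have "w \<in> L \<longleftrightarrow> ?f w \<in> BILFP_language R" for w
  proof -
    let ?P = "gadget (n_vars w) (n_clauses w) (inc w)"
    \<comment> \<open>The language is an image under \<open>encode\<close>, so injectivity is needed
      to conclude that the gadget itself, and not another instance with the same code, is a positive
      one.\<close>
    have "?f w \<in> BILFP_language R \<longleftrightarrow> is_instance ?P \<and> R ?P \<and> optimistic_BILFP ?P"
      unfolding BILFP_language_def
      using inj_on_image_mem_iff[OF encode_inj, of ?P "{P. is_instance P \<and> R P \<and> optimistic_BILFP P}"]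
        gadget_instance(1) by blast
    then show ?thesis
      unfolding L gadget_optimistic_iff satisfiable_iff_accepting
      using assms gadget_instance(1) by blast
  qed
  ultimately show "poly_reducible L (BILFP_language R)"
    unfolding poly_reducible_def using polytime_imp_poly_time_computable by blast
qed

section \<open>Linear programming duality\<close>

definition dot :: "nat \<Rightarrow> (nat \<Rightarrow> real) \<Rightarrow> (nat \<Rightarrow> real) \<Rightarrow> real" where
  "dot n u x = (\<Sum>j<n. u j * x j)"

lemma dot_diff_left: "dot n (\<lambda>j. u j - k * v j) x = dot n u x - k * dot n v x"
  by (simp add: dot_def left_diff_distrib sum_subtractf sum_distrib_left mult.assoc)

lemma dot_diff_right: "dot n u (\<lambda>j. x j - k * y j) = dot n u x - k * dot n u y"
  by (simp add: dot_def right_diff_distrib sum_subtractf sum_distrib_left mult.left_commute)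

lemma dot_scale: "dot n u (\<lambda>j. k * x j) = k * dot n u x"
  by (simp add: dot_def sum_distrib_left mult.left_commute)

text \<open>Bartl's inductive proof: if the last inequality is needed, project along a vector that
  violates the conclusion but satisfies all other inequalities.\<close>

lemma farkas:
  fixes a :: "nat \<Rightarrow> nat \<Rightarrow> real" and m n :: nat
  assumes "\<forall>x. (\<forall>i<m. dot n (a i) x \<le> 0) \<longrightarrow> dot n c x \<le> 0"
  shows "\<exists>l. (\<forall>i<m. 0 \<le> l i) \<and> (\<forall>j<n. c j = (\<Sum>i<m. l i * a i j))"
  using assms
proof (induction m arbitrary: a c)
  case 0
  have "(\<Sum>j<n. c j * c j) \<le> 0" using 0[rule_format, of c] by (simp add: dot_def)
  moreover have "0 \<le> (\<Sum>j<n. c j * c j)" by (intro sum_nonneg) simp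
  ultimately have "(\<Sum>j<n. c j * c j) = 0" by linarith
  then have "\<forall>j\<in>{..<n}. c j * c j = 0" by (subst (asm) sum_nonneg_eq_0_iff) auto
  then show ?case by auto
next
  case (Suc m)
  show ?case
  proof (cases "\<forall>x. (\<forall>i<m. dot n (a i) x \<le> 0) \<longrightarrow> dot n c x \<le> 0")
    case True
    then obtain l where l: "\<forall>i<m. 0 \<le> l i" "\<forall>j<n. c j = (\<Sum>i<m. l i * a i j)"
      using Suc.IH[of a c] by blast
    then show ?thesis by (intro exI[of _ "l(m := 0)"]) (auto simp: less_Suc_eq)
  next
    case False
    then obtain x0 where x0: "\<And>i. i < m \<Longrightarrow> dot n (a i) x0 \<le> 0" "0 < dot n c x0" by force
    then have pos: "0 < dot n (a m) x0" using Suc.prems[rule_format, of x0] by (force simp: less_Suc_eq)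
    define x where "x = (\<lambda>j. (1 / dot n (a m) x0) * x0 j)"
    have x: "\<And>i. i < m \<Longrightarrow> dot n (a i) x \<le> 0" "0 < dot n c x" "dot n (a m) x = 1"
      unfolding x_def dot_scale using x0 pos by (auto simp: divide_nonpos_pos)
    \<comment> \<open>The modified forms are the old ones composed with the projection
      \<open>y - dot n (a m) y * x\<close> along \<open>x\<close>, on whose range the last form
      vanishes.\<close>
    define a' where "a' i = (\<lambda>j. a i j - dot n (a i) x * a m j)" for i
    define c' where "c' = (\<lambda>j. c j - dot n c x * a m j)"
    have "dot n c' y \<le> 0" if y: "\<forall>i<m. dot n (a' i) y \<le> 0" for y
    proof -
      let ?y = "\<lambda>j. y j - dot n (a m) y * x j"
      have "dot n (a i) ?y \<le> 0" if "i < Suc m" for i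
      proof (cases "i = m")
        case False
        then have "dot n (a' i) y \<le> 0" using y that by simp
        then show ?thesis unfolding dot_diff_right a'_def dot_diff_left by (simp add: mult.commute)
      next
        case True
        then show ?thesis by (simp add: dot_diff_right x(3))
      qed
      then have "dot n c ?y \<le> 0" using Suc.prems by blast
      then show ?thesis unfolding dot_diff_right c'_def dot_diff_left by (simp add: mult.commute)
    qed
    then obtain l where l: "\<forall>i<m. 0 \<le> l i" "\<forall>j<n. c' j = (\<Sum>i<m. l i * a' i j)"
      using Suc.IH[of a' c'] by blast
    \<comment> \<open>Undoing the projection determines the multiplier of the last form. It is
      positive in \<open>dot n c x\<close> and collects only nonpositive terms with a minus
      sign.\<close>
    let ?k = "dot n c x - (\<Sum>i<m. l i * dot n (a i) x)"
    have "(\<Sum>i<m. l i * dot n (a i) x) \<le> 0" using l x by (intro sum_nonpos) (simp add: mult_nonneg_nonpos)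
    then have "0 \<le> ?k" using x(2) by linarith
    moreover have "c j = (\<Sum>i<m. l i * a i j) + ?k * a m j" if "j < n" for j
    proof -
      have "c j - dot n c x * a m j = (\<Sum>i<m. l i * (a i j - dot n (a i) x * a m j))"
        using l(2) that by (simp add: c'_def a'_def)
      also have "\<dots> = (\<Sum>i<m. l i * a i j) - (\<Sum>i<m. l i * dot n (a i) x) * a m j"
        by (simp add: right_diff_distrib sum_subtractf sum_distrib_right mult.assoc)
      finally show ?thesis by (simp add: left_diff_distrib)
    qed
    ultimately show ?thesis
      using l(1) by (intro exI[of _ "l(m := ?k)"]) (auto simp: less_Suc_eq)
  qed
qed

section \<open>Optimality as complementary slackness\<close>

lemma lp_feasible_iff:
  assumes "A \<in> carrier_mat m n" "\<beta> \<in> carrier_vec m"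
  shows "lp_feasible A \<beta> y \<longleftrightarrow> y \<in> carrier_vec n \<and> (\<forall>i<m. (\<Sum>j<n. A $$ (i, j) * y $ j) = \<beta> $ i) \<and>
    (\<forall>j<n. 0 \<le> y $ j)"
proof (cases "y \<in> carrier_vec n")
  case True
  have "A *\<^sub>v y = \<beta> \<longleftrightarrow> (\<forall>i<m. (A *\<^sub>v y) $ i = \<beta> $ i)"
    using assms by (auto intro!: eq_vecI)
  also have "\<dots> \<longleftrightarrow> (\<forall>i<m. (\<Sum>j<n. A $$ (i, j) * y $ j) = \<beta> $ i)"
    using mult_mat_vec_index[OF assms(1) True] by metis
  finally show ?thesis
    using assms(1) True unfolding lp_feasible_def by (simp add: zero_le_vec_iff)
next
  case False
  then show ?thesis using assms(1) unfolding lp_feasible_def by auto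
qed

text \<open>Weak duality with equal objective values gives one direction. For the other, no feasible
  direction at \<open>y\<close> improves the objective, and Farkas' lemma for the cone of these
  directions yields the dual solution.\<close>

lemma lp_optimal_iff:
  assumes A: "A \<in> carrier_mat m n" and \<beta>: "\<beta> \<in> carrier_vec m" and y: "lp_feasible A \<beta> y"
  shows "lp_optimal q A \<beta> y \<longleftrightarrow>
    (\<exists>p. \<forall>j<n. (\<Sum>i<m. A $$ (i, j) * p i) \<le> q $ j \<and> (y $ j \<noteq> 0 \<longrightarrow> (\<Sum>i<m. A $$ (i, j) * p i) = q $ j))"
proof
  note feas = lp_feasible_iff[OF A \<beta>]
  have yc: "y \<in> carrier_vec n" "\<And>j. j < n \<Longrightarrow> 0 \<le> y $ j"
    "\<And>i. i < m \<Longrightarrow> (\<Sum>j<n. A $$ (i, j) * y $ j) = \<beta> $ i"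
    using y unfolding feas by auto
  {
    assume "\<exists>p. \<forall>j<n. (\<Sum>i<m. A $$ (i, j) * p i) \<le> q $ j \<and> (y $ j \<noteq> 0 \<longrightarrow> (\<Sum>i<m. A $$ (i, j) * p i) = q $ j)"
    then obtain p where p: "\<And>j. j < n \<Longrightarrow> (\<Sum>i<m. A $$ (i, j) * p i) \<le> q $ j"
      "\<And>j. j < n \<Longrightarrow> y $ j \<noteq> 0 \<Longrightarrow> (\<Sum>i<m. A $$ (i, j) * p i) = q $ j" by blast
    have dual: "(\<Sum>j<n. (\<Sum>i<m. A $$ (i, j) * p i) * z $ j) = (\<Sum>i<m. p i * \<beta> $ i)"
      if "lp_feasible A \<beta> z" for z
    proof -
      have "(\<Sum>j<n. (\<Sum>i<m. A $$ (i, j) * p i) * z $ j) = (\<Sum>i<m. p i * (\<Sum>j<n. A $$ (i, j) * z $ j))"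
        unfolding sum_distrib_left sum_distrib_right
        by (subst sum.swap) (simp add: mult_ac)
      then show ?thesis using that unfolding feas by simp
    qed
    have "q \<bullet> y \<le> q \<bullet> z" if z: "lp_feasible A \<beta> z" for z
    proof -
      have zc: "z \<in> carrier_vec n" "\<And>j. j < n \<Longrightarrow> 0 \<le> z $ j" using z unfolding feas by auto
      have "q \<bullet> y = (\<Sum>j<n. (\<Sum>i<m. A $$ (i, j) * p i) * y $ j)"
      proof -
        have "q $ j * y $ j = (\<Sum>i<m. A $$ (i, j) * p i) * y $ j" if "j < n" for j
          using p(2)[OF that] by (cases "y $ j = 0") simp_all
        then show ?thesis unfolding scalar_prod_sum[OF yc(1)] by (intro sum.cong) auto
      qed
      also have "\<dots> = (\<Sum>j<n. (\<Sum>i<m. A $$ (i, j) * p i) * z $ j)"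
        unfolding dual[OF y] dual[OF z] ..
      also have "\<dots> \<le> q \<bullet> z"
        unfolding scalar_prod_sum[OF zc(1)] using p(1) zc(2) by (intro sum_mono mult_right_mono) auto
      finally show ?thesis .
    qed
    then show "lp_optimal q A \<beta> y" using y unfolding lp_optimal_def by blast
  }
  assume opt: "lp_optimal q A \<beta> y"
  \<comment> \<open>The cone of feasible directions at \<open>y\<close>: \<open>A h = 0\<close> as
    two blocks of inequalities, and \<open>- h j \<le> 0\<close> for the coordinates with
    \<open>y $ j = 0\<close>. Coordinates with positive \<open>y $ j\<close> are free and contribute
    zero rows.\<close>
  define a where "a k = (\<lambda>j. if k < m then A $$ (k, j) else if k - m < m then - A $$ (k - m, j)
      else if j = k - (m + m) \<and> y $ j = 0 then - 1 else 0)" for k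
  define c where "c = (\<lambda>j. - q $ j)"
  have "dot n c h \<le> 0" if h: "\<forall>k<m + m + n. dot n (a k) h \<le> 0" for h
  proof -
    have Ah: "(\<Sum>j<n. A $$ (i, j) * h j) = 0" if i: "i < m" for i
    proof -
      have "dot n (a i) h = (\<Sum>j<n. A $$ (i, j) * h j)"
        "dot n (a (m + i)) h = - (\<Sum>j<n. A $$ (i, j) * h j)"
        using i by (simp_all add: dot_def a_def sum_negf)
      then show ?thesis using h[rule_format, of i] h[rule_format, of "m + i"] i by simp
    qed
    have hn: "0 \<le> h j" if j: "j < n" "y $ j = 0" for j
    proof -
      have "dot n (a (m + m + j)) h = (\<Sum>l<n. if l = j then - h l else 0)"
        unfolding dot_def using j by (intro sum.cong) (auto simp: a_def)
      also have "\<dots> = - h j" using j by simp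
      finally show ?thesis using h[rule_format, of "m + m + j"] j by simp
    qed
    \<comment> \<open>The ratio test: the least quotient is a step that keeps all coordinates
      nonnegative. The element 1 covers the case that no coordinate decreases.\<close>
    define S where "S = insert 1 ((\<lambda>j. y $ j / \<bar>h j\<bar>) ` {j. j < n \<and> y $ j \<noteq> 0 \<and> h j < 0})"
    have S: "finite S" "S \<noteq> {}" by (auto simp: S_def)
    define \<epsilon> where "\<epsilon> = Min S"
    have "0 < y $ j / \<bar>h j\<bar>" if "j < n" "y $ j \<noteq> 0" "h j < 0" for j
      using yc(2)[OF that(1)] that by (intro divide_pos_pos) auto
    then have "\<forall>s\<in>S. 0 < s" by (auto simp: S_def)
    then have \<epsilon>: "0 < \<epsilon>" using Min_in[OF S] unfolding \<epsilon>_def by blast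
    define z where "z = vec n (\<lambda>j. y $ j + \<epsilon> * h j)"
    have "0 \<le> y $ j + \<epsilon> * h j" if j: "j < n" for j
    proof (cases "0 \<le> h j")
      case True
      then show ?thesis using yc(2)[OF j] \<epsilon> by simp
    next
      case False
      then have "y $ j \<noteq> 0" using hn[OF j] by auto
      then have "\<epsilon> \<le> y $ j / \<bar>h j\<bar>"
        unfolding \<epsilon>_def using False j by (intro Min_le[OF S(1)]) (auto simp: S_def)
      then show ?thesis using False by (simp add: field_simps)
    qed
    moreover have "(\<Sum>j<n. A $$ (i, j) * (y $ j + \<epsilon> * h j)) = \<beta> $ i" if i: "i < m" for i
    proof -
      have "(\<Sum>j<n. A $$ (i, j) * (y $ j + \<epsilon> * h j)) =
          (\<Sum>j<n. A $$ (i, j) * y $ j) + \<epsilon> * (\<Sum>j<n. A $$ (i, j) * h j)"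
        by (simp add: distrib_left sum.distrib sum_distrib_left mult.left_commute)
      then show ?thesis using Ah[OF i] yc(3)[OF i] by simp
    qed
    ultimately have "lp_feasible A \<beta> z" unfolding feas by (auto simp: z_def)
    then have "q \<bullet> y \<le> q \<bullet> z" using opt unfolding lp_optimal_def by blast
    also have "q \<bullet> z = q \<bullet> y + \<epsilon> * (\<Sum>j<n. q $ j * h j)"
      unfolding scalar_prod_sum[OF yc(1)] using scalar_prod_sum[of z n q]
      by (simp add: z_def distrib_left sum.distrib sum_distrib_left mult.left_commute)
    finally have "0 \<le> (\<Sum>j<n. q $ j * h j)" using \<epsilon> by (simp add: zero_le_mult_iff)
    then show ?thesis by (simp add: dot_def c_def sum_negf)
  qed
  then obtain l where l: "\<forall>k<m + m + n. 0 \<le> l k" "\<forall>j<n. c j = (\<Sum>k<m + m + n. l k * a k j)"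
    using farkas[of "m + m + n" n a c] by blast
  \<comment> \<open>The free dual variable is the difference of the multipliers of both blocks; its
    sign stems from \<open>c\<close> being the negated objective.\<close>
  let ?p = "\<lambda>i. l (m + i) - l i"
  have "(\<Sum>i<m. A $$ (i, j) * ?p i) \<le> q $ j \<and> (y $ j \<noteq> 0 \<longrightarrow> (\<Sum>i<m. A $$ (i, j) * ?p i) = q $ j)"
    if j: "j < n" for j
  proof -
    have "- q $ j = (\<Sum>i<m. l i * a i j) + (\<Sum>i<m. l (m + i) * a (m + i) j) + (\<Sum>k<n. l (m + m + k) * a (m + m + k) j)"
      using l(2) j unfolding sum_lessThan_add by (simp add: c_def)
    also have "(\<Sum>i<m. l i * a i j) = (\<Sum>i<m. l i * A $$ (i, j))" by (simp add: a_def)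
    also have "(\<Sum>i<m. l (m + i) * a (m + i) j) = - (\<Sum>i<m. l (m + i) * A $$ (i, j))"
      by (simp add: a_def sum_negf)
    also have "(\<Sum>k<n. l (m + m + k) * a (m + m + k) j) =
        (\<Sum>k<n. if k = j then (if y $ j = 0 then - l (m + m + k) else 0) else 0)"
      by (intro sum.cong) (auto simp: a_def)
    also have "\<dots> = (if y $ j = 0 then - l (m + m + j) else 0)" using j by simp
    finally have "q $ j = (\<Sum>i<m. l (m + i) * A $$ (i, j)) - (\<Sum>i<m. l i * A $$ (i, j))
        + (if y $ j = 0 then l (m + m + j) else 0)" by auto
    moreover have "(\<Sum>i<m. A $$ (i, j) * ?p i) = (\<Sum>i<m. l (m + i) * A $$ (i, j)) - (\<Sum>i<m. l i * A $$ (i, j))"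
      by (simp add: right_diff_distrib sum_subtractf mult.commute)
    moreover have "0 \<le> l (m + m + j)" using l(1) j by simp
    ultimately show ?thesis by auto
  qed
  then show "\<exists>p. \<forall>j<n. (\<Sum>i<m. A $$ (i, j) * p i) \<le> q $ j \<and> (y $ j \<noteq> 0 \<longrightarrow> (\<Sum>i<m. A $$ (i, j) * p i) = q $ j)"
    by (intro exI[of _ ?p]) blast
qed

section \<open>Small solutions of linear systems\<close>

text \<open>The crude bound from the Leibniz formula suffices, as only the number of bits
  matters.\<close>

lemma abs_det_le:
  fixes A :: "int mat"
  assumes A: "A \<in> carrier_mat k k" and le: "\<And>i j. i < k \<Longrightarrow> j < k \<Longrightarrow> \<bar>A $$ (i, j)\<bar> \<le> E"
  shows "\<bar>det A\<bar> \<le> fact k * E ^ k"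
proof -
  have "\<bar>\<Prod>i = 0..<k. A $$ (i, p i)\<bar> \<le> E ^ k" if p: "p permutes {0..<k}" for p
  proof -
    have "\<bar>\<Prod>i = 0..<k. A $$ (i, p i)\<bar> \<le> (\<Prod>i = 0..<k. E)"
      unfolding abs_prod using le permutes_in_image[OF p] by (intro prod_mono) auto
    then show ?thesis by simp
  qed
  then have "\<bar>signof p * (\<Prod>i = 0..<k. A $$ (i, p i))\<bar> \<le> E ^ k" if "p permutes {0..<k}" for p
    using that by (auto simp: abs_mult sign_def)
  then have "(\<Sum>p | p permutes {0..<k}. \<bar>signof p * (\<Prod>i = 0..<k. A $$ (i, p i))\<bar>)
      \<le> of_nat (card {p. p permutes {0..<k}}) * E ^ k"
    by (intro sum_bounded_above) auto
  also have "card {p. p permutes {0..<k}} = fact k" by (intro card_permutations) auto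
  finally show ?thesis
    unfolding det_def'[OF A] using order_trans[OF sum_abs] by simp
qed

text \<open>Here \<open>e\<close> is the homogenising coordinate. In a solution of minimal support
  the columns of the support other than \<open>e\<close> are independent, so the solution scaled to
  1 at \<open>e\<close> is the unique solution of the normal equations. Cramer's rule makes it
  integral after multiplication by the Gram determinant. Gram entries are at most
  \<open>R * B * B\<close>, and products of such entries give the bound.\<close>

lemma small_solution:
  fixes M :: "nat \<Rightarrow> nat \<Rightarrow> int" and z :: "nat \<Rightarrow> real"
  assumes B: "\<And>r v. r < R \<Longrightarrow> v < Z \<Longrightarrow> \<bar>M r v\<bar> \<le> B" "0 \<le> B"
    and z: "\<And>r. r < R \<Longrightarrow> (\<Sum>v<Z. of_int (M r v) * z v) = 0" and e: "e < Z" "0 < z e"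
  shows "\<exists>x :: nat \<Rightarrow> int. (\<forall>r<R. (\<Sum>v<Z. M r v * x v) = 0) \<and> 0 < x e \<and>
    (\<forall>v<Z. (x v > 0 \<longrightarrow> z v > 0) \<and> (x v < 0 \<longrightarrow> z v < 0)) \<and>
    (\<forall>v<Z. \<bar>x v\<bar> \<le> (int Z * (1 + int R * B * B)) ^ Suc Z)"
proof -
  \<comment> \<open>Coordinates may become 0 but never acquire a sign that \<open>z\<close> lacks
    there.\<close>
  define sol where "sol y \<longleftrightarrow> (\<forall>r<R. (\<Sum>v<Z. of_int (M r v) * y v) = 0) \<and> 0 < y e \<and>
    (\<forall>v<Z. (y v > 0 \<longrightarrow> z v > 0) \<and> (y v < 0 \<longrightarrow> z v < 0))" for y :: "nat \<Rightarrow> real"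
  define supp where "supp y = {v. v < Z \<and> y v \<noteq> 0}" for y :: "nat \<Rightarrow> real"
  have fin: "finite (supp y)" for y by (simp add: supp_def)
  have "sol z" using z e by (simp add: sol_def)
  then obtain y where y: "sol y" and min: "\<And>y'. sol y' \<Longrightarrow> card (supp y) \<le> card (supp y')"
    using ex_has_least_nat[of sol z "\<lambda>y. card (supp y)"] by blast
  define S where "S = supp y - {e}"
  have finS: "finite S" and SZ: "S \<subseteq> {..<Z}" and eS: "e \<notin> S" using fin by (auto simp: S_def supp_def)
  \<comment> \<open>otherwise move along \<open>h\<close> until the first coordinate vanishes\<close>
  have indep: "\<forall>v\<in>S. h v = 0" if h: "\<And>r. r < R \<Longrightarrow> (\<Sum>v\<in>S. of_int (M r v) * h v) = 0" for h :: "nat \<Rightarrow> real"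
  proof (rule ccontr)
    assume "\<not> (\<forall>v\<in>S. h v = 0)"
    define U where "U = {v\<in>S. h v \<noteq> 0}"
    have U: "finite U" "U \<noteq> {}" using finS \<open>\<not> (\<forall>v\<in>S. h v = 0)\<close> by (auto simp: U_def)
    \<comment> \<open>The coordinate with the least ratio is the first to vanish along
      \<open>h\<close>; up to that point no other one changes its sign.\<close>
    then obtain u where u: "u \<in> U" "\<And>v. v \<in> U \<Longrightarrow> \<bar>y u / h u\<bar> \<le> \<bar>y v / h v\<bar>"
      using ex_min_if_finite[of "(\<lambda>v. \<bar>y v / h v\<bar>) ` U"] by fastforce
    define t where "t = - y u / h u"
    define y' where "y' v = (if v \<in> S then y v + t * h v else y v)" for v
    have y'u: "y' u = 0" using u by (simp add: y'_def U_def t_def)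
    have le: "\<bar>t * h v\<bar> \<le> \<bar>y v\<bar>" if "v \<in> S" for v
    proof (cases "h v = 0")
      case False
      then have "\<bar>t\<bar> \<le> \<bar>y v\<bar> / \<bar>h v\<bar>" using u(2)[of v] that by (simp add: U_def t_def)
      then show ?thesis using False by (simp add: field_simps abs_mult)
    qed simp
    have sg: "(y' v > 0 \<longrightarrow> y v > 0) \<and> (y' v < 0 \<longrightarrow> y v < 0)" for v
      using le[of v] by (auto simp: y'_def)
    have "(\<Sum>v<Z. of_int (M r v) * y' v) = 0" if r: "r < R" for r
    proof -
      have "(\<Sum>v<Z. of_int (M r v) * y' v) = (\<Sum>v<Z. of_int (M r v) * y v + (if v \<in> S then t * (of_int (M r v) * h v) else 0))"
        by (intro sum.cong) (auto simp: y'_def distrib_left mult_ac)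
      also have "\<dots> = (\<Sum>v<Z. of_int (M r v) * y v) + (\<Sum>v\<in>{..<Z} \<inter> S. t * (of_int (M r v) * h v))"
        by (simp add: sum.distrib sum.inter_restrict)
      also have "{..<Z} \<inter> S = S" using SZ by blast
      also have "(\<Sum>v\<in>S. t * (of_int (M r v) * h v)) = t * (\<Sum>v\<in>S. of_int (M r v) * h v)"
        by (rule sum_distrib_left[symmetric])
      finally show ?thesis using h[OF r] y r by (simp add: sol_def)
    qed
    moreover have "y' e = y e" using eS by (simp add: y'_def)
    ultimately have "sol y'" using y sg unfolding sol_def by metis
    moreover have "supp y' \<subseteq> supp y - {u}"
    proof
      fix v assume v: "v \<in> supp y'"
      then have "v \<noteq> u" using y'u by (auto simp: supp_def)
      moreover have "v \<in> supp y"
      proof (cases "v \<in> S")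
        case False
        then show ?thesis using v by (simp add: y'_def supp_def)
      qed (simp add: S_def)
      ultimately show "v \<in> supp y - {u}" by simp
    qed
    then have "card (supp y') < card (supp y)"
      using fin u(1) by (intro psubset_card_mono) (auto simp: U_def S_def)
    ultimately show False using min by fastforce
  qed
  define w where "w v = y v / y e" for v
  have ye: "0 < y e" using y by (simp add: sol_def)
  have we: "w e = 1" using ye by (simp add: w_def)
  have wS: "(\<Sum>v\<in>S. of_int (M r v) * w v) = - of_int (M r e)" if r: "r < R" for r
  proof -
    have "(\<Sum>v<Z. of_int (M r v) * w v) = (\<Sum>v<Z. of_int (M r v) * y v) / y e"
      by (simp add: w_def sum_divide_distrib)
    then have "0 = (\<Sum>v<Z. of_int (M r v) * w v)" using y r by (simp add: sol_def)
    also have "\<dots> = (\<Sum>v\<in>insert e S. of_int (M r v) * w v)"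
      using SZ e by (intro sum.mono_neutral_right) (auto simp: S_def supp_def w_def)
    finally show ?thesis using finS eS we by simp
  qed
  define s where "s = card S"
  obtain f where f: "bij_betw f {..<s} S"
    using ex_bij_betw_nat_finite[OF finS] by (auto simp: s_def atLeast0LessThan)
  have sumS: "(\<Sum>v\<in>S. F v) = (\<Sum>a<s. F (f a))" for F :: "nat \<Rightarrow> 'b :: comm_monoid_add"
    using sum.reindex_bij_betw[OF f, of F] by simp
  have fS: "f a \<in> S" if "a < s" for a using f that by (auto simp: bij_betw_def)
  then have fZ: "f a < Z" if "a < s" for a using SZ that by blast
  define G where "G = mat s s (\<lambda>(a, b). \<Sum>r<R. M r (f a) * M r (f b))"
  define g where "g a = - (\<Sum>r<R. M r (f a) * M r e)" for a
  have G: "G \<in> carrier_mat s s" by (simp add: G_def)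
  have det: "det G \<noteq> 0"
  proof
    assume "det G = 0"
    then have "det (map_mat real_of_int G) = 0" by (simp add: of_int_hom.hom_det)
    then obtain v where v: "v \<in> carrier_vec s" "v \<noteq> 0\<^sub>v s" "map_mat real_of_int G *\<^sub>v v = 0\<^sub>v s"
      using det_0_iff_vec_prod_zero[of "map_mat real_of_int G" s] G by auto
    have row: "(\<Sum>b<s. of_int (G $$ (a, b)) * v $ b) = 0" if a: "a < s" for a
      using mult_mat_vec_index[of "map_mat real_of_int G" s s v a] G v a by simp
    \<comment> \<open>The quadratic form of the Gram matrix is a sum of squares. A kernel vector of
      \<open>G\<close> therefore gives a linear dependency of the columns.\<close>
    have "(\<Sum>r<R. (\<Sum>a<s. of_int (M r (f a)) * v $ a)\<^sup>2) =
        (\<Sum>a<s. v $ a * (\<Sum>b<s. of_int (G $$ (a, b)) * v $ b))"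
    proof -
      have "(\<Sum>r<R. (\<Sum>a<s. of_int (M r (f a)) * v $ a)\<^sup>2) =
          (\<Sum>r<R. \<Sum>a<s. \<Sum>b<s. of_int (M r (f a)) * v $ a * (of_int (M r (f b)) * v $ b))"
        by (simp add: power2_eq_square sum_product)
      also have "\<dots> = (\<Sum>a<s. \<Sum>r<R. \<Sum>b<s. of_int (M r (f a)) * v $ a * (of_int (M r (f b)) * v $ b))"
        by (rule sum.swap)
      also have "\<dots> = (\<Sum>a<s. \<Sum>b<s. \<Sum>r<R. of_int (M r (f a)) * v $ a * (of_int (M r (f b)) * v $ b))"
        by (rule sum.cong[OF refl sum.swap])
      also have "\<dots> = (\<Sum>a<s. \<Sum>b<s. v $ a * (of_int (G $$ (a, b)) * v $ b))"
        by (intro sum.cong refl) (simp add: G_def sum_distrib_left sum_distrib_right mult_ac)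
      finally show ?thesis by (simp add: sum_distrib_left)
    qed
    also have "\<dots> = 0" by (intro sum.neutral) (use row in auto)
    finally have "\<forall>r\<in>{..<R}. (\<Sum>a<s. of_int (M r (f a)) * v $ a)\<^sup>2 = 0"
      by (subst (asm) sum_nonneg_eq_0_iff) auto
    then have 0: "(\<Sum>a<s. of_int (M r (f a)) * v $ a) = 0" if "r < R" for r using that by auto
    define h where "h x = v $ (the_inv_into {..<s} f x)" for x
    have hf: "h (f a) = v $ a" if "a < s" for a
      using that f by (simp add: h_def the_inv_into_f_f bij_betw_def)
    have "\<forall>x\<in>S. h x = 0"
      by (rule indep) (use 0 in \<open>simp add: sumS hf\<close>)
    then have "v $ a = 0" if "a < s" for a using hf[OF that] fS[OF that] by simp
    then have "v = 0\<^sub>v s" using v(1) by (intro eq_vecI) auto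
    then show False using v(2) by simp
  qed
  define adj where "adj a b = adj_mat G $$ (a, b)" for a b
  have Gw: "(\<Sum>c<s. of_int (G $$ (b, c)) * w (f c)) = of_int (g b)" if b: "b < s" for b
  proof -
    have "(\<Sum>c<s. of_int (G $$ (b, c)) * w (f c)) =
        (\<Sum>c<s. \<Sum>r<R. of_int (M r (f b)) * (of_int (M r (f c)) * w (f c)))"
      using b by (intro sum.cong refl) (simp add: G_def sum_distrib_left sum_distrib_right mult_ac)
    also have "\<dots> = (\<Sum>r<R. of_int (M r (f b)) * (\<Sum>c<s. of_int (M r (f c)) * w (f c)))"
      by (subst sum.swap) (simp add: sum_distrib_left)
    also have "\<dots> = (\<Sum>r<R. of_int (M r (f b)) * - of_int (M r e))"
      using wS by (intro sum.cong refl) (simp add: sumS)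
    finally show ?thesis by (simp add: g_def sum_negf)
  qed
  \<comment> \<open>Multiplying the normal equations by the adjugate leaves the determinant on the
    diagonal.\<close>
  have cramer: "of_int (det G) * w (f a) = of_int (\<Sum>b<s. adj a b * g b)" if a: "a < s" for a
  proof -
    have adjG: "(\<Sum>b<s. adj a b * G $$ (b, c)) = (if a = c then det G else 0)" if c: "c < s" for c
    proof -
      have "(adj_mat G * G) $$ (a, c) = (det G \<cdot>\<^sub>m 1\<^sub>m s) $$ (a, c)" using adj_mat(3)[OF G] by simp
      then show ?thesis
        using a c adj_mat(1)[OF G] G by (simp add: scalar_prod_def adj_def atLeast0LessThan)
    qed
    have "of_int (\<Sum>b<s. adj a b * g b) = (\<Sum>b<s. of_int (adj a b) * (\<Sum>c<s. of_int (G $$ (b, c)) * w (f c)))"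
      by (simp add: Gw)
    also have "\<dots> = (\<Sum>c<s. \<Sum>b<s. of_int (adj a b) * (of_int (G $$ (b, c)) * w (f c)))"
      unfolding sum_distrib_left by (rule sum.swap)
    also have "\<dots> = (\<Sum>c<s. of_int (\<Sum>b<s. adj a b * G $$ (b, c)) * w (f c))"
      by (simp add: sum_distrib_right mult.assoc)
    also have "\<dots> = (\<Sum>c<s. if a = c then of_int (det G) * w (f c) else 0)"
      by (intro sum.cong refl) (simp add: adjG)
    also have "\<dots> = of_int (det G) * w (f a)" using a by simp
    finally show ?thesis by simp
  qed
  \<comment> \<open>The sign of the determinant is absorbed, so that \<open>x\<close> is a positive
    multiple of \<open>w\<close> and has the signs of \<open>y\<close>.\<close>
  define x where "x v = (if v = e then \<bar>det G\<bar> else if v \<in> S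
      then sgn (det G) * (\<Sum>b<s. adj (the_inv_into {..<s} f v) b * g b) else 0)" for v
  have xw: "of_int (x v) = of_int \<bar>det G\<bar> * w v" if v: "v < Z" for v
  proof -
    consider "v = e" | "v \<in> S" "v \<noteq> e" | "v \<notin> S" "v \<noteq> e" by blast
    then show ?thesis
    proof cases
      case 2
      then obtain a where a: "a < s" "v = f a" using f by (auto simp: bij_betw_def)
      then have inv: "the_inv_into {..<s} f v = a" using f by (simp add: the_inv_into_f_f bij_betw_def)
      have "of_int (x v) = of_int (sgn (det G)) * (of_int (det G) * w v)"
        unfolding a(2) cramer[OF a(1)] using 2 inv a(2) by (simp add: x_def)
      also have "\<dots> = of_int \<bar>det G\<bar> * w v" by (simp add: abs_sgn[of "det G"] mult_ac)
      finally show ?thesis .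
    next
      case 3
      then show ?thesis using v by (simp add: x_def S_def supp_def w_def)
    qed (simp add: x_def we)
  qed
  have "(\<Sum>v<Z. M r v * x v) = 0" if r: "r < R" for r
  proof -
    have "real_of_int (\<Sum>v<Z. M r v * x v) = (\<Sum>v<Z. of_int (M r v) * (of_int \<bar>det G\<bar> * (y v / y e)))"
      by (simp add: xw w_def)
    also have "\<dots> = of_int \<bar>det G\<bar> / y e * (\<Sum>v<Z. of_int (M r v) * y v)"
      by (simp add: sum_distrib_left mult_ac)
    also have "\<dots> = 0" using y r by (simp add: sol_def)
    finally show ?thesis by linarith
  qed
  moreover have "0 < x e" using det by (simp add: x_def)
  moreover have "(x v > 0 \<longrightarrow> z v > 0) \<and> (x v < 0 \<longrightarrow> z v < 0)" if v: "v < Z" for v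
  proof -
    have "x v > 0 \<longleftrightarrow> real_of_int (x v) > 0" "x v < 0 \<longleftrightarrow> real_of_int (x v) < 0" by simp_all
    then have "x v > 0 \<longleftrightarrow> y v > 0" "x v < 0 \<longleftrightarrow> y v < 0"
      unfolding xw[OF v] w_def using det ye
      by (simp_all add: zero_less_mult_iff mult_less_0_iff zero_less_divide_iff divide_less_0_iff)
    then show ?thesis using y v by (simp add: sol_def)
  qed
  moreover have "\<bar>x v\<bar> \<le> (int Z * (1 + int R * B * B)) ^ Suc Z" if v: "v < Z" for v
  proof -
    \<comment> \<open>The summand 1 ensures \<open>1 \<le> E\<close>, so that powers with smaller
      exponents can be estimated by larger ones.\<close>
    define E where "E = 1 + int R * B * B"
    have E: "1 \<le> E" using B(2) by (simp add: E_def)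
    have sumR: "\<bar>\<Sum>r<R. M r i * M r j\<bar> \<le> E" if "i < Z" "j < Z" for i j
    proof -
      have "\<bar>\<Sum>r<R. M r i * M r j\<bar> \<le> (\<Sum>r<R. \<bar>M r i * M r j\<bar>)" by (rule sum_abs)
      also have "\<dots> \<le> of_nat (card {..<R}) * (B * B)"
        using B that by (intro sum_bounded_above) (auto simp: abs_mult intro!: mult_mono)
      finally show ?thesis by (simp add: E_def mult.assoc)
    qed
    have ZE: "int Z * E \<ge> 1" using e E mult_mono[of 1 "int Z" 1 E] by simp
    then have ZE0: "0 \<le> (int Z * E) ^ k" for k by (intro zero_le_power) simp
    have det_le: "\<bar>det A\<bar> \<le> (int Z * E) ^ Z" if A: "A \<in> carrier_mat k k" "k \<le> s"
      "\<And>i j. i < k \<Longrightarrow> j < k \<Longrightarrow> \<bar>A $$ (i, j)\<bar> \<le> E" for A :: "int mat" and k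
    proof -
      have "s \<le> Z" unfolding s_def using card_mono[OF _ SZ] by simp
      have "fact k \<le> int Z ^ k"
      proof -
        have "k ^ k \<le> Z ^ k" using A(2) \<open>s \<le> Z\<close> by (intro power_mono) auto
        then have "int (k ^ k) \<le> int (Z ^ k)" unfolding of_nat_le_iff .
        then show ?thesis using fact_le_power[of k, where 'a = int] by simp
      qed
      then have "fact k * E ^ k \<le> int Z ^ k * E ^ k" using E by (intro mult_right_mono) auto
      then have "\<bar>det A\<bar> \<le> (int Z * E) ^ k"
        using abs_det_le[OF A(1,3)] by (simp add: power_mult_distrib)
      also have "\<dots> \<le> (int Z * E) ^ Z"
        using ZE A(2) \<open>s \<le> Z\<close> by (intro power_increasing) auto
      finally show ?thesis .
    qed
    have Gle: "\<bar>G $$ (i, j)\<bar> \<le> E" if "i < s" "j < s" for i j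
      using that sumR[OF fZ fZ] by (simp add: G_def)
    have gle: "\<bar>g b\<bar> \<le> E" if "b < s" for b
      using sumR[OF fZ[OF that] e(1)] by (simp add: g_def)
    have adj_le: "\<bar>adj a b\<bar> \<le> (int Z * E) ^ Z" if ab: "a < s" "b < s" for a b
    proof -
      have "\<bar>adj a b\<bar> = \<bar>det (mat_delete G b a)\<bar>"
        using ab G by (simp add: adj_def adj_mat_def cofactor_def abs_mult power_abs)
      also have "\<dots> \<le> (int Z * E) ^ Z"
      proof (rule det_le)
        show "mat_delete G b a \<in> carrier_mat (s - 1) (s - 1)"
          using mat_delete_carrier[OF G] .
        show "\<bar>mat_delete G b a $$ (i, j)\<bar> \<le> E" if "i < s - 1" "j < s - 1" for i j
          using that G by (auto simp: mat_delete_def intro!: Gle)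
      qed simp
      finally show ?thesis .
    qed
    have main: "\<bar>\<Sum>b<s. adj a b * g b\<bar> \<le> (int Z * E) ^ Suc Z" if a: "a < s" for a
    proof -
      have "\<bar>\<Sum>b<s. adj a b * g b\<bar> \<le> (\<Sum>b<s. \<bar>adj a b * g b\<bar>)" by (rule sum_abs)
      also have "\<dots> \<le> of_nat (card {..<s}) * ((int Z * E) ^ Z * E)"
        using adj_le[OF a] gle ZE by (intro sum_bounded_above) (auto simp: abs_mult ZE0 intro!: mult_mono)
      also have "\<dots> \<le> int Z * ((int Z * E) ^ Z * E)"
        using card_mono[OF _ SZ] E ZE0 by (intro mult_right_mono) (auto simp: s_def)
      finally show ?thesis by (simp add: mult_ac)
    qed
    have D: "\<bar>det G\<bar> \<le> (int Z * E) ^ Suc Z"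
    proof -
      have "\<bar>det G\<bar> \<le> (int Z * E) ^ Z" by (rule det_le[OF G]) (use Gle in auto)
      also have "\<dots> \<le> (int Z * E) ^ Suc Z" using ZE by (intro power_increasing) auto
      finally show ?thesis .
    qed
    have "\<bar>x v\<bar> \<le> (int Z * E) ^ Suc Z"
    proof (cases "v \<in> S \<and> v \<noteq> e")
      case True
      then obtain a where a: "a < s" "v = f a" using f by (auto simp: bij_betw_def)
      then have "the_inv_into {..<s} f v = a" using f by (simp add: the_inv_into_f_f bij_betw_def)
      then show ?thesis using True main[OF a(1)] det by (simp add: x_def abs_mult abs_sgn_eq)
    next
      case False
      moreover have "0 \<le> (int Z * E) ^ Suc Z" using ZE by (intro zero_le_power) simp
      ultimately show ?thesis using D by (auto simp: x_def)
    qed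
    then show ?thesis unfolding E_def .
  qed
  ultimately show ?thesis by blast
qed

section \<open>Optimality of a basis as a linear system\<close>

subsection \<open>Bases\<close>

lemma bij_pick:
  assumes "finite I"
  shows "bij_betw (pick I) {..<card I} I"
proof (rule bij_betw_byWitness[where f' = "\<lambda>j. card {a\<in>I. a < j}"])
  show "\<forall>c\<in>{..<card I}. card {a \<in> I. a < pick I c} = c" by (simp add: card_pick_le)
  show "\<forall>j\<in>I. pick I (card {a \<in> I. a < j}) = j" by (simp add: pick_card_in_set)
  show "pick I ` {..<card I} \<subseteq> I" using pick_in_set_le by auto
  have "card {a \<in> I. a < j} < card I" if "j \<in> I" for j
    by (rule psubset_card_mono[OF assms]) (use that in auto)
  then show "(\<lambda>j. card {a \<in> I. a < j}) ` I \<subseteq> {..<card I}" by auto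
qed

lemma sum_pick:
  assumes "I \<subseteq> {..<n}" "\<And>j. j < n \<Longrightarrow> j \<notin> I \<Longrightarrow> f j = (0 :: 'a :: comm_monoid_add)"
  shows "(\<Sum>j<n. f j) = (\<Sum>c<card I. f (pick I c))"
proof -
  have fin: "finite I" using assms(1) finite_subset by blast
  have "(\<Sum>j<n. f j) = (\<Sum>j\<in>I. f j)" using assms by (intro sum.mono_neutral_right) auto
  then show ?thesis using sum.reindex_bij_betw[OF bij_pick[OF fin], of f] by simp
qed

lemma rank_less:
  fixes I :: "nat set"
  assumes "finite I" "j \<in> I"
  shows "card {a \<in> I. a < j} < card I"
  by (rule psubset_card_mono[OF assms(1)]) (use assms(2) in auto)

lemma submatrix_columns:
  assumes "A \<in> carrier_mat m n" "I \<subseteq> {..<n}"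
  shows "submatrix A UNIV I = mat m (card I) (\<lambda>(i, c). A $$ (i, pick I c))"
proof -
  have "{j. j < n \<and> j \<in> I} = I" "{i. i < m \<and> i \<in> UNIV} = {..<m}" using assms(2) by auto
  then show ?thesis
    using assms(1) unfolding submatrix_def by (auto simp: pick_UNIV intro!: eq_matI)
qed

lemma invertible_matI:
  fixes S :: "'a :: field mat"
  assumes "S \<in> carrier_mat m m" "N \<in> carrier_mat m m" "S * N = 1\<^sub>m m"
  shows "invertible_mat S"
  using assms mat_mult_left_right_inverse[OF assms]
  unfolding invertible_mat_def inverts_mat_def by auto

text \<open>For a fixed \<open>A\<close>, a right inverse padded with zero rows outside
  \<open>I\<close> is described by linear equations in its entries. So invertibility can become part
  of the linear system.\<close>

lemma is_basis_iff:
  fixes A :: "'a :: field mat"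
  assumes A: "A \<in> carrier_mat m n" and I: "I \<subseteq> {..<n}"
  shows "is_basis A I \<longleftrightarrow> card I = m \<and> (\<exists>N. (\<forall>j<n. j \<notin> I \<longrightarrow> (\<forall>r<m. N j r = 0)) \<and>
    (\<forall>i<m. \<forall>r<m. (\<Sum>j<n. A $$ (i, j) * N j r) = (if i = r then 1 else 0)))"
proof
  let ?S = "submatrix A UNIV I"
  have fin: "finite I" using I finite_subset by blast
  note S = submatrix_columns[OF A I]
  {
    assume "is_basis A I"
    then have inv: "invertible_mat ?S" by (simp add: is_basis_def)
    then have m: "card I = m" unfolding invertible_mat_def S by simp
    obtain N where N: "inverts_mat ?S N" "inverts_mat N ?S"
      using invertible_mat_inverse[OF inv] by blast
    have SN: "?S * N = 1\<^sub>m m" using N(1) by (simp add: inverts_mat_def S)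
    have Nc: "N \<in> carrier_mat m m"
    proof (rule carrier_matI)
      show "dim_col N = m" using arg_cong[OF SN, of dim_col] by simp
      have "dim_col (N * ?S) = dim_row N" using N(2) by (simp add: inverts_mat_def)
      then show "dim_row N = m" by (simp add: S m)
    qed
    define N' where "N' j r = (if j \<in> I then N $$ (card {a\<in>I. a < j}, r) else 0)" for j r
    have "(\<Sum>j<n. A $$ (i, j) * N' j r) = (if i = r then 1 else 0)" if ir: "i < m" "r < m" for i r
    proof -
      have "(\<Sum>j<n. A $$ (i, j) * N' j r) = (\<Sum>c<card I. A $$ (i, pick I c) * N' (pick I c) r)"
        by (rule sum_pick[OF I]) (simp add: N'_def)
      also have "\<dots> = (\<Sum>c<m. ?S $$ (i, c) * N $$ (c, r))"
      proof (intro sum.cong)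
        show "A $$ (i, pick I c) * N' (pick I c) r = ?S $$ (i, c) * N $$ (c, r)" if "c \<in> {..<m}" for c
          using that ir m by (simp add: N'_def S card_pick_le pick_in_set_le)
      qed (simp add: m)
      also have "\<dots> = (?S * N) $$ (i, r)"
        using ir Nc by (simp add: S m scalar_prod_def atLeast0LessThan)
      finally show ?thesis using ir by (simp add: SN)
    qed
    moreover have "\<forall>j<n. j \<notin> I \<longrightarrow> (\<forall>r<m. N' j r = 0)" by (simp add: N'_def)
    ultimately show "card I = m \<and> (\<exists>N. (\<forall>j<n. j \<notin> I \<longrightarrow> (\<forall>r<m. N j r = 0)) \<and>
      (\<forall>i<m. \<forall>r<m. (\<Sum>j<n. A $$ (i, j) * N j r) = (if i = r then 1 else 0)))" using m by blast
  }
  assume "card I = m \<and> (\<exists>N. (\<forall>j<n. j \<notin> I \<longrightarrow> (\<forall>r<m. N j r = 0)) \<and>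
    (\<forall>i<m. \<forall>r<m. (\<Sum>j<n. A $$ (i, j) * N j r) = (if i = r then 1 else 0)))"
  then obtain N where m: "card I = m" and N: "\<And>j r. j < n \<Longrightarrow> j \<notin> I \<Longrightarrow> r < m \<Longrightarrow> N j r = 0"
    "\<And>i r. i < m \<Longrightarrow> r < m \<Longrightarrow> (\<Sum>j<n. A $$ (i, j) * N j r) = (if i = r then 1 else 0)" by blast
  define N' where "N' = mat m m (\<lambda>(c, r). N (pick I c) r)"
  have "?S * N' = 1\<^sub>m m"
  proof (rule eq_matI)
    fix i r assume "i < dim_row (1\<^sub>m m :: 'a mat)" "r < dim_col (1\<^sub>m m :: 'a mat)"
    then have ir: "i < m" "r < m" by auto
    have "(?S * N') $$ (i, r) = (\<Sum>c<card I. A $$ (i, pick I c) * N (pick I c) r)"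
      using ir by (simp add: S m N'_def scalar_prod_def atLeast0LessThan)
    also have "\<dots> = (\<Sum>j<n. A $$ (i, j) * N j r)"
      by (rule sum_pick[OF I, symmetric]) (use N(1) ir in simp)
    finally show "(?S * N') $$ (i, r) = 1\<^sub>m m $$ (i, r)" using N(2) ir by simp
  qed (simp_all add: S m N'_def)
  then have "invertible_mat ?S" by (intro invertible_matI[of _ m N']) (simp_all add: S m N'_def)
  then show "is_basis A I" using A I by (simp add: is_basis_def)
qed

text \<open>The basic solution is the only solution of the equations with support in
  \<open>I\<close>, so later it can be an ordinary unknown of the system.\<close>

lemma basic_solution_iff:
  fixes A :: "'a :: field mat"
  assumes A: "A \<in> carrier_mat m n" and \<beta>: "\<beta> \<in> carrier_vec m" and basis: "is_basis A I"
    and y: "y \<in> carrier_vec n"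
  shows "y = basic_solution A \<beta> I \<longleftrightarrow>
    (\<forall>i<m. (\<Sum>j<n. A $$ (i, j) * y $ j) = \<beta> $ i) \<and> (\<forall>j<n. j \<notin> I \<longrightarrow> y $ j = 0)"
proof
  let ?S = "submatrix A UNIV I"
  have I: "I \<subseteq> {..<n}" and inv: "invertible_mat ?S" using basis A by (auto simp: is_basis_def)
  have fin: "finite I" using I finite_subset by blast
  note S = submatrix_columns[OF A I]
  have m: "card I = m" using inv unfolding invertible_mat_def S by simp
  have Sc: "?S \<in> carrier_mat m m" by (simp add: S m)
  obtain N where N: "mat_inverse ?S = Some N" using invertible_mat_inverse[OF inv] by blast
  then have Nc: "N \<in> carrier_mat m m" and SN: "?S * N = 1\<^sub>m m" and NS: "N * ?S = 1\<^sub>m m"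
    using mat_inverse(2)[OF Sc N] by auto
  have sub: "(\<Sum>j<n. A $$ (i, j) * y $ j) = (?S *\<^sub>v vec m (\<lambda>c. y $ pick I c)) $ i"
    if "i < m" "\<forall>j<n. j \<notin> I \<longrightarrow> y $ j = 0" for i and y :: "'a vec"
  proof -
    have "(\<Sum>j<n. A $$ (i, j) * y $ j) = (\<Sum>c<card I. A $$ (i, pick I c) * y $ pick I c)"
      by (rule sum_pick[OF I]) (use that in simp)
    also have "\<dots> = (\<Sum>c<m. ?S $$ (i, c) * vec m (\<lambda>c. y $ pick I c) $ c)"
      using that m by (intro sum.cong) (auto simp: S)
    also have "\<dots> = (?S *\<^sub>v vec m (\<lambda>c. y $ pick I c)) $ i"
      by (rule mult_mat_vec_index[OF Sc, symmetric]) (use that in auto)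
    finally show ?thesis .
  qed
  {
    assume yb: "y = basic_solution A \<beta> I"
    have off: "\<forall>j<n. j \<notin> I \<longrightarrow> y $ j = 0" using A by (simp add: yb basic_solution_def)
    have "vec m (\<lambda>c. y $ pick I c) = N *\<^sub>v \<beta>"
    proof (rule eq_vecI)
      fix c assume "c < dim_vec (N *\<^sub>v \<beta>)"
      then have c: "c < m" using Nc by simp
      then have "pick I c \<in> I" using pick_in_set_le m by simp
      then show "vec m (\<lambda>c. y $ pick I c) $ c = (N *\<^sub>v \<beta>) $ c"
        using c I A m by (auto simp: yb basic_solution_def N card_pick_le)
    qed (use Nc in simp)
    moreover have "?S *\<^sub>v (N *\<^sub>v \<beta>) = \<beta>"
      using assoc_mult_mat_vec[OF Sc Nc \<beta>] SN \<beta> by simp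
    ultimately show "(\<forall>i<m. (\<Sum>j<n. A $$ (i, j) * y $ j) = \<beta> $ i) \<and> (\<forall>j<n. j \<notin> I \<longrightarrow> y $ j = 0)"
      using sub[OF _ off] off by simp
  }
  assume *: "(\<forall>i<m. (\<Sum>j<n. A $$ (i, j) * y $ j) = \<beta> $ i) \<and> (\<forall>j<n. j \<notin> I \<longrightarrow> y $ j = 0)"
  let ?v = "vec m (\<lambda>c. y $ pick I c)"
  have "?S *\<^sub>v ?v = \<beta>"
    using * sub[of _ y] \<beta> Sc by (intro eq_vecI) auto
  then have "N *\<^sub>v \<beta> = N *\<^sub>v (?S *\<^sub>v ?v)" by simp
  also have "\<dots> = ?v" using assoc_mult_mat_vec[OF Nc Sc, of ?v] NS by simp
  finally have v: "N *\<^sub>v \<beta> = ?v" .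
  show "y = basic_solution A \<beta> I"
  proof (rule eq_vecI)
    fix j assume "j < dim_vec (basic_solution A \<beta> I)"
    then have j: "j < n" using A by (simp add: basic_solution_def)
    show "y $ j = basic_solution A \<beta> I $ j"
      using j A * rank_less[OF fin, of j] pick_card_in_set[of j I] m
      by (auto simp: basic_solution_def N v)
  qed (use A y in \<open>simp add: basic_solution_def\<close>)
qed

subsection \<open>Instances as lists of numbers\<close>

record dims =
  nrows :: nat
  ncols :: nat
  npars :: nat
  ncons :: nat

definition offB :: "dims \<Rightarrow> nat" where "offB d = ncols d * nrows d"
definition offb :: "dims \<Rightarrow> nat" where "offb d = offB d + npars d * nrows d"
definition offC :: "dims \<Rightarrow> nat" where "offC d = offb d + nrows d"
definition offc :: "dims \<Rightarrow> nat" where "offc d = offC d + npars d * ncols d"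
definition offD :: "dims \<Rightarrow> nat" where "offD d = offc d + ncols d"
definition offd :: "dims \<Rightarrow> nat" where "offd d = offD d + npars d * ncons d"
definition offEnd :: "dims \<Rightarrow> nat" where "offEnd d = offd d + ncons d"

text \<open>All entries are listed by one function in the order of the encoding, matrices row by
  row; the encoded numbers become a single concatenation.\<close>

definition inst_of :: "dims \<Rightarrow> (nat \<Rightarrow> rat) \<Rightarrow> (nat \<Rightarrow> bool) \<Rightarrow> inst" where
  "inst_of d \<rho> S = \<lparr>
     matA = mat (nrows d) (ncols d) (\<lambda>(i, j). \<rho> (j + ncols d * i)),
     matB = mat (nrows d) (npars d) (\<lambda>(i, j). \<rho> (offB d + (j + npars d * i))),
     vecb = vec (nrows d) (\<lambda>i. \<rho> (offb d + i)),
     matC = mat (ncols d) (npars d) (\<lambda>(i, j). \<rho> (offC d + (j + npars d * i))),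
     vecc = vec (ncols d) (\<lambda>i. \<rho> (offc d + i)),
     matD = mat (ncons d) (npars d) (\<lambda>(i, j). \<rho> (offD d + (j + npars d * i))),
     vecd = vec (ncons d) (\<lambda>i. \<rho> (offd d + i)),
     basis = {j. j < ncols d \<and> S j}\<rparr>"

lemma concat_upt_add:
  "concat (map f [0..<a]) @ concat (map (\<lambda>i. f (a + i)) [0..<b]) = concat (map f [0..<a + b])"
proof -
  have "[0..<a + b] = [0..<a] @ map (\<lambda>i. a + i) [0..<b]"
    using map_add_upt[of a b] upt_add_eq_append[of 0 a b] by (simp add: add.commute)
  then show ?thesis by (simp add: comp_def)
qed

lemma concat_upt_mult:
  "concat (map (\<lambda>i. concat (map (\<lambda>j. f (j + n * i)) [0..<n])) [0..<m]) = concat (map f [0..<n * m])"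
proof (induction m)
  case (Suc m)
  have "concat (map (\<lambda>i. concat (map (\<lambda>j. f (j + n * i)) [0..<n])) [0..<Suc m]) =
      concat (map f [0..<n * m]) @ concat (map (\<lambda>j. f (n * m + j)) [0..<n])"
    using Suc by (simp add: add.commute)
  then show ?case unfolding concat_upt_add by (simp add: add.commute)
qed simp

lemma encode_inst_of:
  "encode (inst_of d \<rho> S) = una (nrows d) @ [False] @ una (ncols d) @ [False] @ una (npars d) @ [False] @
     una (ncons d) @ [False] @ concat (map (\<lambda>x. enc_rat (\<rho> x)) [0..<offEnd d]) @
     concat (map (\<lambda>j. [S j]) [0..<ncols d])"
proof -
  let ?f = "\<lambda>x. enc_rat (\<rho> x)"
  have m: "concat (map (\<lambda>i. concat (map (\<lambda>j. enc_rat (\<rho> (a + (j + k * i)))) [0..<k])) [0..<l]) =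
      concat (map (\<lambda>x. ?f (a + x)) [0..<k * l])" for a k l
    by (rule concat_upt_mult[where f = "\<lambda>x. ?f (a + x)"])
  have b: "map (\<lambda>j. j \<in> {j. j < n \<and> S j}) [0..<n] = concat (map (\<lambda>j. [S j]) [0..<n])" for n
    by (induction n) (auto intro!: map_cong)
  have A: "concat (map (\<lambda>i. concat (map (\<lambda>j. enc_rat (\<rho> (j + k * i))) [0..<k])) [0..<l]) =
      concat (map ?f [0..<k * l])" for k l
    by (rule concat_upt_mult)
  have "concat (map ?f [0..<offEnd d]) =
      concat (map ?f [0..<ncols d * nrows d]) @
      concat (map (\<lambda>x. ?f (offB d + x)) [0..<npars d * nrows d]) @
      concat (map (\<lambda>x. ?f (offb d + x)) [0..<nrows d]) @
      concat (map (\<lambda>x. ?f (offC d + x)) [0..<npars d * ncols d]) @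
      concat (map (\<lambda>x. ?f (offc d + x)) [0..<ncols d]) @
      concat (map (\<lambda>x. ?f (offD d + x)) [0..<npars d * ncons d]) @
      concat (map (\<lambda>x. ?f (offd d + x)) [0..<ncons d])"
    unfolding offEnd_def offd_def offD_def offc_def offC_def offb_def offB_def
      concat_upt_add[symmetric] by simp
  moreover have "dim_m (inst_of d \<rho> S) = nrows d" "dim_n (inst_of d \<rho> S) = ncols d"
    "dim_k (inst_of d \<rho> S) = npars d" "dim_g (inst_of d \<rho> S) = ncons d" by (simp_all add: inst_of_def)
  ultimately show ?thesis
    unfolding encode_def by (simp add: inst_of_def enc_unary_una enc_mat_mat enc_vec_vec m A b)
qed

text \<open>The value 1 at the end of the list supplies the constant coefficients of the linear
  system. The zeros beyond it match the default values of a certificate.\<close>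

lemma inst_of_exists:
  assumes "is_instance P"
  shows "\<exists>d \<rho> S. P = inst_of d \<rho> S \<and> \<rho> (offEnd d) = 1 \<and> (\<forall>x>offEnd d. \<rho> x = 0)"
proof -
  define d where "d = \<lparr>nrows = dim_m P, ncols = dim_n P, npars = dim_k P, ncons = dim_g P\<rparr>"
  have c: "matB P \<in> carrier_mat (nrows d) (npars d)" "vecb P \<in> carrier_vec (nrows d)"
     "matC P \<in> carrier_mat (ncols d) (npars d)" "vecc P \<in> carrier_vec (ncols d)"
     "matD P \<in> carrier_mat (ncons d) (npars d)" "vecd P \<in> carrier_vec (ncons d)"
     "matA P \<in> carrier_mat (nrows d) (ncols d)" "basis P \<subseteq> {..<ncols d}"
    using assms by (auto simp: is_instance_def is_basis_def d_def)
  define \<rho> where "\<rho> x =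
    (if x < offB d then matA P $$ (x div ncols d, x mod ncols d)
     else if x < offb d then matB P $$ ((x - offB d) div npars d, (x - offB d) mod npars d)
     else if x < offC d then vecb P $ (x - offb d)
     else if x < offc d then matC P $$ ((x - offC d) div npars d, (x - offC d) mod npars d)
     else if x < offD d then vecc P $ (x - offc d)
     else if x < offd d then matD P $$ ((x - offD d) div npars d, (x - offD d) mod npars d)
     else if x < offEnd d then vecd P $ (x - offd d) else if x = offEnd d then 1 else 0)" for x
  note offs = offEnd_def offd_def offD_def offc_def offC_def offb_def offB_def
  have le: "offB d \<le> offb d" "offb d \<le> offC d" "offC d \<le> offc d" "offc d \<le> offD d" "offD d \<le> offd d"
    "offd d \<le> offEnd d" by (simp_all add: offs)
  have 1: "matA P = mat (nrows d) (ncols d) (\<lambda>(i, j). \<rho> (j + ncols d * i))"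
  proof (rule eq_matI)
    fix i j assume *: "i < dim_row (mat (nrows d) (ncols d) (\<lambda>(i, j). \<rho> (j + ncols d * i)))"
      "j < dim_col (mat (nrows d) (ncols d) (\<lambda>(i, j). \<rho> (j + ncols d * i)))"
    then have "j + ncols d * i < offB d" unfolding offB_def by (intro less_mixed) auto
    then show "matA P $$ (i, j) = mat (nrows d) (ncols d) (\<lambda>(i, j). \<rho> (j + ncols d * i)) $$ (i, j)"
      using * by (simp add: \<rho>_def)
  qed (use c in auto)
  have 2: "matB P = mat (nrows d) (npars d) (\<lambda>(i, j). \<rho> (offB d + (j + npars d * i)))"
  proof (rule eq_matI)
    fix i j assume "i < dim_row (mat (nrows d) (npars d) (\<lambda>(i, j). \<rho> (offB d + (j + npars d * i))))"
      "j < dim_col (mat (nrows d) (npars d) (\<lambda>(i, j). \<rho> (offB d + (j + npars d * i))))"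
    then have *: "i < nrows d" "j < npars d" by auto
    then have "j + npars d * i < npars d * nrows d" by (intro less_mixed) auto
    then show "matB P $$ (i, j) = mat (nrows d) (npars d) (\<lambda>(i, j). \<rho> (offB d + (j + npars d * i))) $$ (i, j)"
      using * le by (simp add: \<rho>_def offb_def)
  qed (use c in auto)
  have 3: "vecb P = vec (nrows d) (\<lambda>i. \<rho> (offb d + i))"
    using c le by (intro eq_vecI) (auto simp: \<rho>_def offC_def)
  have 4: "matC P = mat (ncols d) (npars d) (\<lambda>(i, j). \<rho> (offC d + (j + npars d * i)))"
  proof (rule eq_matI)
    fix i j assume "i < dim_row (mat (ncols d) (npars d) (\<lambda>(i, j). \<rho> (offC d + (j + npars d * i))))"
      "j < dim_col (mat (ncols d) (npars d) (\<lambda>(i, j). \<rho> (offC d + (j + npars d * i))))"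
    then have *: "i < ncols d" "j < npars d" by auto
    then have "j + npars d * i < npars d * ncols d" by (intro less_mixed) auto
    then show "matC P $$ (i, j) = mat (ncols d) (npars d) (\<lambda>(i, j). \<rho> (offC d + (j + npars d * i))) $$ (i, j)"
      using * le by (simp add: \<rho>_def offc_def)
  qed (use c in auto)
  have 5: "vecc P = vec (ncols d) (\<lambda>i. \<rho> (offc d + i))"
    using c le by (intro eq_vecI) (auto simp: \<rho>_def offD_def)
  have 6: "matD P = mat (ncons d) (npars d) (\<lambda>(i, j). \<rho> (offD d + (j + npars d * i)))"
  proof (rule eq_matI)
    fix i j assume "i < dim_row (mat (ncons d) (npars d) (\<lambda>(i, j). \<rho> (offD d + (j + npars d * i))))"
      "j < dim_col (mat (ncons d) (npars d) (\<lambda>(i, j). \<rho> (offD d + (j + npars d * i))))"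
    then have *: "i < ncons d" "j < npars d" by auto
    then have "j + npars d * i < npars d * ncons d" by (intro less_mixed) auto
    then show "matD P $$ (i, j) = mat (ncons d) (npars d) (\<lambda>(i, j). \<rho> (offD d + (j + npars d * i))) $$ (i, j)"
      using * le by (simp add: \<rho>_def offd_def)
  qed (use c in auto)
  have 7: "vecd P = vec (ncons d) (\<lambda>i. \<rho> (offd d + i))"
    using c le by (intro eq_vecI) (auto simp: \<rho>_def offEnd_def)
  have 8: "basis P = {j. j < ncols d \<and> j \<in> basis P}" using c(8) by auto
  have "P = inst_of d \<rho> (\<lambda>j. j \<in> basis P)"
    unfolding inst_of_def by (rule inst.equality) (simp_all add: 1[symmetric] 2[symmetric] 3[symmetric]
      4[symmetric] 5[symmetric] 6[symmetric] 7[symmetric] 8[symmetric])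
  moreover have "\<rho> (offEnd d) = 1" "\<forall>x>offEnd d. \<rho> x = 0" using le by (auto simp: \<rho>_def)
  ultimately show ?thesis by blast
qed

subsection \<open>The system\<close>

text \<open>The columns belong to the parameters \<open>x\<close>, the primal solution \<open>y\<close>, the dual solution \<open>p\<close>, the
  slack variables of the dual and of \<open>D x \<le> d\<close>, an inverse of the basis matrix, and the constant 1.
  A coefficient \<open>\<plusminus>\<rho> i\<close> is coded by a number, 0 stands for the coefficient 0, and \<open>\<rho> (offEnd d)\<close> is 1.\<close>

definition varP :: "dims \<Rightarrow> nat" where "varP d = npars d + ncols d"
definition varS :: "dims \<Rightarrow> nat" where "varS d = varP d + nrows d"
definition varT :: "dims \<Rightarrow> nat" where "varT d = varS d + ncols d"
definition varN :: "dims \<Rightarrow> nat" where "varN d = varT d + ncons d"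
definition unit_col :: "dims \<Rightarrow> nat" where "unit_col d = varN d + ncols d * nrows d"
definition sys_cols :: "dims \<Rightarrow> nat" where "sys_cols d = Suc (unit_col d)"
definition rowS :: "dims \<Rightarrow> nat" where "rowS d = nrows d + ncons d"
definition rowN :: "dims \<Rightarrow> nat" where "rowN d = rowS d + ncols d"
definition sys_rows :: "dims \<Rightarrow> nat" where "sys_rows d = rowN d + nrows d * nrows d"

definition plus_code :: "nat \<Rightarrow> nat" where "plus_code i = Suc (2 * i)"
definition minus_code :: "nat \<Rightarrow> nat" where "minus_code i = Suc (Suc (2 * i))"

definition coef :: "dims \<Rightarrow> nat \<Rightarrow> nat \<Rightarrow> nat" where
  "coef d r v =
    (if r < nrows d then
       if v < npars d then minus_code (offB d + (v + npars d * r))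
       else if v < varP d then plus_code ((v - npars d) + ncols d * r)
       else if v = unit_col d then minus_code (offb d + r) else 0
     else if r < rowS d then
       if v < npars d then plus_code (offD d + (v + npars d * (r - nrows d)))
       else if v = varT d + (r - nrows d) then plus_code (offEnd d)
       else if v = unit_col d then minus_code (offd d + (r - nrows d)) else 0
     else if r < rowN d then
       if v < npars d then minus_code (offC d + (v + npars d * (r - rowS d)))
       else if varP d \<le> v \<and> v < varS d then plus_code ((r - rowS d) + ncols d * (v - varP d))
       else if v = varS d + (r - rowS d) then plus_code (offEnd d)
       else if v = unit_col d then minus_code (offc d + (r - rowS d)) else 0
     else
       if varN d \<le> v \<and> v < unit_col d \<and> (v - varN d) div ncols d = (r - rowN d) div nrows d
       then plus_code ((v - varN d) mod ncols d + ncols d * ((r - rowN d) mod nrows d))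
       else if v = unit_col d \<and> (r - rowN d) mod nrows d = (r - rowN d) div nrows d
       then minus_code (offEnd d) else 0)"

definition cval :: "(nat \<Rightarrow> 'a :: comm_ring_1) \<Rightarrow> nat \<Rightarrow> 'a" where
  "cval \<rho> c = (if c = 0 then 0 else if odd c then \<rho> ((c - 1) div 2) else - \<rho> ((c - 1) div 2))"

lemma cval_simps [simp]: "cval \<rho> 0 = 0" "cval \<rho> (plus_code i) = \<rho> i" "cval \<rho> (minus_code i) = - \<rho> i"
  by (simp_all add: cval_def plus_code_def minus_code_def)

lemma sum_mult_index: "sum f {..<n * m :: nat} = (\<Sum>r<m. \<Sum>j<n. f (j + n * r))"
proof (induction m)
  case (Suc m)
  have "n * Suc m = n * m + n" by simp
  then show ?case using Suc by (simp only: sum_lessThan_add sum.lessThan_Suc) (simp add: add.commute)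
qed simp

lemma sum_sys_cols:
  "sum f {..<sys_cols d} = (\<Sum>l<npars d. f l) + (\<Sum>j<ncols d. f (npars d + j)) + (\<Sum>i<nrows d. f (varP d + i))
    + (\<Sum>j<ncols d. f (varS d + j)) + (\<Sum>i<ncons d. f (varT d + i))
    + (\<Sum>r<nrows d. \<Sum>j<ncols d. f (varN d + (j + ncols d * r))) + (f (unit_col d) :: 'a :: comm_monoid_add)"
  unfolding sys_cols_def sum.lessThan_Suc unit_col_def varN_def varT_def varS_def varP_def sum_lessThan_add
    sum_mult_index ..

definition sys_row :: "dims \<Rightarrow> (nat \<Rightarrow> 'a :: comm_ring_1) \<Rightarrow> (nat \<Rightarrow> 'a) \<Rightarrow> nat \<Rightarrow> 'a" where
  "sys_row d \<rho> z r = (\<Sum>v<sys_cols d. cval \<rho> (coef d r v) * z v)"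

context
  fixes d :: dims and \<rho> z :: "nat \<Rightarrow> 'a :: comm_ring_1"
begin

lemma var_le: "npars d \<le> varP d" "varP d \<le> varS d" "varS d \<le> varT d" "varT d \<le> varN d" "varN d \<le> unit_col d"
  by (simp_all add: varP_def varS_def varT_def varN_def unit_col_def)

lemma var_less:
  "j < ncols d \<Longrightarrow> npars d + j < varP d" "i < nrows d \<Longrightarrow> varP d + i < varS d"
  "j < ncols d \<Longrightarrow> varS d + j < varT d" "l < ncons d \<Longrightarrow> varT d + l < varN d"
  "j < ncols d \<Longrightarrow> i < nrows d \<Longrightarrow> varN d + (j + ncols d * i) < unit_col d"
  using less_mixed[of j "ncols d" i "nrows d"]
  by (simp_all add: varP_def varS_def varT_def varN_def unit_col_def)

text \<open>The four kinds of rows, homogenised by \<open>z (unit_col d)\<close>, are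
  \<open>A y = B x + b\<close> here, followed by \<open>D x + t = d\<close>,
  \<open>A^T p + s = C x + c\<close> and \<open>A N = 1\<close>, where \<open>s\<close> and
  \<open>t\<close> are slacks.\<close>

lemma sys_row_primal:
  assumes "i < nrows d"
  shows "sys_row d \<rho> z i = (\<Sum>j<ncols d. \<rho> (j + ncols d * i) * z (npars d + j))
    - (\<Sum>l<npars d. \<rho> (offB d + (l + npars d * i)) * z l) - \<rho> (offb d + i) * z (unit_col d)"
proof -
  have "coef d i l = minus_code (offB d + (l + npars d * i))" if "l < npars d" for l
    using assms that by (simp add: coef_def)
  moreover have "coef d i (npars d + j) = plus_code (j + ncols d * i)" if "j < ncols d" for j
    using assms var_less(1)[OF that] by (simp add: coef_def)
  moreover have "coef d i v = 0" if "varP d \<le> v" "v < unit_col d" for v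
    using assms that var_le by (simp add: coef_def)
  moreover have "coef d i (unit_col d) = minus_code (offb d + i)"
    using assms var_le by (simp add: coef_def)
  moreover have "varP d + i < unit_col d" if "i < nrows d" for i using var_less(2)[OF that] var_le by simp
  moreover have "varS d + j < unit_col d" if "j < ncols d" for j using var_less(3)[OF that] var_le by simp
  moreover have "varT d + l < unit_col d" if "l < ncons d" for l using var_less(4)[OF that] var_le by simp
  ultimately show ?thesis
    unfolding sys_row_def sum_sys_cols using var_le var_less(5)
    by (simp add: sum_negf trans_le_add1)
qed

lemma sys_row_cons:
  assumes "i < ncons d"
  shows "sys_row d \<rho> z (nrows d + i) = (\<Sum>l<npars d. \<rho> (offD d + (l + npars d * i)) * z l)
    + \<rho> (offEnd d) * z (varT d + i) - \<rho> (offd d + i) * z (unit_col d)"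
proof -
  have r: "nrows d + i < rowS d" using assms by (simp add: rowS_def)
  have "coef d (nrows d + i) l = plus_code (offD d + (l + npars d * i))" if "l < npars d" for l
    using r that by (simp add: coef_def)
  moreover have "coef d (nrows d + i) v = 0" if "npars d \<le> v" "v < unit_col d" "v \<noteq> varT d + i" for v
    using r that by (simp add: coef_def)
  moreover have "coef d (nrows d + i) (unit_col d) = minus_code (offd d + i)"
    using r var_le var_less(4)[OF assms] by (simp add: coef_def)
  moreover have T: "cval \<rho> (coef d (nrows d + i) (varT d + l)) * z (varT d + l) =
      (if l = i then \<rho> (offEnd d) * z (varT d + l) else 0)" if "l < ncons d" for l
    using r that var_le var_less(4)[OF that] by (simp add: coef_def)
  moreover have "npars d + j < unit_col d" "npars d + j \<noteq> varT d + i" if "j < ncols d" for j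
    using var_less(1)[OF that] var_le by auto
  moreover have "varP d + l < unit_col d" "varP d + l \<noteq> varT d + i" if "l < nrows d" for l
    using var_less(2)[OF that] var_le by auto
  moreover have "varS d + j < unit_col d" "varS d + j \<noteq> varT d + i" if "j < ncols d" for j
    using var_less(3)[OF that] var_le by auto
  moreover have "varN d + x \<noteq> varT d + i" for x using var_less(4)[OF assms] by simp
  ultimately show ?thesis
    unfolding sys_row_def sum_sys_cols using var_le var_less(5) assms
    by (simp add: trans_le_add1)
qed

lemma sys_row_dual:
  assumes "j < ncols d"
  shows "sys_row d \<rho> z (rowS d + j) = (\<Sum>i<nrows d. \<rho> (j + ncols d * i) * z (varP d + i))
    + \<rho> (offEnd d) * z (varS d + j) - (\<Sum>l<npars d. \<rho> (offC d + (l + npars d * j)) * z l)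
    - \<rho> (offc d + j) * z (unit_col d)"
proof -
  have r: "\<not> rowS d + j < nrows d" "rowS d + j < rowN d" using assms by (simp_all add: rowS_def rowN_def)
  have "coef d (rowS d + j) l = minus_code (offC d + (l + npars d * j))" if "l < npars d" for l
    using r that by (simp add: coef_def)
  moreover have "coef d (rowS d + j) (varP d + i) = plus_code (j + ncols d * i)" if "i < nrows d" for i
    using r var_less(2)[OF that] var_le by (simp add: coef_def)
  moreover have "coef d (rowS d + j) v = 0" if "npars d \<le> v" "v < unit_col d" "\<not> (varP d \<le> v \<and> v < varS d)"
    "v \<noteq> varS d + j" for v
    using r that by (auto simp: coef_def)
  moreover have "coef d (rowS d + j) (unit_col d) = minus_code (offc d + j)"
    using r var_le var_less(3)[OF assms] by (simp add: coef_def)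
  moreover have "cval \<rho> (coef d (rowS d + j) (varS d + l)) * z (varS d + l) =
      (if l = j then \<rho> (offEnd d) * z (varS d + l) else 0)" if "l < ncols d" for l
    using r that var_le var_less(3)[OF that] by (simp add: coef_def)
  moreover have "npars d + l < unit_col d" "npars d + l \<noteq> varS d + j" "\<not> varP d \<le> npars d + l" if "l < ncols d" for l
    using var_less(1)[OF that] var_le by auto
  moreover have "varT d + l < unit_col d" if "l < ncons d" for l
    using var_less(4)[OF that] var_le by auto
  moreover have "varT d + x \<noteq> varS d + j" "varN d + x \<noteq> varS d + j" "\<not> varT d + x < varS d" "\<not> varN d + x < varS d" for x
    using var_less(3)[OF assms] var_le by auto
  ultimately show ?thesis
    unfolding sys_row_def sum_sys_cols using var_le var_less(5) assms
    by (simp add: sum_negf trans_le_add1)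
qed

lemma sys_row_inverse:
  assumes "i < nrows d" "r < nrows d"
  shows "sys_row d \<rho> z (rowN d + (i + nrows d * r)) =
    (\<Sum>j<ncols d. \<rho> (j + ncols d * i) * z (varN d + (j + ncols d * r)))
    - (if i = r then \<rho> (offEnd d) * z (unit_col d) else 0)"
proof -
  let ?q = "rowN d + (i + nrows d * r)"
  have r: "\<not> ?q < nrows d" "\<not> ?q < rowS d" "\<not> ?q < rowN d" by (simp_all add: rowS_def rowN_def)
  have dm: "(?q - rowN d) div nrows d = r" "(?q - rowN d) mod nrows d = i"
    using assms by (simp_all add: mod_div_mixed)
  have 0: "coef d ?q v = 0" if "v < varN d" for v
    unfolding coef_def dm using r that var_le by simp
  have N: "cval \<rho> (coef d ?q (varN d + (j + ncols d * s))) * z' =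
      (if s = r then \<rho> (j + ncols d * i) * z' else 0)" if "j < ncols d" "s < nrows d" for j s z'
  proof -
    have "(varN d + (j + ncols d * s) - varN d) div ncols d = s" "(varN d + (j + ncols d * s) - varN d) mod ncols d = j"
      using that by (simp_all add: mod_div_mixed)
    then show ?thesis
      unfolding coef_def dm using r var_less(5)[OF that] by simp
  qed
  have e: "cval \<rho> (coef d ?q (unit_col d)) * z' = (if i = r then - \<rho> (offEnd d) * z' else 0)" for z'
    unfolding coef_def dm using r by simp
  have lt: "npars d + j < varN d" "varS d + j < varN d" if "j < ncols d" for j
    using var_less(1,3)[OF that] var_le by simp_all
  have "(\<Sum>s<nrows d. \<Sum>j<ncols d. if s = r then \<rho> (j + ncols d * i) * z (varN d + (j + ncols d * s)) else 0)
      = (\<Sum>s<nrows d. if s = r then (\<Sum>j<ncols d. \<rho> (j + ncols d * i) * z (varN d + (j + ncols d * s))) else 0)"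
    by (intro sum.cong) auto
  then have "(\<Sum>s<nrows d. \<Sum>j<ncols d. cval \<rho> (coef d ?q (varN d + (j + ncols d * s))) * z (varN d + (j + ncols d * s)))
      = (\<Sum>j<ncols d. \<rho> (j + ncols d * i) * z (varN d + (j + ncols d * r)))"
    using assms by (simp add: N)
  moreover have "l < npars d \<Longrightarrow> l < varN d" "i < nrows d \<Longrightarrow> varP d + i < varN d" "l < ncons d \<Longrightarrow> varT d + l < varN d" for l i
    using var_less(2)[of i] var_less(4)[of l] var_le by simp_all
  ultimately show ?thesis
    unfolding sys_row_def sum_sys_cols e using lt by (simp add: 0)
qed

end

lemma all_less_add: "(\<forall>r<a + b :: nat. Q r) \<longleftrightarrow> (\<forall>r<a. Q r) \<and> (\<forall>j<b. Q (a + j))"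
  by (metis add_diff_inverse_nat nat_add_left_cancel_less trans_less_add1)

lemma all_less_mult: "(\<forall>r<n * m :: nat. Q r) \<longleftrightarrow> (\<forall>i<n. \<forall>r<m. Q (i + n * r))"
proof (intro iffI allI impI)
  fix r assume *: "\<forall>i<n. \<forall>r<m. Q (i + n * r)" "r < n * m"
  then have "r mod n < n" by (cases n) auto
  moreover have "r div n < m" using *(2) by (simp add: less_mult_imp_div_less mult.commute)
  ultimately have "Q (r mod n + n * (r div n))" using *(1) by blast
  then show "Q r" by simp
qed (blast intro: less_mixed)

lemma all_sys_rows:
  "(\<forall>r<sys_rows d. Q r) \<longleftrightarrow> (\<forall>i<nrows d. Q i) \<and> (\<forall>i<ncons d. Q (nrows d + i)) \<and>
    (\<forall>j<ncols d. Q (rowS d + j)) \<and> (\<forall>i<nrows d. \<forall>r<nrows d. Q (rowN d + (i + nrows d * r)))"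
  unfolding sys_rows_def rowN_def rowS_def all_less_add all_less_mult by blast

definition optimality_witness ::
    "dims \<Rightarrow> (nat \<Rightarrow> real) \<Rightarrow> (nat \<Rightarrow> bool) \<Rightarrow> (nat \<Rightarrow> real) \<Rightarrow> (nat \<Rightarrow> real) \<Rightarrow> (nat \<Rightarrow> real) \<Rightarrow> bool" where
  "optimality_witness d \<rho> S x y p \<longleftrightarrow>
    (\<forall>i<ncons d. (\<Sum>l<npars d. \<rho> (offD d + (l + npars d * i)) * x l) \<le> \<rho> (offd d + i)) \<and>
    (\<forall>i<nrows d. (\<Sum>j<ncols d. \<rho> (j + ncols d * i) * y j) =
      (\<Sum>l<npars d. \<rho> (offB d + (l + npars d * i)) * x l) + \<rho> (offb d + i)) \<and>
    (\<forall>j<ncols d. 0 \<le> y j \<and> (\<not> S j \<longrightarrow> y j = 0)) \<and>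
    (\<forall>j<ncols d. (\<Sum>i<nrows d. \<rho> (j + ncols d * i) * p i) \<le>
        (\<Sum>l<npars d. \<rho> (offC d + (l + npars d * j)) * x l) + \<rho> (offc d + j) \<and>
      (y j \<noteq> 0 \<longrightarrow> (\<Sum>i<nrows d. \<rho> (j + ncols d * i) * p i) =
        (\<Sum>l<npars d. \<rho> (offC d + (l + npars d * j)) * x l) + \<rho> (offc d + j)))"

text \<open>The basis determines \<open>y\<close>, so quantifying over \<open>y\<close>
  existentially changes nothing, and duality replaces optimality by the existence of
  \<open>p\<close>. The condition on the basis does not depend on \<open>x\<close> and can be pulled
  out.\<close>

lemma optimistic_inst_of:
  fixes \<rho> :: "nat \<Rightarrow> rat"
  defines "\<rho>' \<equiv> \<lambda>x. real_of_rat (\<rho> x)"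
  shows "optimistic_BILFP (inst_of d \<rho> S) \<longleftrightarrow>
    is_basis (mat (nrows d) (ncols d) (\<lambda>(i, j). \<rho>' (j + ncols d * i))) {j. j < ncols d \<and> S j} \<and>
    (\<exists>x y p. optimality_witness d \<rho>' S x y p)"
    (is "_ \<longleftrightarrow> is_basis ?A ?I \<and> _")
proof -
  let ?P = "inst_of d \<rho> S"
  define isD where "isD x \<longleftrightarrow> (\<forall>i<ncons d. (\<Sum>l<npars d. \<rho>' (offD d + (l + npars d * i)) * x l) \<le> \<rho>' (offd d + i))" for x
  define isE where "isE x y \<longleftrightarrow> (\<forall>i<nrows d. (\<Sum>j<ncols d. \<rho>' (j + ncols d * i) * y j) =
      (\<Sum>l<npars d. \<rho>' (offB d + (l + npars d * i)) * x l) + \<rho>' (offb d + i))" for x y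
  define isN where "isN y \<longleftrightarrow> (\<forall>j<ncols d. 0 \<le> y j \<and> (\<not> S j \<longrightarrow> y j = 0))" for y :: "nat \<Rightarrow> real"
  define isO where "isO x y p \<longleftrightarrow> (\<forall>j<ncols d. (\<Sum>i<nrows d. \<rho>' (j + ncols d * i) * p i) \<le>
        (\<Sum>l<npars d. \<rho>' (offC d + (l + npars d * j)) * x l) + \<rho>' (offc d + j) \<and>
      (y j \<noteq> 0 \<longrightarrow> (\<Sum>i<nrows d. \<rho>' (j + ncols d * i) * p i) =
        (\<Sum>l<npars d. \<rho>' (offC d + (l + npars d * j)) * x l) + \<rho>' (offc d + j)))"
    for x y p :: "nat \<Rightarrow> real"
  have A: "real_mat (matA ?P) = ?A" by (auto simp: inst_of_def \<rho>'_def intro!: eq_matI)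
  have Ac: "?A \<in> carrier_mat (nrows d) (ncols d)" by simp
  have I: "basis ?P = ?I" by (simp add: inst_of_def)
  have Aij: "?A $$ (i, j) = \<rho>' (j + ncols d * i)" if "i < nrows d" "j < ncols d" for i j
    using that by simp
  define \<beta> where "\<beta> x = real_mat (matB ?P) *\<^sub>v x + real_vec (vecb ?P)" for x
  define q where "q x = real_mat (matC ?P) *\<^sub>v x + real_vec (vecc ?P)" for x
  have \<beta>c: "\<beta> x \<in> carrier_vec (nrows d)" for x
    by (rule carrier_vecI) (simp add: \<beta>_def inst_of_def)
  have \<beta>i: "\<beta> x $ i = (\<Sum>l<npars d. \<rho>' (offB d + (l + npars d * i)) * x $ l) + \<rho>' (offb d + i)"
    if "x \<in> carrier_vec (npars d)" "i < nrows d" for x i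
  proof -
    have "(real_mat (matB ?P) *\<^sub>v x) $ i = (\<Sum>l<npars d. real_mat (matB ?P) $$ (i, l) * x $ l)"
      using that by (intro mult_mat_vec_index) (auto simp: inst_of_def)
    then show ?thesis using that by (simp add: \<beta>_def inst_of_def \<rho>'_def)
  qed
  have qj: "q x $ j = (\<Sum>l<npars d. \<rho>' (offC d + (l + npars d * j)) * x $ l) + \<rho>' (offc d + j)"
    if "x \<in> carrier_vec (npars d)" "j < ncols d" for x j
  proof -
    have "(real_mat (matC ?P) *\<^sub>v x) $ j = (\<Sum>l<npars d. real_mat (matC ?P) $$ (j, l) * x $ l)"
      using that by (intro mult_mat_vec_index) (auto simp: inst_of_def)
    then show ?thesis using that by (simp add: q_def inst_of_def \<rho>'_def)
  qed
  have poly: "x \<in> polyhedron (real_mat (matD ?P)) (real_vec (vecd ?P)) \<longleftrightarrow>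
      x \<in> carrier_vec (npars d) \<and> isD (\<lambda>l. x $ l)" for x
  proof (cases "x \<in> carrier_vec (npars d)")
    case True
    have "(real_mat (matD ?P) *\<^sub>v x) $ i = (\<Sum>l<npars d. \<rho>' (offD d + (l + npars d * i)) * x $ l)"
      if "i < ncons d" for i
    proof -
      have "(real_mat (matD ?P) *\<^sub>v x) $ i = (\<Sum>l<npars d. real_mat (matD ?P) $$ (i, l) * x $ l)"
        using that True by (intro mult_mat_vec_index) (auto simp: inst_of_def)
      then show ?thesis using that by (simp add: inst_of_def \<rho>'_def)
    qed
    then show ?thesis
      using True by (auto simp: isD_def polyhedron_def less_eq_vec_def inst_of_def \<rho>'_def)
  qed (simp add: polyhedron_def inst_of_def)
  have opt: "lp_optimal (q x) ?A (\<beta> x) (basic_solution ?A (\<beta> x) ?I) \<longleftrightarrow>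
      (\<exists>y p. isE (\<lambda>l. x $ l) y \<and> isN y \<and> isO (\<lambda>l. x $ l) y p)"
    if x: "x \<in> carrier_vec (npars d)" and basis: "is_basis ?A ?I" for x
  proof
    let ?y = "basic_solution ?A (\<beta> x) ?I"
    have yc: "?y \<in> carrier_vec (ncols d)" by (simp add: basic_solution_def)
    note sol = basic_solution_iff[OF Ac \<beta>c basis]
    note feas = lp_feasible_iff[OF Ac \<beta>c]
    {
      assume o: "lp_optimal (q x) ?A (\<beta> x) ?y"
      then have f: "lp_feasible ?A (\<beta> x) ?y" by (simp add: lp_optimal_def)
      obtain p where p: "\<forall>j<ncols d. (\<Sum>i<nrows d. ?A $$ (i, j) * p i) \<le> q x $ j \<and>
          (?y $ j \<noteq> 0 \<longrightarrow> (\<Sum>i<nrows d. ?A $$ (i, j) * p i) = q x $ j)"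
        using o unfolding lp_optimal_iff[OF Ac \<beta>c f] by blast
      have "isE (\<lambda>l. x $ l) (\<lambda>j. ?y $ j)"
        using f unfolding feas isE_def by (simp add: \<beta>i[OF x])
      moreover have "isN (\<lambda>j. ?y $ j)"
        using f sol[OF yc] unfolding feas isN_def by auto
      moreover have "isO (\<lambda>l. x $ l) (\<lambda>j. ?y $ j) p" using p unfolding isO_def by (simp add: qj[OF x])
      ultimately show "\<exists>y p. isE (\<lambda>l. x $ l) y \<and> isN y \<and> isO (\<lambda>l. x $ l) y p"
        by (intro exI[of _ "\<lambda>j. ?y $ j"] exI[of _ p]) blast
    }
    assume "\<exists>y p. isE (\<lambda>l. x $ l) y \<and> isN y \<and> isO (\<lambda>l. x $ l) y p"
    then obtain y p where E: "isE (\<lambda>l. x $ l) y" and N: "isN y" and O: "isO (\<lambda>l. x $ l) y p" by blast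
    have vc: "vec (ncols d) y \<in> carrier_vec (ncols d)" by simp
    have "vec (ncols d) y = ?y"
      unfolding sol[OF vc] using E N unfolding isE_def isN_def by (simp add: \<beta>i[OF x])
    moreover have f: "lp_feasible ?A (\<beta> x) (vec (ncols d) y)"
      unfolding feas using E N unfolding isE_def isN_def by (simp add: \<beta>i[OF x])
    moreover have "lp_optimal (q x) ?A (\<beta> x) (vec (ncols d) y)"
      unfolding lp_optimal_iff[OF Ac \<beta>c f]
      using O unfolding isO_def by (intro exI[of _ p]) (simp add: qj[OF x])
    ultimately show "lp_optimal (q x) ?A (\<beta> x) ?y" by simp
  qed
  have cong: "isD (\<lambda>l. vec (npars d) x $ l) \<longleftrightarrow> isD x" "isE (\<lambda>l. vec (npars d) x $ l) y \<longleftrightarrow> isE x y"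
    "isO (\<lambda>l. vec (npars d) x $ l) y p \<longleftrightarrow> isO x y p" for x y p
    unfolding isD_def isE_def isO_def by simp_all
  have "optimistic_BILFP ?P \<longleftrightarrow> (\<exists>x. x \<in> carrier_vec (npars d) \<and> isD (\<lambda>l. x $ l) \<and> is_basis ?A ?I \<and>
      lp_optimal (q x) ?A (\<beta> x) (basic_solution ?A (\<beta> x) ?I))"
    unfolding optimistic_BILFP_def optimal_basis_def Bex_def poly A I \<beta>_def[symmetric] q_def[symmetric]
    by blast
  also have "\<dots> \<longleftrightarrow> is_basis ?A ?I \<and> (\<exists>x. x \<in> carrier_vec (npars d) \<and> isD (\<lambda>l. x $ l) \<and>
      (\<exists>y p. isE (\<lambda>l. x $ l) y \<and> isN y \<and> isO (\<lambda>l. x $ l) y p))"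
    using opt by blast
  also have "\<dots> \<longleftrightarrow> is_basis ?A ?I \<and> (\<exists>x y p. isD x \<and> isE x y \<and> isN y \<and> isO x y p)"
  proof (intro conj_cong iffI)
    assume "\<exists>x y p. isD x \<and> isE x y \<and> isN y \<and> isO x y p"
    then obtain x y p where *: "isD x" "isE x y" "isN y" "isO x y p" by blast
    have "vec (npars d) x \<in> carrier_vec (npars d)" by simp
    moreover have "isD (\<lambda>l. vec (npars d) x $ l)" unfolding cong(1) by (rule *(1))
    moreover have "isE (\<lambda>l. vec (npars d) x $ l) y" unfolding cong(2) by (rule *(2))
    moreover have "isO (\<lambda>l. vec (npars d) x $ l) y p" unfolding cong(3) by (rule *(4))
    ultimately show "\<exists>x. x \<in> carrier_vec (npars d) \<and> isD (\<lambda>l. x $ l) \<and>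
      (\<exists>y p. isE (\<lambda>l. x $ l) y \<and> isN y \<and> isO (\<lambda>l. x $ l) y p)" using *(3) by blast
  qed blast+
  finally show ?thesis unfolding isD_def isE_def isN_def isO_def optimality_witness_def .
qed

section \<open>The verifier\<close>

text \<open>The positive part of a numerator of the system; with \<open>p\<close> and
  \<open>q\<close> exchanged it is the negative part.\<close>

definition num :: "dims \<Rightarrow> (nat \<Rightarrow> nat) \<Rightarrow> (nat \<Rightarrow> nat) \<Rightarrow> nat \<Rightarrow> nat \<Rightarrow> nat" where
  "num d p q r v = (if coef d r v = 0 then 0 else if coef d r v mod 2 = 1 then p ((coef d r v - 1) div 2)
     else q ((coef d r v - 1) div 2))"

definition den :: "dims \<Rightarrow> (nat \<Rightarrow> nat) \<Rightarrow> nat \<Rightarrow> nat \<Rightarrow> nat" where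
  "den d b r v = (if coef d r v = 0 then 1 else b ((coef d r v - 1) div 2))"

text \<open>A row is cleared of denominators by the product of all of them; for column
  \<open>v\<close> this factor remains besides its own denominator.\<close>

definition other_dens :: "dims \<Rightarrow> (nat \<Rightarrow> nat) \<Rightarrow> nat \<Rightarrow> nat \<Rightarrow> nat" where
  "other_dens d b r v = (\<Prod>u<sys_cols d. if u = v then 1 else den d b r u)"

text \<open>A copy of equality that marks comparisons of numbers given in binary; the other equations between
  numbers compare numbers given in unary.\<close>

definition bin_eq :: "nat \<Rightarrow> nat \<Rightarrow> bool" where
  "bin_eq m n \<longleftrightarrow> m = n"

text \<open>Positive contributions are collected on one side and negative ones on the other, so the
  test needs neither subtraction nor signed numbers.\<close>

definition row_holds :: "dims \<Rightarrow> (nat \<Rightarrow> nat) \<Rightarrow> (nat \<Rightarrow> nat) \<Rightarrow> (nat \<Rightarrow> nat) \<Rightarrow> (nat \<Rightarrow> nat) \<Rightarrow> (nat \<Rightarrow> nat) \<Rightarrow> nat \<Rightarrow> bool" where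
  "row_holds d p q b zp zn r \<longleftrightarrow>
    bin_eq (\<Sum>v<sys_cols d. (num d p q r v * zp v + num d q p r v * zn v) * other_dens d b r v)
           (\<Sum>v<sys_cols d. (num d p q r v * zn v + num d q p r v * zp v) * other_dens d b r v)"

definition int_coef :: "dims \<Rightarrow> (nat \<Rightarrow> nat) \<Rightarrow> (nat \<Rightarrow> nat) \<Rightarrow> (nat \<Rightarrow> nat) \<Rightarrow> nat \<Rightarrow> nat \<Rightarrow> int" where
  "int_coef d p q b r v = (int (num d p q r v) - int (num d q p r v)) * int (other_dens d b r v)"

lemma row_holds_iff:
  "row_holds d p q b zp zn r \<longleftrightarrow> (\<Sum>v<sys_cols d. int_coef d p q b r v * (int (zp v) - int (zn v))) = 0"
proof -
  have "row_holds d p q b zp zn r \<longleftrightarrow>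
      int (\<Sum>v<sys_cols d. (num d p q r v * zp v + num d q p r v * zn v) * other_dens d b r v) -
      int (\<Sum>v<sys_cols d. (num d p q r v * zn v + num d q p r v * zp v) * other_dens d b r v) = 0"
    unfolding row_holds_def bin_eq_def by linarith
  also have "int (\<Sum>v<sys_cols d. (num d p q r v * zp v + num d q p r v * zn v) * other_dens d b r v) -
      int (\<Sum>v<sys_cols d. (num d p q r v * zn v + num d q p r v * zp v) * other_dens d b r v) =
      (\<Sum>v<sys_cols d. int_coef d p q b r v * (int (zp v) - int (zn v)))"
    unfolding of_nat_sum sum_subtractf[symmetric] int_coef_def
    by (intro sum.cong refl) (simp add: algebra_simps)
  finally show ?thesis .
qed

text \<open>Used over the rationals to check a certificate, and over the reals to pass from a real
  solution to an integral system.\<close>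

lemma int_coef_sys_row:
  fixes z :: "nat \<Rightarrow> 'a :: field_char_0"
  assumes b: "\<And>x. 0 < b x" and \<rho>: "\<And>x. \<rho> x = (of_nat (p x) - of_nat (q x)) / of_nat (b x)"
  shows "(\<Sum>v<sys_cols d. of_int (int_coef d p q b r v) * z v) =
    of_nat (\<Prod>u<sys_cols d. den d b r u) * sys_row d \<rho> z r"
proof -
  have "of_int (int_coef d p q b r v) = of_nat (\<Prod>u<sys_cols d. den d b r u) * cval \<rho> (coef d r v)"
    if v: "v < sys_cols d" for v
  proof -
    have "(\<Prod>u<sys_cols d. den d b r u) = den d b r v * other_dens d b r v"
    proof -
      have "(\<Prod>u<sys_cols d. den d b r u) = den d b r v * (\<Prod>u\<in>{..<sys_cols d} - {v}. den d b r u)"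
        using v by (intro prod.remove) auto
      also have "(\<Prod>u\<in>{..<sys_cols d} - {v}. den d b r u) = other_dens d b r v"
        unfolding other_dens_def by (intro prod.mono_neutral_cong_left) auto
      finally show ?thesis .
    qed
    moreover have "cval \<rho> (coef d r v) = (of_nat (num d p q r v) - of_nat (num d q p r v)) / of_nat (den d b r v)"
      by (simp add: cval_def num_def den_def \<rho> odd_iff_mod_2_eq_one minus_divide_left)
    moreover have "of_nat (den d b r v) \<noteq> (0 :: 'a)" using b by (simp add: den_def)
    ultimately show ?thesis by (simp add: int_coef_def)
  qed
  then show ?thesis by (simp add: sys_row_def sum_distrib_left mult.assoc)
qed

text \<open>The encoding of a fraction rebuilt from its certificate: sign bit, absolute value
  \<open>p + q\<close> (one of them being 0), the sign bit of the positive denominator, and the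
  denominator.\<close>

definition enc_num :: "nat \<Rightarrow> nat \<Rightarrow> nat \<Rightarrow> bool list" where
  "enc_num p q b = [\<not> bin_eq q 0] @ pair (bits (p + q)) [] @ [False] @ pair (bits b) []"

lemma concat_map_dbl: "concat (map (\<lambda>b. [True, b]) l) = dbl l"
  by (induction l) auto

lemma enc_nat_pair: "enc_nat n = pair (bits n) []"
  by (simp add: enc_nat_def pair_def concat_map_dbl)

lemma quotient_of_fraction:
  assumes "0 < b" "coprime a (int b)"
  shows "quotient_of (of_int a / of_nat b) = (a, int b)"
proof -
  have "of_int a / of_nat b = Rat.Fract a (int b)" by (simp add: Fract_of_int_quotient)
  then show ?thesis using assms by (simp add: quotient_of_Fract normalize_stable)
qed

lemma enc_rat_enc_num:
  assumes "p = 0 \<or> q = 0" "0 < b" "coprime (p + q) b"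
  shows "enc_rat ((of_nat p - of_nat q) / of_nat b) = enc_num p q b"
proof -
  have "coprime (int p - int q) (int b)"
    using assms(1,3) by auto
  from quotient_of_fraction[OF assms(2) this]
  have "quotient_of ((of_nat p - of_nat q) / of_nat b) = (int p - int q, int b)" by simp
  moreover have "nat \<bar>int p - int q\<bar> = p + q" "int p - int q < 0 \<longleftrightarrow> q \<noteq> 0" using assms(1) by auto
  ultimately show ?thesis
    by (simp add: enc_rat_def enc_int_def enc_nat_pair enc_num_def bin_eq_def)
qed

text \<open>The certificate consists of the numbers \<open>(p x - q x) / b x\<close> of the instance, of Bezout
  coefficients which show that these fractions are reduced, and of an integral solution
  \<open>zp - zn\<close> of the homogenised system.\<close>

definition valid :: "bool \<Rightarrow> bool list \<Rightarrow> dims \<Rightarrow> (nat \<Rightarrow> nat) \<Rightarrow> (nat \<Rightarrow> nat) \<Rightarrow> (nat \<Rightarrow> nat) \<Rightarrow> (nat \<Rightarrow> nat) \<Rightarrow>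
    (nat \<Rightarrow> nat) \<Rightarrow> (nat \<Rightarrow> nat) \<Rightarrow> (nat \<Rightarrow> nat) \<Rightarrow> (nat \<Rightarrow> bool) \<Rightarrow> bool" where
  "valid fx w d p q b \<mu> \<nu> zp zn S \<longleftrightarrow>
    w = una (nrows d) @ [False] @ una (ncols d) @ [False] @ una (npars d) @ [False] @
      una (ncons d) @ [False] @ concat (map (\<lambda>x. enc_num (p x) (q x) (b x)) [0..<offEnd d]) @
      concat (map (\<lambda>j. [S j]) [0..<ncols d]) \<and>
    (\<forall>x<Suc (offEnd d). (bin_eq (p x) 0 \<or> bin_eq (q x) 0) \<and> bin_eq (\<nu> x * b x) (\<mu> x * (p x + q x) + 1)) \<and>
    bin_eq (p (offEnd d)) 1 \<and> bin_eq (q (offEnd d)) 0 \<and> bin_eq (b (offEnd d)) 1 \<and>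
    card {j. j < ncols d \<and> S j} = nrows d \<and>
    (\<forall>r<sys_rows d. row_holds d p q b zp zn r) \<and> bin_eq (zn (unit_col d)) 0 \<and> \<not> bin_eq (zp (unit_col d)) 0 \<and>
    (\<forall>j<ncols d. bin_eq (zn (npars d + j)) 0 \<and> bin_eq (zn (varS d + j)) 0 \<and>
       (bin_eq (zp (npars d + j)) 0 \<or> bin_eq (zp (varS d + j)) 0) \<and> (S j \<or> bin_eq (zp (npars d + j)) 0)) \<and>
    (\<forall>i<ncons d. bin_eq (zn (varT d + i)) 0) \<and>
    (\<forall>j<ncols d. \<forall>r<nrows d. S j \<or> bin_eq (zp (varN d + (j + ncols d * r))) 0 \<and>
       bin_eq (zn (varN d + (j + ncols d * r))) 0) \<and>
    (fx \<longrightarrow> (\<forall>x<npars d * ncols d. bin_eq (p (offC d + x)) 0 \<and> bin_eq (q (offC d + x)) 0))"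

text \<open>The inverse block divided by the homogenising coordinate is a right inverse. Over the
  rationals this makes the instance legal, over the reals it gives the basis demanded by
  \<open>optimal_basis\<close>.\<close>

lemma sys_inverse_basis:
  fixes \<rho> z :: "nat \<Rightarrow> 'a :: field"
  assumes sys: "\<And>r. r < sys_rows d \<Longrightarrow> sys_row d \<rho> z r = 0" and \<rho>: "\<rho> (offEnd d) = 1"
    and e: "z (unit_col d) \<noteq> 0" and card: "card {j. j < ncols d \<and> S j} = nrows d"
    and off: "\<And>j r. j < ncols d \<Longrightarrow> r < nrows d \<Longrightarrow> \<not> S j \<Longrightarrow> z (varN d + (j + ncols d * r)) = 0"
  shows "is_basis (mat (nrows d) (ncols d) (\<lambda>(i, j). \<rho> (j + ncols d * i))) {j. j < ncols d \<and> S j}"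
proof -
  have rows: "\<forall>r<sys_rows d. sys_row d \<rho> z r = 0" using sys by blast
  let ?N = "\<lambda>j r. z (varN d + (j + ncols d * r)) / z (unit_col d)"
  have "(\<Sum>j<ncols d. \<rho> (j + ncols d * i) * ?N j r) = (if i = r then 1 else 0)"
    if ir: "i < nrows d" "r < nrows d" for i r
  proof -
    have "(\<Sum>j<ncols d. \<rho> (j + ncols d * i) * z (varN d + (j + ncols d * r)))
        = (if i = r then z (unit_col d) else 0)"
      using rows[unfolded all_sys_rows] ir by (auto simp: sys_row_inverse \<rho>)
    moreover have "(\<Sum>j<ncols d. \<rho> (j + ncols d * i) * ?N j r) =
        (\<Sum>j<ncols d. \<rho> (j + ncols d * i) * z (varN d + (j + ncols d * r))) / z (unit_col d)"
      by (simp add: sum_divide_distrib)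
    ultimately show ?thesis using e by simp
  qed
  then show ?thesis
    using card off by (subst is_basis_iff[of _ "nrows d" "ncols d"]) (auto intro!: exI[of _ ?N])
qed

section \<open>Soundness of the verifier\<close>

lemma sys_row_of_rat:
  "sys_row d (\<lambda>x. real_of_rat (\<rho> x)) (\<lambda>v. real_of_rat (z v)) r = real_of_rat (sys_row d \<rho> z r)"
  unfolding sys_row_def of_rat_sum by (intro sum.cong refl) (simp add: of_rat_mult cval_def of_rat_minus)

text \<open>The integral solution divided by its homogenising coordinate gives the parameters, the
  primal and the dual solution. The Bezout identities make the fractions reduced, so the compared
  string really is an encoding.\<close>

lemma valid_sound:
  assumes v: "valid fx w d p q b \<mu> \<nu> zp zn S" and b: "\<And>x. 0 < b x"
  shows "\<exists>P. w = encode P \<and> is_instance P \<and> (fx \<longrightarrow> fixed_objective P) \<and> optimistic_BILFP P"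
proof -
  note r0 = v[unfolded valid_def bin_eq_def]
  note c1 = conjunct1[OF r0] and r1 = conjunct2[OF r0]
  note c2 = conjunct1[OF r1] and r2 = conjunct2[OF r1]
  note c3 = conjunct1[OF r2] and r3 = conjunct2[OF r2]
  note c4 = conjunct1[OF r3] and r4 = conjunct2[OF r3]
  note c5 = conjunct1[OF r4] and r5 = conjunct2[OF r4]
  note c6 = conjunct1[OF r5] and r6 = conjunct2[OF r5]
  note c7 = conjunct1[OF r6] and r7 = conjunct2[OF r6]
  note c8 = conjunct1[OF r7] and r8 = conjunct2[OF r7]
  note c9 = conjunct1[OF r8] and r9 = conjunct2[OF r8]
  note c10 = conjunct1[OF r9] and r10 = conjunct2[OF r9]
  note c11 = conjunct1[OF r10] and r11 = conjunct2[OF r10]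
  note c12 = conjunct1[OF r11] and r12 = conjunct2[OF r11]
  note vx = c2[THEN spec, THEN mp] and v1 = c3 c4 c5 and card = c6
    and vr = c7[THEN spec, THEN mp] and ve = c8 c9
    and vj = c10[THEN spec, THEN mp] and vt = c11[THEN spec, THEN mp]
    and vN = c12[THEN spec, THEN mp, THEN spec, THEN mp] and vfx = r12[THEN mp, THEN spec, THEN mp]
  define \<rho> :: "nat \<Rightarrow> rat" where "\<rho> x = (of_nat (p x) - of_nat (q x)) / of_nat (b x)" for x
  define z :: "nat \<Rightarrow> rat" where "z j = of_int (int (zp j) - int (zn j))" for j
  define P where "P = inst_of d \<rho> S"
  have \<rho>1: "\<rho> (offEnd d) = 1" using v1 by (simp add: \<rho>_def)
  have enc: "enc_rat (\<rho> x) = enc_num (p x) (q x) (b x)" if "x < Suc (offEnd d)" for x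
  proof -
    have "\<nu> x * b x = \<mu> x * (p x + q x) + 1" "p x = 0 \<or> q x = 0" using vx[OF that] by (rule conjunct2, rule conjunct1)
    moreover have "coprime (p x + q x) (b x)"
    proof (rule coprimeI)
      fix c assume c: "c dvd p x + q x" "c dvd b x"
      then have "c dvd \<mu> x * (p x + q x) + 1" unfolding calculation(1)[symmetric] by simp
      then show "is_unit c" using c(1) by (metis dvd_add_right_iff dvd_mult)
    qed
    ultimately show ?thesis unfolding \<rho>_def using b by (intro enc_rat_enc_num)
  qed
  have "concat (map (\<lambda>x. enc_num (p x) (q x) (b x)) [0..<offEnd d]) = concat (map (\<lambda>x. enc_rat (\<rho> x)) [0..<offEnd d])"
    using enc by (intro arg_cong[of _ _ concat] map_cong) auto
  then have w: "w = encode P" unfolding P_def encode_inst_of using c1 by simp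
  have sys: "sys_row d \<rho> z r = 0" if "r < sys_rows d" for r
  proof -
    have "(\<Sum>v<sys_cols d. int_coef d p q b r v * (int (zp v) - int (zn v))) = 0"
      using vr[OF that] unfolding row_holds_iff .
    then have "rat_of_int (\<Sum>v<sys_cols d. int_coef d p q b r v * (int (zp v) - int (zn v))) = 0" by simp
    then have "(\<Sum>v<sys_cols d. of_int (int_coef d p q b r v) * z v) = 0" by (simp add: z_def)
    then have "of_nat (\<Prod>u<sys_cols d. den d b r u) * sys_row d \<rho> z r = 0"
      using int_coef_sys_row[OF b \<rho>_def] by simp
    moreover have "(\<Prod>u<sys_cols d. den d b r u) \<noteq> 0" using b by (simp add: den_def)
    ultimately show ?thesis by (simp only: mult_eq_0_iff of_nat_eq_0_iff) simp
  qed
  have e: "0 < z (unit_col d)" using ve by (simp add: z_def)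
  have off: "z (varN d + (j + ncols d * r)) = 0" if "j < ncols d" "r < nrows d" "\<not> S j" for j r
    using vN[OF that(1,2)] that(3) by (simp add: z_def)
  have basis: "is_basis (matA P) (basis P)"
    using sys_inverse_basis[OF sys \<rho>1 _ card off] e by (simp add: P_def inst_of_def)
  have inst: "is_instance P" using basis by (simp add: is_instance_def P_def inst_of_def)
  have fx: "fixed_objective P" if fx
  proof -
    have C: "\<rho> (offC d + x) = 0" if "x < npars d * ncols d" for x using vfx[OF \<open>fx\<close> that] by (simp add: \<rho>_def)
    show ?thesis
      unfolding fixed_objective_def P_def inst_of_def
      by (intro eq_matI) (auto intro!: C less_mixed)
  qed
  let ?\<rho> = "\<lambda>x. real_of_rat (\<rho> x)" and ?z = "\<lambda>v. real_of_rat (z v)"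
  have rsys: "sys_row d ?\<rho> ?z r = 0" if "r < sys_rows d" for r
    unfolding sys_row_of_rat sys[OF that] by simp
  then have rows: "\<forall>r<sys_rows d. sys_row d ?\<rho> ?z r = 0" by blast
  note rows = rows[unfolded all_sys_rows]
  define E where "E = ?z (unit_col d)"
  have E: "0 < E" using e by (simp add: E_def)
  have rbasis: "is_basis (mat (nrows d) (ncols d) (\<lambda>(i, j). ?\<rho> (j + ncols d * i))) {j. j < ncols d \<and> S j}"
    by (rule sys_inverse_basis[OF rsys _ _ card]) (use \<rho>1 e off in auto)
  define x where "x l = ?z l / E" for l
  define y where "y j = ?z (npars d + j) / E" for j
  define \<pi> where "\<pi> i = ?z (varP d + i) / E" for i
  have zero: "z j = 0 \<longleftrightarrow> zp j = zn j" for j by (simp add: z_def)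
  have o1: "(\<Sum>l<npars d. ?\<rho> (offD d + (l + npars d * i)) * x l) \<le> ?\<rho> (offd d + i)" if i: "i < ncons d" for i
  proof -
    have nn: "0 \<le> ?z (varT d + i)" using vt[OF i] by (simp add: z_def)
    have eq: "(\<Sum>l<npars d. ?\<rho> (offD d + (l + npars d * i)) * ?z l) + ?z (varT d + i) = ?\<rho> (offd d + i) * E"
    proof -
      have "sys_row d ?\<rho> ?z (nrows d + i) = 0" using rows i by blast
      then show ?thesis unfolding sys_row_cons[OF i] \<rho>1 of_rat_1 E_def by linarith
    qed
    have quot: "(\<Sum>l<npars d. ?\<rho> (offD d + (l + npars d * i)) * x l) =
        (\<Sum>l<npars d. ?\<rho> (offD d + (l + npars d * i)) * ?z l) / E"
      by (simp add: x_def sum_divide_distrib)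
    have "(\<Sum>l<npars d. ?\<rho> (offD d + (l + npars d * i)) * ?z l) \<le> ?\<rho> (offd d + i) * E"
      using nn eq by linarith
    then show ?thesis unfolding quot using E by (simp add: divide_le_eq)
  qed
  have o2: "(\<Sum>j<ncols d. ?\<rho> (j + ncols d * i) * y j) =
      (\<Sum>l<npars d. ?\<rho> (offB d + (l + npars d * i)) * x l) + ?\<rho> (offb d + i)" if i: "i < nrows d" for i
  proof -
    have "(\<Sum>j<ncols d. ?\<rho> (j + ncols d * i) * ?z (npars d + j)) =
        (\<Sum>l<npars d. ?\<rho> (offB d + (l + npars d * i)) * ?z l) + ?\<rho> (offb d + i) * E"
    proof -
      have "sys_row d ?\<rho> ?z i = 0" using rows i by blast
      then show ?thesis unfolding sys_row_primal[OF i] E_def by linarith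
    qed
    then have "(\<Sum>j<ncols d. ?\<rho> (j + ncols d * i) * ?z (npars d + j)) / E =
        (\<Sum>l<npars d. ?\<rho> (offB d + (l + npars d * i)) * ?z l) / E + ?\<rho> (offb d + i)"
      using E by (simp add: field_simps)
    then show ?thesis by (simp add: x_def y_def sum_divide_distrib)
  qed
  have o3: "0 \<le> y j \<and> (\<not> S j \<longrightarrow> y j = 0)" if j: "j < ncols d" for j
    using vj[OF j] E by (auto simp: y_def z_def)
  have o4: "(\<Sum>i<nrows d. ?\<rho> (j + ncols d * i) * \<pi> i) \<le>
          (\<Sum>l<npars d. ?\<rho> (offC d + (l + npars d * j)) * x l) + ?\<rho> (offc d + j) \<and>
        (y j \<noteq> 0 \<longrightarrow> (\<Sum>i<nrows d. ?\<rho> (j + ncols d * i) * \<pi> i) =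
          (\<Sum>l<npars d. ?\<rho> (offC d + (l + npars d * j)) * x l) + ?\<rho> (offc d + j))" if j: "j < ncols d" for j
  proof -
    have "(\<Sum>i<nrows d. ?\<rho> (j + ncols d * i) * ?z (varP d + i)) + ?z (varS d + j) =
        (\<Sum>l<npars d. ?\<rho> (offC d + (l + npars d * j)) * ?z l) + ?\<rho> (offc d + j) * E"
    proof -
      have "sys_row d ?\<rho> ?z (rowS d + j) = 0" using rows j by blast
      then show ?thesis unfolding sys_row_dual[OF j] \<rho>1 of_rat_1 E_def by linarith
    qed
    then have "(\<Sum>i<nrows d. ?\<rho> (j + ncols d * i) * ?z (varP d + i)) / E + ?z (varS d + j) / E =
        (\<Sum>l<npars d. ?\<rho> (offC d + (l + npars d * j)) * ?z l) / E + ?\<rho> (offc d + j)"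
      using E by (simp add: field_simps)
    then have eq: "(\<Sum>i<nrows d. ?\<rho> (j + ncols d * i) * \<pi> i) + ?z (varS d + j) / E =
        (\<Sum>l<npars d. ?\<rho> (offC d + (l + npars d * j)) * x l) + ?\<rho> (offc d + j)"
      by (simp add: x_def \<pi>_def sum_divide_distrib)
    have nn: "0 \<le> ?z (varS d + j) / E" using vj[OF j] E by (simp add: z_def)
    \<comment> \<open>As the negative parts vanish here, complementarity is a condition on
      \<open>zp\<close> alone.\<close>
    have "y j \<noteq> 0 \<Longrightarrow> ?z (varS d + j) = 0" using vj[OF j] by (auto simp: y_def z_def)
    then show ?thesis using eq nn by (intro conjI impI) (linarith, simp)
  qed
  have "optimistic_BILFP P"
    unfolding P_def optimistic_inst_of optimality_witness_def
    by (rule conjI[OF rbasis], rule exI[of _ x], rule exI[of _ y], rule exI[of _ \<pi>],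
      (intro conjI; (intro allI impI, (erule o1 | erule o2 | erule o3 | erule o4))))
  then show ?thesis using w inst fx by blast
qed


section \<open>Completeness: positive instances have short certificates\<close>

lemma sys_solvable:
  fixes \<rho> :: "nat \<Rightarrow> rat" and S :: "nat \<Rightarrow> bool"
  defines "\<rho>' \<equiv> \<lambda>x. real_of_rat (\<rho> x)"
  assumes opt: "optimistic_BILFP (inst_of d \<rho> S)" and \<rho>1: "\<rho> (offEnd d) = 1"
  shows "card {j. j < ncols d \<and> S j} = nrows d \<and> (\<exists>z. (\<forall>r<sys_rows d. sys_row d \<rho>' z r = 0) \<and>
    z (unit_col d) = 1 \<and>
    (\<forall>j<ncols d. 0 \<le> z (npars d + j) \<and> 0 \<le> z (varS d + j) \<and> (z (npars d + j) = 0 \<or> z (varS d + j) = 0) \<and>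
       (S j \<or> z (npars d + j) = 0)) \<and>
    (\<forall>i<ncons d. 0 \<le> z (varT d + i)) \<and>
    (\<forall>j<ncols d. \<forall>r<nrows d. S j \<or> z (varN d + (j + ncols d * r)) = 0))"
proof -
  let ?A = "mat (nrows d) (ncols d) (\<lambda>(i, j). \<rho>' (j + ncols d * i))" and ?I = "{j. j < ncols d \<and> S j}"
  obtain x y p where basis: "is_basis ?A ?I" and w: "optimality_witness d \<rho>' S x y p"
    using opt unfolding optimistic_inst_of \<rho>'_def by blast
  note r0 = w[unfolded optimality_witness_def]
  note D = conjunct1[OF r0, THEN spec, THEN mp] and r1 = conjunct2[OF r0]
  note E = conjunct1[OF r1, THEN spec, THEN mp] and r2 = conjunct2[OF r1]
  note N = conjunct1[OF r2, THEN spec, THEN mp] and O = conjunct2[OF r2, THEN spec, THEN mp]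
  have "?A \<in> carrier_mat (nrows d) (ncols d)" "?I \<subseteq> {..<ncols d}" by auto
  from is_basis_iff[OF this] basis obtain W where card: "card ?I = nrows d"
    and W: "\<And>j r. j < ncols d \<Longrightarrow> j \<notin> ?I \<Longrightarrow> r < nrows d \<Longrightarrow> W j r = 0"
    "\<And>i r. i < nrows d \<Longrightarrow> r < nrows d \<Longrightarrow> (\<Sum>j<ncols d. ?A $$ (i, j) * W j r) = (if i = r then 1 else 0)"
    by blast
  \<comment> \<open>The blocks are laid out one after another; both kinds of slack are defined as
    differences, so their rows hold automatically.\<close>
  define z where "z v = (if v < npars d then x v else if v < varP d then y (v - npars d)
    else if v < varS d then p (v - varP d)
    else if v < varT d then (\<Sum>l<npars d. \<rho>' (offC d + (l + npars d * (v - varS d))) * x l) + \<rho>' (offc d + (v - varS d))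
       - (\<Sum>i<nrows d. \<rho>' ((v - varS d) + ncols d * i) * p i)
    else if v < varN d then \<rho>' (offd d + (v - varT d)) - (\<Sum>l<npars d. \<rho>' (offD d + (l + npars d * (v - varT d))) * x l)
    else if v < unit_col d then W ((v - varN d) mod ncols d) ((v - varN d) div ncols d) else 1)" for v
  have zx: "z l = x l" if "l < npars d" for l using that by (simp add: z_def)
  have zy: "z (npars d + j) = y j" if "j < ncols d" for j using that by (simp add: z_def varP_def)
  have zp: "z (varP d + i) = p i" if "i < nrows d" for i
    using that by (simp add: z_def varS_def varP_def)
  have zs: "z (varS d + j) = (\<Sum>l<npars d. \<rho>' (offC d + (l + npars d * j)) * x l) + \<rho>' (offc d + j)
       - (\<Sum>i<nrows d. \<rho>' (j + ncols d * i) * p i)" if "j < ncols d" for j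
    using that var_le[of d] var_less(3)[OF that] by (simp add: z_def)
  have zt: "z (varT d + i) = \<rho>' (offd d + i) - (\<Sum>l<npars d. \<rho>' (offD d + (l + npars d * i)) * x l)"
    if "i < ncons d" for i
    using that var_le[of d] var_less(4)[OF that] by (simp add: z_def)
  have zW: "z (varN d + (j + ncols d * r)) = W j r" if "j < ncols d" "r < nrows d" for j r
    using that var_le[of d] var_less(5)[OF that] by (simp add: z_def mod_div_mixed)
  have z1: "z (unit_col d) = 1" using var_le[of d] by (simp add: z_def)
  have \<rho>1: "\<rho>' (offEnd d) = 1" using \<rho>1 by (simp add: \<rho>'_def)
  have "\<forall>r<sys_rows d. sys_row d \<rho>' z r = 0"
    unfolding all_sys_rows
  proof (intro conjI allI impI)
    fix i assume i: "i < nrows d"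
    show "sys_row d \<rho>' z i = 0" unfolding sys_row_primal[OF i] using E[OF i] by (simp add: zx zy z1)
    fix r assume r: "r < nrows d"
    have "(\<Sum>j<ncols d. ?A $$ (i, j) * W j r) = (\<Sum>j<ncols d. \<rho>' (j + ncols d * i) * W j r)"
      using i by (intro sum.cong) auto
    then have s: "(\<Sum>j<ncols d. \<rho>' (j + ncols d * i) * W j r) = (if i = r then 1 else 0)"
      using W(2)[OF i r] by (rule trans[OF sym])
    have "(\<Sum>j<ncols d. \<rho>' (j + ncols d * i) * z (varN d + (j + ncols d * r))) =
        (\<Sum>j<ncols d. \<rho>' (j + ncols d * i) * W j r)"
      using r by (intro sum.cong refl) (simp add: zW)
    then show "sys_row d \<rho>' z (rowN d + (i + nrows d * r)) = 0"
      unfolding sys_row_inverse[OF i r] z1 \<rho>1 s by simp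
  next
    fix i assume i: "i < ncons d"
    show "sys_row d \<rho>' z (nrows d + i) = 0" unfolding sys_row_cons[OF i] by (simp add: zx zt[OF i] z1 \<rho>1)
  next
    fix j assume j: "j < ncols d"
    show "sys_row d \<rho>' z (rowS d + j) = 0" unfolding sys_row_dual[OF j] by (simp add: zx zp zs[OF j] z1 \<rho>1)
  qed
  moreover have "0 \<le> z (npars d + j) \<and> 0 \<le> z (varS d + j) \<and> (z (npars d + j) = 0 \<or> z (varS d + j) = 0) \<and>
       (S j \<or> z (npars d + j) = 0)" if j: "j < ncols d" for j
    using N[OF j] O[OF j] unfolding zy[OF j] zs[OF j] by auto
  moreover have "0 \<le> z (varT d + i)" if i: "i < ncons d" for i using D[OF i] by (simp add: zt[OF i])
  moreover have "S j \<or> z (varN d + (j + ncols d * r)) = 0" if "j < ncols d" "r < nrows d" for j r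
    using W(1)[OF that(1) _ that(2)] that by (auto simp: zW)
  ultimately show ?thesis using card z1 by blast
qed

text \<open>Reducing one Bezout coefficient modulo \<open>a\<close> bounds it, and the identity then
  bounds the other.\<close>

lemma small_bezout:
  assumes "0 < b" "coprime a (b :: nat)"
  shows "\<exists>u v. v * b = u * a + 1 \<and> u \<le> b \<and> v \<le> a + 1"
\<comment> \<open>Remainder 1 modulo \<open>a\<close> requires \<open>a > 1\<close>; the remaining
  cases have explicit coefficients.\<close>
proof (cases "a \<le> 1")
  case True
  then consider "a = 0" "b = 1" | "a = 1" using assms by (cases "a = 0") auto
  then show ?thesis
  proof cases
    case 2
    then show ?thesis using assms(1) by (intro exI[of _ "b - 1"] exI[of _ 1]) simp
  qed (auto intro!: exI[of _ 0] exI[of _ 1])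
next
  case False
  obtain x y where xy: "b * x = a * y + gcd b a" using bezout_nat[of b a] assms(1) by blast
  have g: "gcd b a = 1" using assms(2) by (simp add: coprime_iff_gcd_eq_1 gcd.commute)
  define v where "v = x mod a"
  have "(b * v) mod a = (b * x) mod a" by (simp add: v_def mod_mult_right_eq)
  also have "\<dots> = 1" using False unfolding xy g by (metis mod_less mod_mult_self4 not_le)
  finally have "b * v = (b * v div a) * a + 1" by (metis div_mult_mod_eq)
  moreover have "v < a" using False by (simp add: v_def)
  moreover have "b * v div a \<le> b * a div a" using \<open>v < a\<close> by (intro div_le_mono) simp
  then have "b * v div a \<le> b" using False by simp
  ultimately show ?thesis by (intro exI[of _ "b * v div a"] exI[of _ v]) (simp add: mult.commute)
qed

text \<open>Bounds the rows and the columns: five blocks of length at most \<open>l\<close>, one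
  block of size at most \<open>l * l\<close>, and the homogenising column.\<close>

definition sys_bound :: "nat \<Rightarrow> nat" where
  "sys_bound l = l * l + 5 * l + 1"

text \<open>The product is the exponent in \<open>solution_bound\<close> for systems of size
  \<open>sys_bound l\<close>. The summand \<open>l + 2\<close> accommodates the numbers of the
  instance and the Bezout coefficients, which are at most \<open>2 ^ l + 1\<close>.\<close>

definition bit_bound :: "nat \<Rightarrow> nat" where
  "bit_bound l = (2 * sys_bound l + 2 * (l * Suc (sys_bound l))) * Suc (sys_bound l) + l + 2"

lemma length_concat_upt: "length (concat (map f [0..<n])) = (\<Sum>x<n. length (f x))"
  by (simp add: length_concat comp_def interv_sum_list_conv_sum_set_nat atLeast0LessThan)

lemma length_enc_num: "length (enc_num p q b) = 4 + 2 * length (bits (p + q)) + 2 * length (bits b)"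
  by (simp add: enc_num_def)

lemma num_le: "(\<And>x. p x \<le> B) \<Longrightarrow> (\<And>x. q x \<le> B) \<Longrightarrow> num d p q r v \<le> B"
  by (simp add: num_def)

lemma int_coef_le:
  assumes "\<And>x. p x \<le> B" "\<And>x. q x \<le> B" "\<And>x. b x \<le> B" "0 < B"
  shows "\<bar>int_coef d p q b r v\<bar> \<le> int (B * B ^ sys_cols d)"
proof -
  have "other_dens d b r v \<le> (\<Prod>u<sys_cols d. B)"
    unfolding other_dens_def by (intro prod_mono) (use assms in \<open>auto simp: den_def\<close>)
  then have o: "other_dens d b r v \<le> B ^ sys_cols d" by simp
  have "num d p q r v \<le> B" "num d q p r v \<le> B" using assms by (auto intro: num_le)
  then have "\<bar>int (num d p q r v) - int (num d q p r v)\<bar> \<le> int B" by linarith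
  moreover have "\<bar>int (other_dens d b r v)\<bar> \<le> int (B ^ sys_cols d)" using o by linarith
  ultimately show ?thesis unfolding int_coef_def abs_mult of_nat_mult by (intro mult_mono) auto
qed

text \<open>Every factor in the bound of \<open>small_solution\<close> is rounded up to a power of
  two, for coefficients bounded as in \<open>int_coef_le\<close>.\<close>

lemma solution_bound:
  fixes Z R l K :: nat
  assumes "Z \<le> K" "R \<le> K"
  shows "(int Z * (1 + int R * int (2 ^ l * (2 ^ l) ^ Z) * int (2 ^ l * (2 ^ l) ^ Z))) ^ Suc Z
    \<le> int (2 ^ ((2 * K + 2 * (l * Suc K)) * Suc K))"
proof -
  define B :: nat where "B = 2 ^ (l * Suc Z)"
  have B: "2 ^ l * (2 ^ l) ^ Z = B" by (simp add: B_def power_add power_mult)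
  have "1 + R * B * B \<le> (1 + R) * (B * B)" by (simp add: B_def)
  also have "\<dots> \<le> 2 ^ R * (B * B)" using Suc_leI[OF less_exp[of R]] by (intro mult_right_mono) simp_all
  finally have "Z * (1 + R * B * B) \<le> 2 ^ Z * (2 ^ R * (B * B))"
    using less_exp[of Z] by (intro mult_mono) auto
  also have "\<dots> = 2 ^ (Z + R + 2 * (l * Suc Z))"
    by (simp add: B_def power_add[symmetric] mult_2)
  also have "\<dots> \<le> 2 ^ (2 * K + 2 * (l * Suc K))"
    using assms by (intro power_increasing add_mono mult_mono) auto
  finally have "(Z * (1 + R * B * B)) ^ Suc Z \<le> (2 ^ (2 * K + 2 * (l * Suc K))) ^ Suc Z"
    by (intro power_mono) auto
  also have "\<dots> = 2 ^ ((2 * K + 2 * (l * Suc K)) * Suc Z)" by (rule power_mult[symmetric])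
  also have "\<dots> \<le> 2 ^ ((2 * K + 2 * (l * Suc K)) * Suc K)"
    using assms by (intro power_increasing mult_left_mono) auto
  finally have "int ((Z * (1 + R * B * B)) ^ Suc Z) \<le> int (2 ^ ((2 * K + 2 * (l * Suc K)) * Suc K))"
    by (simp only: of_nat_le_iff)
  then show ?thesis unfolding B by (simp only: of_nat_power of_nat_mult of_nat_add of_nat_1)
qed

text \<open>The numbers of the instance are short because they occur in its encoding; the solution
  is short by \<open>small_solution\<close>. The values outside the ranges are fixed so that
  decoding a certificate reproduces these functions everywhere.\<close>

lemma valid_complete:
  assumes inst: "is_instance P" and fx: "fx \<longrightarrow> fixed_objective P" and opt: "optimistic_BILFP P"
  defines "l \<equiv> length (encode P)"
  shows "\<exists>d p q b \<mu> \<nu> zp zn S. valid fx (encode P) d p q b \<mu> \<nu> zp zn S \<and>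
    nrows d \<le> l \<and> ncols d \<le> l \<and> npars d \<le> l \<and> ncons d \<le> l \<and> offEnd d \<le> l \<and> sys_cols d \<le> sys_bound l \<and>
    (\<forall>x. p x < 2 ^ bit_bound l \<and> q x < 2 ^ bit_bound l \<and> b x < 2 ^ bit_bound l \<and> \<mu> x < 2 ^ bit_bound l \<and>
       \<nu> x < 2 ^ bit_bound l) \<and> (\<forall>v. zp v < 2 ^ bit_bound l \<and> zn v < 2 ^ bit_bound l) \<and>
    (\<forall>x>offEnd d. p x = 0 \<and> q x = 0 \<and> b x = 1 \<and> \<mu> x = 0 \<and> \<nu> x = 0) \<and>
    (\<forall>v\<ge>sys_cols d. zp v = 0 \<and> zn v = 0) \<and> (\<forall>j\<ge>ncols d. \<not> S j)"
proof -
  obtain d \<rho> S0 where P0: "P = inst_of d \<rho> S0" and \<rho>1: "\<rho> (offEnd d) = 1" and \<rho>0: "\<And>x. offEnd d < x \<Longrightarrow> \<rho> x = 0"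
    using inst_of_exists[OF inst] by blast
  define S where "S j \<longleftrightarrow> j < ncols d \<and> S0 j" for j
  \<comment> \<open>Cutting off \<open>S0\<close> beyond the columns does not change the instance
    and makes \<open>S\<close> equal to a decoded characteristic vector.\<close>
  have P: "P = inst_of d \<rho> S" unfolding P0 inst_of_def S_def by simp
  define p q b where "p x = nat (fst (quotient_of (\<rho> x)))" and "q x = nat (- fst (quotient_of (\<rho> x)))"
    and "b x = nat (snd (quotient_of (\<rho> x)))" for x
  have b: "0 < b x" for x using quotient_of_denom_pos' by (simp add: b_def)
  have pq: "p x = 0 \<or> q x = 0" for x by (auto simp: p_def q_def)
  have \<rho>: "\<rho> x = (of_nat (p x) - of_nat (q x)) / of_nat (b x)" for x
  proof -
    have "\<rho> x = of_int (fst (quotient_of (\<rho> x))) / of_int (snd (quotient_of (\<rho> x)))"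
      by (rule quotient_of_div) simp
    moreover have "of_int (fst (quotient_of (\<rho> x))) = (of_nat (p x) - of_nat (q x) :: rat)"
      by (cases "0 \<le> fst (quotient_of (\<rho> x))") (simp_all add: p_def q_def)
    moreover have "of_int (snd (quotient_of (\<rho> x))) = (of_nat (b x) :: rat)"
      using quotient_of_denom_pos'[of "\<rho> x"] by (simp add: b_def)
    ultimately show ?thesis by simp
  qed
  have cop: "coprime (p x + q x) (b x)" for x
  proof -
    have "p x + q x = nat \<bar>fst (quotient_of (\<rho> x))\<bar>" by (auto simp: p_def q_def)
    moreover have "coprime (fst (quotient_of (\<rho> x))) (snd (quotient_of (\<rho> x)))"
      by (rule Rat.quotient_of_coprime) simp
    ultimately show ?thesis
      using quotient_of_denom_pos'[of "\<rho> x"] by (simp add: b_def coprime_nat_abs_left_iff)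
  qed
  have p1: "p (offEnd d) = 1" "q (offEnd d) = 0" "b (offEnd d) = 1"
    by (simp_all add: p_def q_def b_def \<rho>1)
  have p0: "p x = 0" "q x = 0" "b x = 1" if "offEnd d < x" for x
    by (simp_all add: p_def q_def b_def \<rho>0[OF that])
  have enc: "enc_rat (\<rho> x) = enc_num (p x) (q x) (b x)" for x
    unfolding \<rho> by (rule enc_rat_enc_num[OF pq b cop])
  note w = encode_inst_of[of d \<rho> S, folded P, unfolded enc]
  have len: "l = nrows d + ncols d + npars d + ncons d + 4 +
      (\<Sum>x<offEnd d. length (enc_num (p x) (q x) (b x))) + ncols d"
    unfolding l_def w by (simp add: length_concat_upt)
  have dims: "nrows d \<le> l" "ncols d \<le> l" "npars d \<le> l" "ncons d \<le> l" unfolding len by simp_all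
  have "(\<Sum>x<offEnd d. 1) \<le> (\<Sum>x<offEnd d. length (enc_num (p x) (q x) (b x)))"
    by (intro sum_mono) (simp add: length_enc_num)
  then have E: "offEnd d \<le> l" unfolding len by simp
  have nums: "p x + q x \<le> 2 ^ l \<and> b x \<le> 2 ^ l" for x
  proof (cases "x < offEnd d")
    case True
    then have "length (enc_num (p x) (q x) (b x)) \<le> (\<Sum>x<offEnd d. length (enc_num (p x) (q x) (b x)))"
      by (intro member_le_sum) auto
    then have "length (bits (p x + q x)) \<le> l" "length (bits (b x)) \<le> l" unfolding len length_enc_num by linarith+
    then show ?thesis unfolding length_bits_le_iff by simp
  next
    case False
    then show ?thesis using p1 p0[of x] by (cases "x = offEnd d") auto
  qed
  have ple: "p x \<le> 2 ^ l" "q x \<le> 2 ^ l" "b x \<le> 2 ^ l" for x using nums[of x] by auto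
  obtain \<mu>0 \<nu>0 where bez: "\<And>x. \<nu>0 x * b x = \<mu>0 x * (p x + q x) + 1 \<and> \<mu>0 x \<le> b x \<and> \<nu>0 x \<le> p x + q x + 1"
    using small_bezout[OF b cop] by metis
  define \<mu> \<nu> where "\<mu> x = (if x \<le> offEnd d then \<mu>0 x else 0)" and "\<nu> x = (if x \<le> offEnd d then \<nu>0 x else 0)" for x
  have lt: "n < 2 ^ bit_bound l" if "n \<le> 2 ^ l + 1" for n :: nat
  proof -
    have "(1 :: nat) \<le> 2 ^ l" by simp
    then have "n < 4 * 2 ^ l" using that by linarith
    then have "n < 2 ^ (l + 2)" by (simp add: power_add)
    also have "\<dots> \<le> 2 ^ bit_bound l" by (intro power_increasing) (simp_all add: bit_bound_def)
    finally show ?thesis .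
  qed
  have small: "p x < 2 ^ bit_bound l \<and> q x < 2 ^ bit_bound l \<and> b x < 2 ^ bit_bound l \<and> \<mu> x < 2 ^ bit_bound l \<and>
       \<nu> x < 2 ^ bit_bound l" for x
    using nums[of x] bez[of x] by (intro conjI lt) (auto simp: \<mu>_def \<nu>_def)
  let ?\<rho> = "\<lambda>x. real_of_rat (\<rho> x)"
  from sys_solvable[OF opt[unfolded P] \<rho>1] obtain z where card: "card {j. j < ncols d \<and> S j} = nrows d"
    and z: "\<forall>r<sys_rows d. sys_row d ?\<rho> z r = 0" and z1: "z (unit_col d) = 1"
    and zj: "\<forall>j<ncols d. 0 \<le> z (npars d + j) \<and> 0 \<le> z (varS d + j) \<and> (z (npars d + j) = 0 \<or> z (varS d + j) = 0) \<and>
       (S j \<or> z (npars d + j) = 0)" and zt: "\<forall>i<ncons d. 0 \<le> z (varT d + i)"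
    and zN: "\<forall>j<ncols d. \<forall>r<nrows d. S j \<or> z (varN d + (j + ncols d * r)) = 0" by blast
  define M where "M r v = int_coef d p q b r v" for r v
  define B where "B = int (2 ^ l * (2 ^ l) ^ sys_cols d)"
  have MB: "\<bar>M r v\<bar> \<le> B" for r v unfolding M_def B_def by (rule int_coef_le[OF ple]) simp
  have Mz: "(\<Sum>v<sys_cols d. of_int (M r v) * z v) = 0" if "r < sys_rows d" for r
  proof -
    have "?\<rho> x = (of_nat (p x) - of_nat (q x)) / of_nat (b x)" for x
      unfolding \<rho> by (simp add: of_rat_divide of_rat_diff)
    from int_coef_sys_row[OF b this] show ?thesis using z that unfolding M_def by simp
  qed
  have unit: "unit_col d < sys_cols d" "0 < z (unit_col d)" using z1 by (simp_all add: sys_cols_def)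
  have B0: "0 \<le> B" unfolding B_def by (rule of_nat_0_le_iff)
  obtain x where x: "\<forall>r<sys_rows d. (\<Sum>v<sys_cols d. M r v * x v) = 0" "0 < x (unit_col d)"
    "\<forall>v<sys_cols d. (x v > 0 \<longrightarrow> z v > 0) \<and> (x v < 0 \<longrightarrow> z v < 0)"
    "\<forall>v<sys_cols d. \<bar>x v\<bar> \<le> (int (sys_cols d) * (1 + int (sys_rows d) * B * B)) ^ Suc (sys_cols d)"
    using small_solution[where M = M and z = z and R = "sys_rows d" and Z = "sys_cols d", OF MB B0 Mz unit] by blast
  define zp zn where "zp v = (if v < sys_cols d then nat (x v) else 0)"
    and "zn v = (if v < sys_cols d then nat (- x v) else 0)" for v
  have "ncols d * nrows d \<le> l * l" "nrows d * nrows d \<le> l * l" using dims by (intro mult_mono; simp)+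
  then have Z: "sys_cols d \<le> sys_bound l" "sys_rows d \<le> sys_bound l"
    unfolding sys_cols_def unit_col_def varN_def varT_def varS_def varP_def sys_rows_def rowN_def rowS_def sys_bound_def
    using dims by linarith+
  have xb: "\<bar>x v\<bar> < 2 ^ bit_bound l" if "v < sys_cols d" for v
  proof -
    have "\<bar>x v\<bar> \<le> int (2 ^ ((2 * sys_bound l + 2 * (l * Suc (sys_bound l))) * Suc (sys_bound l)))"
      using x(4) that solution_bound[OF Z, of l] unfolding B_def by (meson order_trans)
    also have "\<dots> < int (2 ^ bit_bound l)"
      unfolding of_nat_less_iff by (intro power_strict_increasing) (simp_all add: bit_bound_def)
    finally show ?thesis by simp
  qed
  have zsmall: "zp v < 2 ^ bit_bound l \<and> zn v < 2 ^ bit_bound l" for v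
    using xb[of v] by (auto simp: zp_def zn_def nat_less_iff)
  \<comment> \<open>Domination of signs transfers nonnegativity, complementarity and the support
    condition from the real solution to the integral one.\<close>
  have zn0: "zn v = 0" if "0 \<le> z v" for v
    using x(3) that by (force simp: zn_def)
  have zp0: "zp v = 0" if "z v \<le> 0" for v
    using x(3) that by (force simp: zp_def)
  have rows: "row_holds d p q b zp zn r" if r: "r < sys_rows d" for r
  proof -
    have "(\<Sum>v<sys_cols d. M r v * (int (zp v) - int (zn v))) = (\<Sum>v<sys_cols d. M r v * x v)"
      by (intro sum.cong refl) (simp add: zp_def zn_def)
    then show ?thesis unfolding row_holds_iff M_def[symmetric] using x(1) r by simp
  qed
  have C: "p (offC d + y) = 0 \<and> q (offC d + y) = 0" if fx and y: "y < npars d * ncols d" for y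
  proof -
    have k: "0 < npars d" using y by (cases "npars d") auto
    have ij: "y div npars d < ncols d" "y mod npars d < npars d"
      using y k by (simp_all add: less_mult_imp_div_less mult.commute)
    have "matC P $$ (y div npars d, y mod npars d) = 0"
      using mp[OF fx \<open>fx\<close>] ij unfolding fixed_objective_def P by (simp add: inst_of_def)
    then have "\<rho> (offC d + y) = 0" unfolding P using ij by (simp add: inst_of_def)
    then show ?thesis by (simp add: p_def q_def)
  qed
  have v: "valid fx (encode P) d p q b \<mu> \<nu> zp zn S"
    unfolding valid_def bin_eq_def
  proof (intro conjI allI impI)
    show "\<nu> y * b y = \<mu> y * (p y + q y) + 1" if "y < Suc (offEnd d)" for y
      using bez[of y] that by (simp add: \<mu>_def \<nu>_def)
    show "zp (unit_col d) \<noteq> 0" using x(2) unit by (simp add: zp_def)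
    show "zn (unit_col d) = 0" using zn0 z1 by simp
    fix j assume j: "j < ncols d"
    show "zn (npars d + j) = 0" "zn (varS d + j) = 0" using zj j zn0 by blast+
    show "zp (npars d + j) = 0 \<or> zp (varS d + j) = 0" "S j \<or> zp (npars d + j) = 0"
      using zj j zp0 by (metis order_refl)+
    fix r assume r: "r < nrows d"
    show "S j \<or> zp (varN d + (j + ncols d * r)) = 0 \<and> zn (varN d + (j + ncols d * r)) = 0"
      using zN j r zp0 zn0 by (metis order_refl)
  qed (use w pq p1 card rows zt zn0 C in auto)
  have o: "\<forall>y>offEnd d. p y = 0 \<and> q y = 0 \<and> b y = 1 \<and> \<mu> y = 0 \<and> \<nu> y = 0"
    by (simp add: p0 \<mu>_def \<nu>_def)
  have z0: "\<forall>v\<ge>sys_cols d. zp v = 0 \<and> zn v = 0" by (simp add: zp_def zn_def)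
  have S0: "\<forall>j\<ge>ncols d. \<not> S j" by (simp add: S_def)
  show ?thesis
    by (rule exI[of _ d], rule exI[of _ p], rule exI[of _ q], rule exI[of _ b], rule exI[of _ \<mu>], rule exI[of _ \<nu>],
      rule exI[of _ zp], rule exI[of _ zn], rule exI[of _ S])
      (rule conjI[OF v] conjI[OF dims(1)] conjI[OF dims(2)] conjI[OF dims(3)] conjI[OF dims(4)] conjI[OF E]
        conjI[OF Z(1)] conjI[OF allI[OF small]] conjI[OF allI[OF zsmall]] conjI[OF o] conjI[OF z0] S0)+
qed

section \<open>Layout of the certificate and polynomial time of the verifier\<close>

definition cert_dims :: "bool list \<Rightarrow> dims" where
  "cert_dims u = \<lparr>nrows = length (item 0 u), ncols = length (item 1 u), npars = length (item 2 u), ncons = length (item 3 u)\<rparr>"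

text \<open>Items 0 to 4 hold the dimensions and the basis; five numbers per entry follow, and two
  numbers per column after that. The default 1 for \<open>c = 2\<close> keeps denominators positive
  outside the range.\<close>

definition cert_num :: "bool list \<Rightarrow> nat \<Rightarrow> nat \<Rightarrow> nat" where
  "cert_num u c x = (if x \<le> offEnd (cert_dims u) then val (item (5 + (c + 5 * x)) u) else if c = 2 then 1 else 0)"

definition cert_sol :: "bool list \<Rightarrow> nat \<Rightarrow> nat \<Rightarrow> nat" where
  "cert_sol u c v = (if v < sys_cols (cert_dims u)
     then val (item (5 + (5 * Suc (offEnd (cert_dims u)) + (c + 2 * v))) u) else 0)"

definition cert_basis :: "bool list \<Rightarrow> nat \<Rightarrow> bool" where
  "cert_basis u = nth_bit (item 4 u)"

definition verify :: "bool \<Rightarrow> bool list \<Rightarrow> bool list" where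
  "verify fx x = (if valid fx (first x) (cert_dims (second x)) (cert_num (second x) 0) (cert_num (second x) 1)
      (cert_num (second x) 2) (cert_num (second x) 3) (cert_num (second x) 4) (cert_sol (second x) 0)
      (cert_sol (second x) 1) (cert_basis (second x)) then [True] else [])"

lemma pt_dims:
  assumes "polytime u"
  shows "polytime (\<lambda>e. una (nrows (cert_dims (u e))))" "polytime (\<lambda>e. una (ncols (cert_dims (u e))))"
    "polytime (\<lambda>e. una (npars (cert_dims (u e))))" "polytime (\<lambda>e. una (ncons (cert_dims (u e))))"
  unfolding cert_dims_def dims.simps by (intro pt_una_length pt_item polytime_const assms)+

lemma pt_offsets:
  assumes u: "polytime u"
  shows "polytime (\<lambda>e. una (offB (cert_dims (u e))))" "polytime (\<lambda>e. una (offb (cert_dims (u e))))"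
    "polytime (\<lambda>e. una (offC (cert_dims (u e))))" "polytime (\<lambda>e. una (offc (cert_dims (u e))))"
    "polytime (\<lambda>e. una (offD (cert_dims (u e))))" "polytime (\<lambda>e. una (offd (cert_dims (u e))))"
    "polytime (\<lambda>e. una (offEnd (cert_dims (u e))))"
  unfolding offEnd_def offd_def offD_def offc_def offC_def offb_def offB_def
  by (intro pt_una_add pt_una_mult pt_dims u)+

lemma pt_system:
  assumes u: "polytime u"
  shows "polytime (\<lambda>e. una (varP (cert_dims (u e))))" "polytime (\<lambda>e. una (varS (cert_dims (u e))))"
    "polytime (\<lambda>e. una (varT (cert_dims (u e))))" "polytime (\<lambda>e. una (varN (cert_dims (u e))))"
    "polytime (\<lambda>e. una (unit_col (cert_dims (u e))))" "polytime (\<lambda>e. una (sys_cols (cert_dims (u e))))"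
    "polytime (\<lambda>e. una (rowS (cert_dims (u e))))" "polytime (\<lambda>e. una (rowN (cert_dims (u e))))"
    "polytime (\<lambda>e. una (sys_rows (cert_dims (u e))))"
  unfolding sys_cols_def unit_col_def varN_def varT_def varS_def varP_def sys_rows_def rowN_def rowS_def
  by (intro pt_una_Suc pt_una_add pt_una_mult pt_dims u)+

lemmas pt_env = pt_first pt_second polytime_id
lemmas pt_unary = pt_una_add pt_una_mult pt_una_diff pt_una_div pt_una_mod pt_una_Suc pt_una_length
  pt_dims pt_offsets pt_system

lemma pt_coef:
  assumes "polytime u" "polytime (\<lambda>e. una (r e))" "polytime (\<lambda>e. una (v e))"
  shows "polytime (\<lambda>e. una (coef (cert_dims (u e)) (r e) (v e)))"
  unfolding coef_def plus_code_def minus_code_def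
  by (intro pt_una_if pt_less pt_le pt_eq pt_conj pt_unary polytime_const assms)

lemma pt_cert_num:
  assumes "polytime u" "polytime (\<lambda>e. una (x e))"
  shows "polytime (\<lambda>e. bits (cert_num (u e) c (x e)))"
  unfolding cert_num_def
  by (intro pt_bits_if pt_le pt_bits_val pt_item pt_unary polytime_const assms)

lemma pt_cert_sol:
  assumes "polytime u" "polytime (\<lambda>e. una (v e))"
  shows "polytime (\<lambda>e. bits (cert_sol (u e) c (v e)))"
  unfolding cert_sol_def
  by (intro pt_bits_if pt_less pt_bits_val pt_item pt_unary polytime_const assms)

lemma pt_cert_basis:
  assumes "polytime u" "polytime (\<lambda>e. una (j e))"
  shows "polytime (\<lambda>e. [cert_basis (u e) (j e)])"
  unfolding cert_basis_def by (intro pt_nth_bit pt_item polytime_const assms)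

lemma pt_num:
  assumes "polytime u" "polytime (\<lambda>e. una (r e))" "polytime (\<lambda>e. una (v e))"
  shows "polytime (\<lambda>e. bits (num (cert_dims (u e)) (cert_num (u e) c) (cert_num (u e) c') (r e) (v e)))"
  unfolding num_def
  by (intro pt_bits_if pt_eq pt_cert_num pt_coef pt_unary polytime_const assms)

lemma pt_den:
  assumes "polytime u" "polytime (\<lambda>e. una (r e))" "polytime (\<lambda>e. una (v e))"
  shows "polytime (\<lambda>e. bits (den (cert_dims (u e)) (cert_num (u e) c) (r e) (v e)))"
  unfolding den_def
  by (intro pt_bits_if pt_eq pt_cert_num pt_coef pt_unary polytime_const assms)

lemma pt_other_dens:
  assumes "polytime u" "polytime (\<lambda>e. una (r e))" "polytime (\<lambda>e. una (v e))"
  shows "polytime (\<lambda>e. bits (other_dens (cert_dims (u e)) (cert_num (u e) c) (r e) (v e)))"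
  unfolding other_dens_def
  by (intro pt_bits_prod pt_bits_if pt_eq pt_den pt_unary polytime_const
      polytime_comp[OF assms(1)] polytime_comp[OF assms(2)] polytime_comp[OF assms(3)] pt_env assms)

lemma pt_bin_eq:
  "polytime (\<lambda>e. bits (N e)) \<Longrightarrow> polytime (\<lambda>e. bits (M e)) \<Longrightarrow> polytime (\<lambda>e. [bin_eq (N e) (M e)])"
  unfolding bin_eq_def by (rule pt_bits_eq)

lemma pt_row_holds:
  assumes "polytime u" "polytime (\<lambda>e. una (r e))"
  shows "polytime (\<lambda>e. [row_holds (cert_dims (u e)) (cert_num (u e) a) (cert_num (u e) b) (cert_num (u e) c)
    (cert_sol (u e) a') (cert_sol (u e) b') (r e)])"
  unfolding row_holds_def
  by (intro pt_bin_eq pt_bits_sum pt_bits_add pt_bits_mult pt_num pt_other_dens pt_cert_sol pt_unary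
      polytime_comp[OF assms(1)] polytime_comp[OF assms(2)] pt_env assms)

lemma pt_enc_num:
  assumes "polytime (\<lambda>e. bits (p e))" "polytime (\<lambda>e. bits (q e))" "polytime (\<lambda>e. bits (b e))"
  shows "polytime (\<lambda>e. enc_num (p e) (q e) (b e))"
  unfolding enc_num_def
  by (intro pt_append polytime_pair pt_not pt_bin_eq pt_bits_add polytime_const assms)

lemma polytime_verify: "polytime (verify fx)"
proof -
  have "polytime (\<lambda>x. if valid fx (first x) (cert_dims (second x)) (cert_num (second x) 0) (cert_num (second x) 1)
      (cert_num (second x) 2) (cert_num (second x) 3) (cert_num (second x) 4) (cert_sol (second x) 0)
      (cert_sol (second x) 1) (cert_basis (second x)) then [True] else [])"
    unfolding valid_def
    by (intro pt_if pt_conj pt_disj pt_imp pt_not pt_all pt_list_eq pt_eq pt_bin_eq pt_una_card pt_row_holds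
        pt_append pt_concat pt_enc_num pt_cert_num pt_cert_sol pt_cert_basis pt_bits_mult pt_bits_add
        pt_unary polytime_const pt_env)
  then show ?thesis unfolding verify_def[abs_def] .
qed

section \<open>Length of the certificate and membership in NP\<close>

definition cert_count :: "nat \<Rightarrow> nat" where
  "cert_count l = 5 + (5 * Suc l + 2 * sys_bound l)"

text \<open>\<open>join\<close> doubles every string and adds one separator. Among the counted
  numbers are five for each of at most \<open>Suc l\<close> entries, including the constant
  1.\<close>

definition cert_bound :: "nat \<Rightarrow> nat" where
  "cert_bound l = cert_count l + 2 * (cert_count l * bit_bound l)"

lemma poly_bounded_cert_bound: "poly_bounded cert_bound"
proof -
  have "poly_bounded (\<lambda>l. cert_bound l)"
    unfolding cert_bound_def cert_count_def bit_bound_def sys_bound_def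
    by (intro poly_bounded_intros)
  then show ?thesis .
qed

lemma certificate:
  fixes F G :: "nat \<Rightarrow> nat \<Rightarrow> nat"
  assumes dims: "nrows d \<le> l" "ncols d \<le> l" "npars d \<le> l" "ncons d \<le> l" "offEnd d \<le> l" "sys_cols d \<le> sys_bound l"
    and F: "\<And>c x. F c x < 2 ^ bit_bound l" and G: "\<And>c v. G c v < 2 ^ bit_bound l"
    and F0: "\<And>c x. offEnd d < x \<Longrightarrow> F c x = (if c = 2 then 1 else 0)" and G0: "\<And>c v. sys_cols d \<le> v \<Longrightarrow> G c v = 0"
    and S: "\<And>j. ncols d \<le> j \<Longrightarrow> \<not> S j"
  shows "\<exists>u. length u \<le> cert_bound l \<and> cert_dims u = d \<and> (\<forall>c<5. cert_num u c = F c) \<and>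
    (\<forall>c<2. cert_sol u c = G c) \<and> cert_basis u = S"
proof -
  \<comment> \<open>The number of strings for the entries, counting position \<open>offEnd d\<close>
    as well; the solution starts behind them.\<close>
  define E where "E = 5 * Suc (offEnd d)"
  define xs where "xs = [una (nrows d), una (ncols d), una (npars d), una (ncons d), map S [0..<ncols d]] @
    map (\<lambda>i. bits (if i < E then F (i mod 5) (i div 5) else G ((i - E) mod 2) ((i - E) div 2))) [0..<E + 2 * sys_cols d]"
  define u where "u = join xs"
  have len: "length xs = 5 + (E + 2 * sys_cols d)" by (simp add: xs_def)
  have it: "item i u = xs ! i" if "i < length xs" for i using that by (simp add: u_def)
  have it4: "item 0 u = una (nrows d)" "item 1 u = una (ncols d)" "item 2 u = una (npars d)" "item 3 u = una (ncons d)"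
    "item 4 u = map S [0..<ncols d]"
    using it len by (simp_all add: xs_def)
  have d: "cert_dims u = d" unfolding cert_dims_def it4 by simp
  have it5: "item (5 + i) u = bits (if i < E then F (i mod 5) (i div 5) else G ((i - E) mod 2) ((i - E) div 2))"
    if "i < E + 2 * sys_cols d" for i
  proof -
    have "item (5 + i) u = xs ! (5 + i)" using that len by (intro it) simp
    also have "\<dots> = map (\<lambda>i. bits (if i < E then F (i mod 5) (i div 5) else G ((i - E) mod 2) ((i - E) div 2)))
        [0..<E + 2 * sys_cols d] ! i"
      unfolding xs_def by (simp add: nth_append)
    finally show ?thesis using that by simp
  qed
  have "cert_num u c x = F c x" if c: "c < 5" for c x
  proof (cases "x \<le> offEnd d")
    case True
    then have "c + 5 * x < E" using c by (simp add: E_def)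
    then show ?thesis using it5[of "c + 5 * x"] True c by (simp add: cert_num_def d)
  qed (simp add: cert_num_def d F0)
  moreover have "cert_sol u c v = G c v" if c: "c < 2" for c v
  proof (cases "v < sys_cols d")
    case True
    then have "E + (c + 2 * v) < E + 2 * sys_cols d" using c by simp
    from it5[OF this] show ?thesis using True c unfolding cert_sol_def d E_def[symmetric] by simp
  qed (simp add: cert_sol_def d G0)
  moreover have "cert_basis u j = S j" for j
    using S[of j] unfolding cert_basis_def it4 nth_bit_iff by (cases "j < ncols d") simp_all
  moreover have "length u \<le> cert_bound l"
  proof -
    have lb: "l \<le> bit_bound l" by (simp add: bit_bound_def)
    have "length x \<le> bit_bound l" if "x \<in> set xs" for x
      using that dims lb F G unfolding xs_def by (auto simp: length_bits_le_iff)
    then have "(\<Sum>x\<leftarrow>xs. length x) \<le> (\<Sum>x\<leftarrow>xs. bit_bound l)" by (intro sum_list_mono)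
    also have "\<dots> = length xs * bit_bound l" by (simp add: sum_list_triv)
    finally have "length u \<le> length xs + 2 * (length xs * bit_bound l)" by (simp add: u_def length_join)
    also have "length xs \<le> cert_count l" using dims by (simp add: len E_def cert_count_def)
    then have "length xs + 2 * (length xs * bit_bound l) \<le> cert_bound l"
      unfolding cert_bound_def by (intro add_mono mult_mono) auto
    finally show ?thesis .
  qed
  ultimately show ?thesis using d by (intro exI[of _ u] conjI allI impI ext)
qed

text \<open>The right-hand side of the Bezout identity is at least 1, so a denominator 0 is excluded
  without a separate test.\<close>

lemma valid_imp_pos:
  assumes "valid fx w d p q b \<mu> \<nu> zp zn S" "\<And>x. offEnd d < x \<Longrightarrow> b x = 1"
  shows "0 < b x"
proof (cases "offEnd d < x")
  case False
  then have "\<nu> x * b x = \<mu> x * (p x + q x) + 1"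
    using conjunct1[OF conjunct2[OF assms(1)[unfolded valid_def bin_eq_def]], THEN spec, THEN mp, of x] by simp
  then show ?thesis by (cases "b x") auto
qed (simp add: assms(2))

text \<open>The flag \<open>fx\<close> turns the test for \<open>C = 0\<close> on or off, so one
  verifier covers both problems.\<close>

theorem BILFP_in_NP: "BILFP_language (\<lambda>P. fx \<longrightarrow> fixed_objective P) \<in> NP"
proof -
  obtain Q :: "nat poly" where Q: "\<And>l. cert_bound l \<le> poly Q l" using poly_boundedE[OF poly_bounded_cert_bound] by blast
  show ?thesis
  proof (rule polytime_verifier_in_NP[OF polytime_verify[of fx], where q = Q])
    show "verify fx x = [True] \<or> verify fx x = []" for x by (simp add: verify_def)
    fix w
    show "w \<in> BILFP_language (\<lambda>P. fx \<longrightarrow> fixed_objective P) \<longleftrightarrow>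
        (\<exists>u. length u \<le> poly Q (length w) \<and> verify fx (pair w u) = [True])"
    proof
      assume "w \<in> BILFP_language (\<lambda>P. fx \<longrightarrow> fixed_objective P)"
      then obtain P where w: "w = encode P" and P: "is_instance P" "fx \<longrightarrow> fixed_objective P" "optimistic_BILFP P"
        unfolding BILFP_language_def by blast
      let ?l = "length (encode P)"
      obtain d p q b \<mu> \<nu> zp zn S where v: "valid fx (encode P) d p q b \<mu> \<nu> zp zn S"
        and dims: "nrows d \<le> ?l" "ncols d \<le> ?l" "npars d \<le> ?l" "ncons d \<le> ?l" "offEnd d \<le> ?l" "sys_cols d \<le> sys_bound ?l"
        and small: "\<forall>x. p x < 2 ^ bit_bound ?l \<and> q x < 2 ^ bit_bound ?l \<and> b x < 2 ^ bit_bound ?l \<and> \<mu> x < 2 ^ bit_bound ?l \<and>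
          \<nu> x < 2 ^ bit_bound ?l" "\<forall>v. zp v < 2 ^ bit_bound ?l \<and> zn v < 2 ^ bit_bound ?l"
        and out: "\<forall>x>offEnd d. p x = 0 \<and> q x = 0 \<and> b x = 1 \<and> \<mu> x = 0 \<and> \<nu> x = 0"
          "\<forall>v\<ge>sys_cols d. zp v = 0 \<and> zn v = 0" "\<forall>j\<ge>ncols d. \<not> S j"
        using valid_complete[OF P] by (elim exE conjE) (rule that; assumption)
      define F where "F c = (if c = 0 then p else if c = 1 then q else if c = 2 then b else if c = 3 then \<mu> else \<nu>)" for c :: nat
      define G where "G c = (if c = 0 then zp else zn)" for c :: nat
      have FG: "F c x < 2 ^ bit_bound ?l" "G c x < 2 ^ bit_bound ?l" for c x using small by (simp_all add: F_def G_def)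
      have F0: "F c x = (if c = 2 then 1 else 0)" if "offEnd d < x" for c x using out(1) that by (simp add: F_def)
      have G0: "G c x = 0" if "sys_cols d \<le> x" for c x using out(2) that by (simp add: G_def)
      have S0: "\<not> S j" if "ncols d \<le> j" for j using out(3) that by blast
      obtain u where u: "length u \<le> cert_bound ?l" "cert_dims u = d" "\<forall>c<5. cert_num u c = F c"
        "\<forall>c<2. cert_sol u c = G c" "cert_basis u = S"
        using certificate[where d = d and l = ?l and F = F and G = G and S = S, OF dims FG F0 G0 S0] by blast
      have "cert_num u 0 = p" "cert_num u 1 = q" "cert_num u 2 = b" "cert_num u 3 = \<mu>" "cert_num u 4 = \<nu>"
        "cert_sol u 0 = zp" "cert_sol u 1 = zn"
        using u(3,4) by (simp_all add: F_def G_def)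
      then have "verify fx (pair w u) = [True]"
        unfolding verify_def first_pair second_pair w by (simp only: u(2,5) v if_True)
      then show "\<exists>u. length u \<le> poly Q (length w) \<and> verify fx (pair w u) = [True]"
        using u(1) Q[of ?l] unfolding w by (meson order_trans)
    next
      assume "\<exists>u. length u \<le> poly Q (length w) \<and> verify fx (pair w u) = [True]"
      then obtain u where "verify fx (pair w u) = [True]" by blast
      then have v: "valid fx w (cert_dims u) (cert_num u 0) (cert_num u 1) (cert_num u 2) (cert_num u 3) (cert_num u 4)
          (cert_sol u 0) (cert_sol u 1) (cert_basis u)"
        unfolding verify_def by (simp split: if_splits)
      have "0 < cert_num u 2 x" for x by (rule valid_imp_pos[OF v]) (simp add: cert_num_def)
      from valid_sound[OF v this] show "w \<in> BILFP_language (\<lambda>P. fx \<longrightarrow> fixed_objective P)"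
        unfolding BILFP_language_def by blast
    qed
  qed
qed

theorem theorem6:
  shows "NP_complete (BILFP_language (\<lambda>P. True)) \<and>
    NP_complete (BILFP_language fixed_objective)"
proof -
  have "BILFP_language (\<lambda>P. True) \<in> NP" "BILFP_language fixed_objective \<in> NP"
    using BILFP_in_NP[of False] BILFP_in_NP[of True] by simp_all
  then show ?thesis
    using BILFP_NP_hard[of "\<lambda>P. True"] BILFP_NP_hard[of fixed_objective] gadget_instance(2)
    unfolding NP_complete_def by blast
qed

end
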